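(* Let $\mu,\nu,q\in\mathscr{P}_2(\mathbb{R}^d)$. Assume that $\mu\preceq_{\mathrm{c}}\nu$ and that $q$ does not give mass to small sets. Then the primal problem \[ P^{q}(\mu,\nu)\coloneqq\sup_{\pi\in\mathsf{MT}(\mu,\nu)}\int \mathrm{MCov}(\pi_x,q)\,\mu(dx) \] is uniquely attained (there is exactly one $\hat\pi\in\mathsf{MT}(\mu,\nu)$ achieving the supremum), its value $P^q(\mu,\nu)$ is finite, and \[ P^q(\mu,\nu)=D^{q}(\mu,\nu)\coloneqq\inf_{\substack{\psi\in L^1(\nu),\\ \psi \text{ convex}}}\Big(\int\psi\,d\nu-\int(\psi^{\ast}\star q)^{\ast}\,d\mu\Big). \]
   Context: $\mathscr{P}_2(\mathbb{R}^d)$ is the set of Borel probability measures on $\mathbb{R}^d$ with finite second moment. $\mu\preceq_{\mathrm{c}}\nu$ (convex order) means $\int f\,d\mu\le\int f\,d\nu$ for all convex $f:\mathbb{R}^d\to\mathbb{R}$. A measure $q$ does not give mass to small sets if $q(A)=0$ for every measurable $A\subseteq\mathbb{R}^d$ of Hausdorff dimension at most $d-1$. For $\rho,\varrho\in\mathscr{P}_2(\mathbb{R}^d)$, $\mathrm{MCov}(\rho,\varrho)\coloneqq\sup_{\tilde\pi\in\mathsf{Cpl}(\rho,\varrho)}\int\langle y,z\rangle\,\tilde\pi(dy,dz)$, where $\mathsf{Cpl}(\rho,\varrho)$ is the set of couplings of $\rho$ and $\varrho$. $\mathsf{MT}(\mu,\nu)$ is the set of martingale transports: couplings $\pi\in\mathsf{Cpl}(\mu,\nu)$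 with disintegration $\pi(dx,dy)=\pi_x(dy)\mu(dx)$ such that $\int y\,\pi_x(dy)=x$ for $\mu$-a.e. $x$. For $\psi:\mathbb{R}^d\to(-\infty,+\infty]$, $\psi^\ast(x)\coloneqq\sup_{y}(\langle x,y\rangle-\psi(y))$ is the convex conjugate. For a function $f$ and a probability measure $\varrho$, $(f\star\varrho)(y)\coloneqq\int f(y+z)\,\varrho(dz)$. *)

theory Defs
  imports "HOL-Analysis.Analysis" "HOL-Probability.Probability"
begin

definition P2 :: "'a::euclidean_space measure \<Rightarrow> bool" where
  "P2 M \<longleftrightarrow> prob_space M \<and> sets M = sets borel \<and> integrable M (\<lambda>x. (norm x)^2)"

definition eint :: "'a measure \<Rightarrow> ('a \<Rightarrow> ereal) \<Rightarrow> ereal" where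
  "eint M f = enn2ereal (\<integral>\<^sup>+ x. e2ennreal (f x) \<partial>M) - enn2ereal (\<integral>\<^sup>+ x. e2ennreal (- f x) \<partial>M)"

definition convex_order :: "'a::euclidean_space measure \<Rightarrow> 'a measure \<Rightarrow> bool" where
  "convex_order \<mu> \<nu> \<longleftrightarrow>
     (\<forall>f::'a \<Rightarrow> real. convex_on UNIV f \<longrightarrow> eint \<mu> (\<lambda>x. ereal (f x)) \<le> eint \<nu> (\<lambda>x. ereal (f x)))"

definition hausdorff_content :: "real \<Rightarrow> real \<Rightarrow> 'a::metric_space set \<Rightarrow> ennreal" where
  "hausdorff_content \<delta> s A =
     Inf {(\<Sum>i. ennreal (diameter (C i) powr s)) | C :: nat \<Rightarrow> 'a set.
            A \<subseteq> (\<Union>i. C i) \<and> (\<forall>i. bounded (C i) \<and> diameter (C i) \<le> \<delta>)}"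

definition hausdorff_measure :: "real \<Rightarrow> 'a::metric_space set \<Rightarrow> ennreal" where
  "hausdorff_measure s A = (SUP \<delta>\<in>{0<..}. hausdorff_content \<delta> s A)"

definition hausdorff_dim :: "'a::metric_space set \<Rightarrow> real" where
  "hausdorff_dim A = Inf {s. 0 \<le> s \<and> hausdorff_measure s A = 0}"

definition no_mass_small_sets :: "'a::euclidean_space measure \<Rightarrow> bool" where
  "no_mass_small_sets q \<longleftrightarrow>
     (\<forall>A \<in> sets q. hausdorff_dim A \<le> real DIM('a) - 1 \<longrightarrow> emeasure q A = 0)"

definition Cpl :: "'a::euclidean_space measure \<Rightarrow> 'a measure \<Rightarrow> ('a \<times> 'a) measure set" where
  "Cpl \<rho> \<sigma> = {\<pi>. sets \<pi> = sets (borel :: ('a \<times> 'a) measure) \<and>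
                    distr \<pi> borel fst = \<rho> \<and> distr \<pi> borel snd = \<sigma>}"

definition MCov :: "'a::euclidean_space measure \<Rightarrow> 'a measure \<Rightarrow> ereal" where
  "MCov \<rho> \<sigma> = (SUP \<pi>\<in>Cpl \<rho> \<sigma>. ereal (\<integral>p. fst p \<bullet> snd p \<partial>\<pi>))"

(* martingale transports, represented through their disintegration kernel x \<mapsto> \<pi>_x *)
definition MT_kernels :: "'a::euclidean_space measure \<Rightarrow> 'a measure \<Rightarrow> ('a \<Rightarrow> 'a measure) set" where
  "MT_kernels \<mu> \<nu> = {K. K \<in> measurable \<mu> (prob_algebra borel) \<and> bind \<mu> K = \<nu> \<and>
       (AE x in \<mu>. integrable (K x) (\<lambda>y. y) \<and> (\<integral>y. y \<partial>(K x)) = x)}"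

definition joint :: "'a::euclidean_space measure \<Rightarrow> ('a \<Rightarrow> 'a measure) \<Rightarrow> ('a \<times> 'a) measure" where
  "joint \<mu> K = bind \<mu> (\<lambda>x. distr (K x) (borel :: ('a \<times> 'a) measure) (Pair x))"

definition primal_obj :: "'a::euclidean_space measure \<Rightarrow> 'a measure \<Rightarrow> ('a \<Rightarrow> 'a measure) \<Rightarrow> ereal" where
  "primal_obj q \<mu> K = eint \<mu> (\<lambda>x. MCov (K x) q)"

definition Pq :: "'a::euclidean_space measure \<Rightarrow> 'a measure \<Rightarrow> 'a measure \<Rightarrow> ereal" where
  "Pq q \<mu> \<nu> = (SUP K\<in>MT_kernels \<mu> \<nu>. primal_obj q \<mu> K)"

definition conj :: "('a::euclidean_space \<Rightarrow> ereal) \<Rightarrow> 'a \<Rightarrow> ereal" where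
  "conj \<psi> x = (SUP y. ereal (x \<bullet> y) - \<psi> y)"

definition conv_meas :: "('a::euclidean_space \<Rightarrow> ereal) \<Rightarrow> 'a measure \<Rightarrow> 'a \<Rightarrow> ereal" where
  "conv_meas f \<rho> y = eint \<rho> (\<lambda>z. f (y + z))"

definition econvex :: "('a::euclidean_space \<Rightarrow> ereal) \<Rightarrow> bool" where
  "econvex \<psi> \<longleftrightarrow> (\<forall>x. \<psi> x \<noteq> -\<infinity>) \<and>
     (\<forall>x y. \<forall>t::real. 0 \<le> t \<and> t \<le> 1 \<longrightarrow>
        \<psi> ((1 - t) *\<^sub>R x + t *\<^sub>R y) \<le> ereal (1 - t) * \<psi> x + ereal t * \<psi> y)"

definition L1e :: "'a measure \<Rightarrow> ('a \<Rightarrow> ereal) \<Rightarrow> bool" where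
  "L1e \<nu> \<psi> \<longleftrightarrow> (AE y in \<nu>. \<bar>\<psi> y\<bar> \<noteq> \<infinity>) \<and> integrable \<nu> (\<lambda>y. real_of_ereal (\<psi> y))"

definition Dq :: "'a::euclidean_space measure \<Rightarrow> 'a measure \<Rightarrow> 'a measure \<Rightarrow> ereal" where
  "Dq q \<mu> \<nu> = (INF \<psi>\<in>{\<psi>. L1e \<nu> \<psi> \<and> econvex \<psi>}.
       ereal (\<integral>y. real_of_ereal (\<psi> y) \<partial>\<nu>) - eint \<mu> (conj (conv_meas (conj \<psi>) q)))"

end

theory Submission
  imports Defs
begin

text \<open>
  Lift the problem to laws \<open>P\<close> of triples \<open>(x, y, z)\<close> under which \<open>(x, z)\<close> has law \<open>\<mu> \<Otimes> q\<close>, \<open>y\<close> has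
  law \<open>\<nu>\<close> and \<open>E[y | x] = x\<close>, and maximise the linear functional \<open>E[y \<bullet> z]\<close>. The linear-programming
  dual consists of continuous \<open>\<phi>, h, \<xi>\<close> with \<open>y \<bullet> z \<le> \<phi> y + h x \<bullet> (y - x) + \<xi> (x, z)\<close>. There is no
  duality gap and the primal is attained, because measures satisfying finitely many constraints
  approximately with nearly the dual value exist (a penalisation argument) and are tight. The convex
  order makes the dual value finite, so that Strassen's theorem is a by-product. Every dual feasible
  triple yields the convex function \<open>\<psi> y = sup (y \<bullet> (z - h x) + h x \<bullet> x - \<xi> (x, z))\<close> over \<open>x, z\<close>, which
  is no worse in \<open>Dq\<close>, and disintegrating \<open>P\<close> along \<open>x\<close> yields a martingale kernel that is no worse
  in \<open>Pq\<close>; weak duality closes the circle.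

  For uniqueness, an optimal kernel lifts to an optimal \<open>P\<close>. Along a minimising sequence of the dual
  the nonnegative gaps tend to zero \<open>P\<close>-almost surely, and for fixed \<open>x\<close> the pairs \<open>(y, z)\<close> at which
  they do form a monotone relation. Such a relation is multivalued only over a set of \<open>z\<close> of
  dimension at most \<open>d - 1\<close>, which \<open>q\<close> does not charge. So \<open>y\<close> is a function of \<open>(x, z)\<close>, the same
  one for any two optimal \<open>P\<close>.
\<close>

text \<open>\<open>MCov (K x) q\<close> is itself a supremum, so \<open>primal_obj\<close> is not
  linear in the kernel, and a direct argument would have to select optimal couplings measurably in
  x. Over laws of triples the objective is linear, and prescribing a product as the law of (x, z)
  makes almost every conditional law given x a coupling of \<open>K x\<close> and q. The price is a
  lack of compactness: only second moments are available, while the objective has quadratic growth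
  as well. Therefore all test functions grow at most quadratically, and functions dominating the
  tails of the squared norm are placed among the constraints, which makes approximate solutions
  uniformly integrable. A Schoenberg curve with a Borel right inverse reduces both the extraction of
  weak limits and the construction of conditional laws to the real line. The dual value is bounded
  below because the term with h vanishes at y = x; this is where the convex order enters. In the
  uniqueness part two points over the same x exchange their z, so that \<phi>, h and \<xi> cancel.
  Monotonicity is thus fibrewise only, and the exceptional set is estimated section by section under
  \<open>\<mu> \<Otimes>\<^sub>M q\<close>.\<close>

section \<open>A continuous surjection from the line\<close>

text \<open>The plateau function behind Schoenberg's space-filling curve: 2-periodic, 0 on [0, 1/3]
  and 1 on [2/3, 1]. A clamped cosine replaces the usual piecewise linear function, so that
  continuity and periodicity are inherited from \<open>cos\<close>.\<close>

definition schoenberg_digit :: "real \<Rightarrow> real" where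
  "schoenberg_digit t = max 0 (min 1 (1/2 - cos (pi * t)))"

lemma schoenberg_digit_bounds: "0 \<le> schoenberg_digit t" "schoenberg_digit t \<le> 1"
  by (auto simp: schoenberg_digit_def)

lemma continuous_schoenberg_digit: "continuous_on UNIV schoenberg_digit"
  unfolding schoenberg_digit_def by (intro continuous_intros)

lemma schoenberg_digit_add_even: "schoenberg_digit (2 * of_int k + t) = schoenberg_digit t"
proof -
  have "cos (pi * (2 * of_int k + t)) = cos (pi * t)"
    using cos.plus_of_int[of "pi * t" k] by (simp add: algebra_simps)
  then show ?thesis by (simp add: schoenberg_digit_def)
qed

lemma schoenberg_digit_low:
  assumes "0 \<le> t" "t \<le> 1/3"
  shows "schoenberg_digit t = 0"
proof -
  have "cos (pi / 3) \<le> cos (pi * t)"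
    using assms by (intro cos_monotone_0_pi_le) (auto simp: field_simps)
  then show ?thesis by (simp add: schoenberg_digit_def cos_60)
qed

lemma schoenberg_digit_high:
  assumes "2/3 \<le> t" "t \<le> 1"
  shows "schoenberg_digit t = 1"
proof -
  have "cos (pi * t) \<le> cos (2 / 3 * pi)"
    using assms by (intro cos_monotone_0_pi_le) (auto simp: field_simps)
  also have "\<dots> = - (1/2)"
    using cos_pi_minus[of "pi / 3"] by (simp add: cos_60 field_simps)
  finally show ?thesis by (simp add: schoenberg_digit_def)
qed

lemma
  fixes c :: "nat \<Rightarrow> nat"
  assumes c: "\<And>k. c k \<le> 1"
  shows summable_ternary: "summable (\<lambda>k. 2 * real (c k) / 3 ^ Suc k)"
    and ternary_sum_bounds: "0 \<le> (\<Sum>k. 2 * real (c k) / 3 ^ Suc k)" "(\<Sum>k. 2 * real (c k) / 3 ^ Suc k) \<le> 1"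
proof -
  have g: "(\<lambda>k. 2 * (1/3::real) ^ Suc k) sums 1"
    using sums_mult[OF geometric_sums[of "1/3::real"], of "2/3"] by (simp add: field_simps)
  have fb: "0 \<le> 2 * real (c k) / 3 ^ Suc k" "2 * real (c k) / 3 ^ Suc k \<le> 2 * (1/3) ^ Suc k" for k
    using c[of k] by (auto simp: field_simps)
  show summ: "summable (\<lambda>k. 2 * real (c k) / 3 ^ Suc k)"
    by (rule summable_comparison_test'[OF sums_summable[OF g], of 0]) (use fb in auto)
  show "0 \<le> (\<Sum>k. 2 * real (c k) / 3 ^ Suc k)" "(\<Sum>k. 2 * real (c k) / 3 ^ Suc k) \<le> 1"
    using suminf_nonneg[OF summ] suminf_le[OF fb(2) summ sums_summable[OF g]] fb sums_unique[OF g]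
    by auto
qed

text \<open>Multiplying the base-3 number with digits \<open>2 * c k\<close> by \<open>3 ^ j\<close> leaves, modulo 2, a
  number whose leading digit is \<open>2 * c j\<close>.\<close>

lemma schoenberg_digit_ternary:
  fixes c :: "nat \<Rightarrow> nat"
  assumes c: "\<And>k. c k \<le> 1"
  shows "schoenberg_digit (3 ^ j * (\<Sum>k. 2 * real (c k) / 3 ^ Suc k)) = real (c j)"
proof -
  let ?f = "\<lambda>k. 2 * real (c k) / 3 ^ Suc k"
  have summ: "summable (\<lambda>k. 2 * real (c (k + i)) / 3 ^ Suc k)" for i
    by (rule summable_ternary[OF c])
  note tail = ternary_sum_bounds[of "\<lambda>k. c (k + i)" for i, OF c]
  have "(\<Sum>k. ?f k) = (\<Sum>k. ?f (k + j)) + (\<Sum>k<j. ?f k)"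
    using suminf_split_initial_segment[of ?f j] summ[of 0] by simp
  also have "(\<Sum>k. ?f (k + j)) = (\<Sum>k. 2 * real (c (k + j)) / 3 ^ Suc k) / 3 ^ j"
    using suminf_divide[OF summ[of j], of "3 ^ j"] by (simp add: power_add field_simps)
  also have "(\<Sum>k. 2 * real (c (k + j)) / 3 ^ Suc k) = 
      (\<Sum>k. 2 * real (c (k + Suc j)) / 3 ^ Suc (Suc k)) + 2 * real (c j) / 3"
    using suminf_split_initial_segment[OF summ[of j], of 1] by simp
  also have "(\<Sum>k. 2 * real (c (k + Suc j)) / 3 ^ Suc (Suc k)) = 
      (\<Sum>k. 2 * real (c (k + Suc j)) / 3 ^ Suc k) / 3"
    using suminf_divide[OF summ[of "Suc j"], of 3] by (simp add: field_simps)
  finally have eq: "3 ^ j * (\<Sum>k. ?f k) = 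
     3 ^ j * (\<Sum>k<j. ?f k) + ((\<Sum>k. 2 * real (c (k + Suc j)) / 3 ^ Suc k) / 3 + 2 * real (c j) / 3)"
    by (simp add: field_simps)
  have "3 ^ j * (\<Sum>k<j. ?f k) = (\<Sum>k<j. 2 * of_int (int (c k * 3 ^ (j - Suc k))))"
    unfolding sum_distrib_left
  proof (intro sum.cong refl)
    fix k assume "k \<in> {..<j}"
    then have "(3::real) ^ j = 3 ^ (j - Suc k) * 3 ^ Suc k"
      by (simp del: power_Suc flip: power_add)
    then show "3 ^ j * ?f k = 2 * of_int (int (c k * 3 ^ (j - Suc k)))"
      by simp
  qed
  also have "\<dots> = 2 * of_int (\<Sum>k<j. int (c k * 3 ^ (j - Suc k)))"
    by (simp add: sum_distrib_left)
  finally have eq2: "3 ^ j * (\<Sum>k<j. ?f k) = 2 * of_int (\<Sum>k<j. int (c k * 3 ^ (j - Suc k)))" .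
  consider "c j = 0" | "c j = 1" using c[of j] by linarith
  then show ?thesis
  proof cases
    case 1
    then show ?thesis
      unfolding eq eq2 schoenberg_digit_add_even
      using tail[of "Suc j"] by (subst schoenberg_digit_low) auto
  next
    case 2
    then show ?thesis
      unfolding eq eq2 schoenberg_digit_add_even
      using tail[of "Suc j"] by (subst schoenberg_digit_high) auto
  qed
qed

text \<open>The digits are increments of the dyadic floor approximations of y, so the series
  telescopes. The condition y < 1 makes the initial floor 0.\<close>

lemma binary_expansion:
  fixes y :: real
  assumes "0 \<le> y" "y < 1"
  obtains d :: "nat \<Rightarrow> nat" where "\<And>k. d k \<le> 1" "(\<lambda>k. real (d k) / 2 ^ Suc k) sums y"
proof
  define d where "d k = nat (\<lfloor>2 ^ Suc k * y\<rfloor> - 2 * \<lfloor>2 ^ k * y\<rfloor>)" for k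
  have dd: "0 \<le> \<lfloor>2 ^ Suc k * y\<rfloor> - 2 * \<lfloor>2 ^ k * y\<rfloor>" "\<lfloor>2 ^ Suc k * y\<rfloor> - 2 * \<lfloor>2 ^ k * y\<rfloor> \<le> 1" for k
    by (simp_all, linarith+)
  show "d k \<le> 1" for k
    using dd[of k] by (simp add: d_def)
  have rd: "real (d k) / 2 ^ Suc k = of_int \<lfloor>2 ^ Suc k * y\<rfloor> / 2 ^ Suc k - of_int \<lfloor>2 ^ k * y\<rfloor> / 2 ^ k" for k
    using dd(1)[of k] by (simp add: d_def field_simps)
  have fl: "(\<lambda>k. of_int \<lfloor>2 ^ k * y\<rfloor> / 2 ^ k) \<longlonglongrightarrow> y"
  proof (rule tendsto_sandwich)
    show "\<forall>\<^sub>F k in sequentially. y - (1/2) ^ k \<le> of_int \<lfloor>2 ^ k * y\<rfloor> / 2 ^ k"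
    proof (intro always_eventually allI)
      fix k show "y - (1/2) ^ k \<le> of_int \<lfloor>2 ^ k * y\<rfloor> / 2 ^ k"
      proof (subst pos_le_divide_eq)
        have "(y - (1/2) ^ k) * 2 ^ k = 2 ^ k * y - 1"
          by (simp add: algebra_simps power_divide)
        then show "(y - (1/2) ^ k) * 2 ^ k \<le> of_int \<lfloor>2 ^ k * y\<rfloor>"
          using floor_correct[of "2 ^ k * y"] by linarith
      qed simp
    qed
    show "\<forall>\<^sub>F k in sequentially. of_int \<lfloor>2 ^ k * y\<rfloor> / 2 ^ k \<le> y"
      by (intro always_eventually allI) (simp add: field_simps)
    show "(\<lambda>k. y - (1/2) ^ k) \<longlonglongrightarrow> y"
      by (rule tendsto_eq_intros LIMSEQ_power_zero | simp)+
  qed simp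
  show "(\<lambda>k. real (d k) / 2 ^ Suc k) sums y"
  proof -
    have "\<lfloor>y\<rfloor> = 0" using assms by linarith
    then show ?thesis
      unfolding rd using telescope_sums[OF fl] by simp
  qed
qed

text \<open>Half of t minus half of the triangle wave with period 2: a continuous function with
  value k on [2k, 2k + 1] that climbs from k to k + 1 on [2k + 1, 2k + 2]. It serves as the scale of
  the curve, constant while a whole cube is being filled.\<close>

definition staircase :: "real \<Rightarrow> real" where
  "staircase t = t / 2 - arccos (cos (pi * t)) / (2 * pi)"

lemma continuous_staircase: "continuous_on UNIV staircase"
  unfolding staircase_def by (intro continuous_intros) auto

lemma staircase_flat:
  assumes "2 * real k \<le> t" "t \<le> 2 * real k + 1"
  shows "staircase t = real k"
proof -
  have "cos (pi * t) = cos (pi * (t - 2 * real k))"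
    using cos.plus_of_nat[of "pi * (t - 2 * real k)" k] by (simp add: algebra_simps)
  moreover have "arccos (cos (pi * (t - 2 * real k))) = pi * (t - 2 * real k)"
    using assms mult_left_mono[of "t - 2 * real k" 1 pi] by (intro arccos_cos) auto
  ultimately show ?thesis
    by (simp add: staircase_def field_simps)
qed

lemma continuous_schoenberg_series:
  fixes a :: "nat \<Rightarrow> real"
  shows "continuous_on UNIV (\<lambda>t. \<Sum>k. schoenberg_digit (a k * t) / 2 ^ Suc k)"
proof -
  have "uniform_limit UNIV (\<lambda>n t. \<Sum>k<n. schoenberg_digit (a k * t) / 2 ^ Suc k)
      (\<lambda>t. \<Sum>k. schoenberg_digit (a k * t) / 2 ^ Suc k) sequentially"
  proof (rule Weierstrass_m_test)
    show "norm (schoenberg_digit (a n * x) / 2 ^ Suc n) \<le> (1/2) ^ Suc n" for n x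
      using schoenberg_digit_bounds[of "a n * x"] by (simp add: field_simps)
    show "summable (\<lambda>n. (1/2::real) ^ Suc n)"
      using summable_geometric[of "1/2::real"] by (simp add: summable_mult)
  qed
  then show ?thesis
  proof (rule uniform_limit_theorem[rotated])
    have "continuous_on UNIV (\<lambda>t. schoenberg_digit (a k * t))" for k
      by (rule continuous_on_compose2[OF continuous_schoenberg_digit]) (auto intro!: continuous_intros)
    then show "\<forall>\<^sub>F n in sequentially. continuous_on UNIV (\<lambda>t. \<Sum>k<n. schoenberg_digit (a k * t) / 2 ^ Suc k)"
      by (intro always_eventually allI continuous_on_sum continuous_on_divide continuous_on_const) auto
  qed simp
qed

text \<open>On [2k, 2k + 1] the curve is k times a Schoenberg curve in the cube with coordinates in
  [-1, 1]. The bound on t is what makes bounded sets images of bounded intervals, as tightness will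
  require.\<close>

lemma continuous_surjection_from_real:
  obtains \<gamma> :: "real \<Rightarrow> 'e::euclidean_space"
  where "continuous_on UNIV \<gamma>"
    and "\<And>k y. (\<And>b. b \<in> Basis \<Longrightarrow> \<bar>y \<bullet> b\<bar> < real k) \<Longrightarrow> \<exists>t. 0 \<le> t \<and> t \<le> 2 * real k + 1 \<and> \<gamma> t = y"
proof -
  let ?n = "DIM('e)"
  obtain idx :: "'e \<Rightarrow> nat" where idx: "bij_betw idx Basis {..<?n}"
    using ex_bij_betw_finite_nat[OF finite_Basis] by (auto simp: atLeast0LessThan)
  \<comment> \<open>Coordinate b reads its binary digits at the ternary positions congruent to
    \<open>idx b\<close> modulo the dimension.\<close>
  define x where "x b t = (\<Sum>k. schoenberg_digit (3 ^ (?n * k + idx b) * t) / 2 ^ Suc k)" for b :: 'e and t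
  define \<gamma> where "\<gamma> t = (\<Sum>b\<in>Basis. (staircase t * (2 * x b t - 1)) *\<^sub>R b)" for t
  have "continuous_on UNIV (x b)" for b
    unfolding x_def by (rule continuous_schoenberg_series)
  then have cont: "continuous_on UNIV \<gamma>"
    unfolding \<gamma>_def by (intro continuous_intros continuous_staircase)
  show thesis
  proof (rule that[OF cont])
    fix k :: nat and y :: 'e
    assume y: "\<And>b. b \<in> Basis \<Longrightarrow> \<bar>y \<bullet> b\<bar> < real k"
    have k: "0 < real k"
      using y[OF SOME_Basis] by linarith
    have "\<exists>d. (\<forall>j. d j \<le> 1) \<and> (\<lambda>j. real (d j) / 2 ^ Suc j) sums ((y \<bullet> b / real k + 1) / 2)"
      if "b \<in> Basis" for b
    proof -
      have "0 \<le> (y \<bullet> b / real k + 1) / 2" "(y \<bullet> b / real k + 1) / 2 < 1"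
        using y[OF that] k by (auto simp: field_simps)
      then show ?thesis using binary_expansion by metis
    qed
    then obtain d :: "'e \<Rightarrow> nat \<Rightarrow> nat" where d: "\<And>b j. b \<in> Basis \<Longrightarrow> d b j \<le> 1"
      "\<And>b. b \<in> Basis \<Longrightarrow> (\<lambda>j. real (d b j) / 2 ^ Suc j) sums ((y \<bullet> b / real k + 1) / 2)"
      by metis
    \<comment> \<open>The binary expansions of all coordinates are interleaved into one digit
      sequence.\<close>
    define c where "c m = d (the_inv_into Basis idx (m mod ?n)) (m div ?n)" for m
    have c1: "c m \<le> 1" for m
    proof -
      have "the_inv_into Basis idx (m mod ?n) \<in> Basis"
        using idx by (intro the_inv_into_into) (auto simp: bij_betw_def)
      then show ?thesis using d(1) by (simp add: c_def)
    qed
    have c2: "c (?n * j + idx b) = d b j" if "b \<in> Basis" for b j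
    proof -
      have "idx b < ?n" using idx that by (auto simp: bij_betw_def)
      then show ?thesis
        using idx that by (simp add: c_def the_inv_into_f_f bij_betw_def)
    qed
    define s where "s = (\<Sum>k. 2 * real (c k) / 3 ^ Suc k)"
    have s: "0 \<le> s" "s \<le> 1" using ternary_sum_bounds[OF c1] by (auto simp: s_def)
    have xb: "x b (2 * real k + s) = (y \<bullet> b / real k + 1) / 2" if b: "b \<in> Basis" for b
    proof -
      have "schoenberg_digit (3 ^ (?n * j + idx b) * (2 * real k + s)) = real (d b j)" for j
      proof -
        \<comment> \<open>The offset 2k contributes an even integer after multiplication by a power
          of 3, so the digits are those of s.\<close>
        have "3 ^ (?n * j + idx b) * (2 * real k + s) =
            2 * of_int (3 ^ (?n * j + idx b) * int k) + 3 ^ (?n * j + idx b) * s"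
          by (simp add: algebra_simps)
        then show ?thesis
          using schoenberg_digit_ternary[OF c1] c2[OF b] by (simp only: schoenberg_digit_add_even s_def)
      qed
      then show ?thesis
        using sums_unique[OF d(2)[OF b]] by (simp add: x_def)
    qed
    have "\<gamma> (2 * real k + s) = (\<Sum>b\<in>Basis. (y \<bullet> b) *\<^sub>R b)"
      unfolding \<gamma>_def
    proof (intro sum.cong refl)
      fix b :: 'e assume b: "b \<in> Basis"
      have "staircase (2 * real k + s) = real k" using s by (intro staircase_flat) auto
      then show "(staircase (2 * real k + s) * (2 * x b (2 * real k + s) - 1)) *\<^sub>R b = (y \<bullet> b) *\<^sub>R b"
        using k by (simp add: xb[OF b]) (simp add: field_simps)
    qed
    then have "\<gamma> (2 * real k + s) = y"
      by (simp add: euclidean_representation)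
    then show "\<exists>t. 0 \<le> t \<and> t \<le> 2 * real k + 1 \<and> \<gamma> t = y"
      using s by (intro exI[of _ "2 * real k + s"]) auto
  qed
qed

text \<open>The section picks the least admissible parameter. Its sublevel sets are the compact
  images of the intervals [0, t], whence it is Borel. Measures are carried to the line by e and back
  by \<gamma>; continuity is only required of \<gamma>, since test functions are composed with
  it.\<close>

lemma continuous_surjection_with_measurable_section:
  obtains \<gamma> :: "real \<Rightarrow> 'e::euclidean_space" and e :: "'e \<Rightarrow> real"
  where "continuous_on UNIV \<gamma>" "e \<in> borel_measurable borel" "\<And>y. \<gamma> (e y) = y"
    "\<And>y. 0 \<le> e y" "\<And>y k. norm y < real k \<Longrightarrow> e y \<le> 2 * real k + 1"
proof -
  obtain \<gamma> :: "real \<Rightarrow> 'e" where cont: "continuous_on UNIV \<gamma>"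
    and surj: "\<And>k y. (\<And>b. b \<in> Basis \<Longrightarrow> \<bar>y \<bullet> b\<bar> < real k) \<Longrightarrow> \<exists>t. 0 \<le> t \<and> t \<le> 2 * real k + 1 \<and> \<gamma> t = y"
    using continuous_surjection_from_real by blast
  have surj': "\<exists>t. 0 \<le> t \<and> t \<le> 2 * real k + 1 \<and> \<gamma> t = y" if "norm y < real k" for y k
    by (rule surj) (use that Basis_le_norm le_less_trans in blast)
  define T where "T y = {t. 0 \<le> t \<and> \<gamma> t = y}" for y
  define e where "e y = Inf (T y)" for y
  have bdd: "bdd_below (T y)" for y by (auto simp: T_def)
  have ne: "T y \<noteq> {}" for y
    using surj'[of y] reals_Archimedean2[of "norm y"] by (auto simp: T_def)
  have "closed (T y)" for y
  proof -
    have "T y = {0..} \<inter> \<gamma> -` {y}" by (auto simp: T_def)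
    then show ?thesis using continuous_closed_vimage[of "{y}" \<gamma>] cont
      by (auto simp: continuous_on_eq_continuous_at)
  qed
  then have eT: "e y \<in> T y" for y
    unfolding e_def by (intro closed_contains_Inf ne bdd)
  have le: "e y \<le> t \<longleftrightarrow> y \<in> \<gamma> ` {0..t}" for y t
  proof
    assume "e y \<le> t" then show "y \<in> \<gamma> ` {0..t}"
      using eT[of y] by (auto simp: T_def image_iff intro!: bexI[of _ "e y"])
  next
    assume "y \<in> \<gamma> ` {0..t}"
    then obtain s where "s \<in> T y" "s \<le> t" by (auto simp: T_def)
    then show "e y \<le> t" using cInf_lower[OF _ bdd, of s y] by (simp add: e_def)
  qed
  have meas: "e \<in> borel_measurable borel"
  proof (rule borel_measurable_iff_le[THEN iffD2], intro allI)
    fix t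
    have "{w \<in> space borel. e w \<le> t} = \<gamma> ` {0..t}" by (auto simp: le)
    moreover have "compact (\<gamma> ` {0..t})"
      by (intro compact_continuous_image continuous_on_subset[OF cont]) auto
    ultimately show "{w \<in> space borel. e w \<le> t} \<in> sets borel"
      by (simp add: borel_compact)
  qed
  show thesis
  proof (rule that[OF cont meas])
    show "\<gamma> (e y) = y" "0 \<le> e y" for y using eT[of y] by (auto simp: T_def)
    show "e y \<le> 2 * real k + 1" if "norm y < real k" for y k
      using surj'[OF that] le[of y "2 * real k + 1"] by auto
  qed
qed

section \<open>Weak convergence\<close>

text \<open>A countable determining class turns the equality of two laws into countably many linear
  constraints. It covers all finite measures because it is also applied to densities of positive and
  negative parts.\<close>

definition separates_measures :: "(nat \<Rightarrow> 'e::euclidean_space \<Rightarrow> real) \<Rightarrow> bool" where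
  "separates_measures f \<longleftrightarrow> (\<forall>M N. finite_measure M \<longrightarrow> finite_measure N \<longrightarrow> sets M = sets borel \<longrightarrow>
     sets N = sets borel \<longrightarrow> (\<forall>n. (\<integral>x. f n x \<partial>M) = (\<integral>x. f n x \<partial>N)) \<longrightarrow> M = N)"

text \<open>Finite intersections of a countable basis form a countable \<pi>-system of open sets
  that generates the Borel sets; the indicator of each of them is a pointwise limit of truncated
  multiples of the distance to the complement.\<close>

lemma separating_family_of_continuous_functions:
  obtains f :: "nat \<Rightarrow> 'e::euclidean_space \<Rightarrow> real"
  where "\<And>n. continuous_on UNIV (f n)" "\<And>n x. 0 \<le> f n x" "\<And>n x. f n x \<le> 1"
    "separates_measures f"
proof -
  obtain B :: "'e set set" where B: "countable B" "topological_basis B"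
    using ex_countable_basis by auto
  define I where "I = Inter ` {F. finite F \<and> F \<subseteq> B}"
  have Icount: "countable I"
    unfolding I_def using B by (intro countable_image countable_Collect_finite_subset)
  have IUNIV: "UNIV \<in> I"
    unfolding I_def by (auto intro!: image_eqI[of _ _ "{}"])
  have Iopen: "open U" if "U \<in> I" for U
    using that topological_basis_open[OF B(2)] unfolding I_def by auto
  have Istable: "Int_stable I"
  proof (rule Int_stableI)
    fix a b assume "a \<in> I" "b \<in> I"
    then obtain F G where "a = \<Inter>F" "b = \<Inter>G" "finite F" "F \<subseteq> B" "finite G" "G \<subseteq> B"
      unfolding I_def by auto
    then show "a \<inter> b \<in> I"
      unfolding I_def by (auto intro!: image_eqI[of _ _ "F \<union> G"])
  qed
  have sig: "sets borel = sigma_sets UNIV I"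
  proof
    have "B \<subseteq> I" unfolding I_def by (auto intro!: image_eqI[of _ _ "{_}"])
    then show "sets (borel :: 'e measure) \<subseteq> sigma_sets UNIV I"
      unfolding borel_eq_countable_basis[OF B] by (simp add: sigma_sets_mono')
    show "sigma_sets UNIV I \<subseteq> sets borel"
      using Iopen by (intro sets.sigma_sets_subset[of I borel, simplified]) auto
  qed
  \<comment> \<open>The whole space is treated separately because \<open>infdist\<close> to the
    empty set is 0.\<close>
  define g where "g U k x = (if U = UNIV then 1 else min 1 (real k * infdist x (- U)))"
    for U :: "'e set" and k x
  have gc: "continuous_on UNIV (g U k)" for U k
    unfolding g_def by (cases "U = UNIV") (auto intro!: continuous_intros)
  have g01: "0 \<le> g U k x" "g U k x \<le> 1" for U k x
    unfolding g_def by (auto simp: infdist_nonneg)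
  have glim: "(\<lambda>k. g U k x) \<longlonglongrightarrow> indicator U x" if "open U" for U x
  proof (cases "U = UNIV \<or> x \<notin> U")
    case True
    then show ?thesis by (cases "U = UNIV") (auto simp: g_def)
  next
    case False
    then have "infdist x (- U) \<noteq> 0"
      using in_closed_iff_infdist_zero[of "- U" x] that by (auto simp: closed_def)
    then have pos: "infdist x (- U) > 0"
      using infdist_nonneg[of x "- U"] by linarith
    have "\<forall>\<^sub>F k in sequentially. 1 / infdist x (- U) \<le> real k"
      using eventually_ge_at_top filterlim_at_top filterlim_real_sequentially by blast
    then have "\<forall>\<^sub>F k in sequentially. g U k x = 1"
      by eventually_elim (use pos False in \<open>auto simp: g_def field_simps\<close>)
    then show ?thesis
      using False by (simp add: tendsto_eventually)
  qed
  define f where "f n = (case from_nat_into (I \<times> UNIV) n of (U, k) \<Rightarrow> g U k)" for n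
  have f_surj: "\<exists>n. f n = g U k" if "U \<in> I" for U k
  proof -
    have "(U, k) \<in> I \<times> UNIV" using that by auto
    then obtain n where "from_nat_into (I \<times> UNIV) n = (U, k)"
      using from_nat_into_surj Icount by (metis countable_SIGMA countableI_type)
    then show ?thesis by (auto simp: f_def intro!: exI[of _ n])
  qed
  show thesis
  proof (rule that[of f])
    show "continuous_on UNIV (f n)" "0 \<le> f n x" "f n x \<le> 1" for n x
      by (auto simp: f_def gc g01 split: prod.split)
    show "separates_measures f"
      unfolding separates_measures_def
    proof (intro allI impI)
      fix M N :: "'e measure"
      assume fin: "finite_measure M" "finite_measure N"
        and sets: "sets M = sets borel" "sets N = sets borel"
        and eq: "\<forall>n. (\<integral>x. f n x \<partial>M) = (\<integral>x. f n x \<partial>N)"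
      have lim: "(\<lambda>k. \<integral>x. g U k x \<partial>M) \<longlonglongrightarrow> measure M U"
        if "U \<in> I" "finite_measure M" "sets M = sets borel" for U and M :: "'e measure"
      proof -
        interpret finite_measure M by fact
        have [measurable_cong]: "sets M = sets borel" by fact
        have sp: "space M = UNIV" using sets_eq_imp_space_eq[OF that(3)] by simp
        have [measurable]: "U \<in> sets borel" using Iopen[OF that(1)] by auto
        have [measurable]: "g U k \<in> borel_measurable borel" for k
          using gc by (rule borel_measurable_continuous_onI)
        have "(\<lambda>k. \<integral>x. g U k x \<partial>M) \<longlonglongrightarrow> (\<integral>x. indicator U x \<partial>M)"
          by (rule integral_dominated_convergence[where w="\<lambda>_. 1"])
            (use glim[OF Iopen[OF that(1)]] g01 in auto)
        then show ?thesis by (simp add: sp)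
      qed
      have "measure M U = measure N U" if "U \<in> I" for U
      proof (rule LIMSEQ_unique)
        show "(\<lambda>k. \<integral>x. g U k x \<partial>M) \<longlonglongrightarrow> measure M U"
          using lim that fin sets by blast
        have "(\<integral>x. g U k x \<partial>M) = (\<integral>x. g U k x \<partial>N)" for k
          using f_surj[OF that, of k] eq by metis
        then show "(\<lambda>k. \<integral>x. g U k x \<partial>M) \<longlonglongrightarrow> measure N U"
          using lim[OF that fin(2) sets(2)] by simp
      qed
      then have em: "emeasure M U = emeasure N U" if "U \<in> I" for U
        using that fin by (simp add: finite_measure.emeasure_eq_measure)
      show "M = N"
      proof (rule measure_eqI_generator_eq[OF Istable, where A="\<lambda>_. UNIV"])
        show "emeasure M UNIV \<noteq> \<infinity>" 
          using fin(1) by (simp add: finite_measure.emeasure_eq_measure)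
      qed (use em sets sig IUNIV in auto)
    qed
  qed
qed

text \<open>Prokhorov's theorem reduced to Helly selection on the line: the images under e are tight
  by Markov's inequality, and the limit is mapped back by \<gamma>. Convergence is preserved because
  f composed with \<gamma> is bounded and continuous and \<gamma> inverts e.\<close>

lemma bounded_second_moments_imp_convergent_subsequence:
  fixes P :: "nat \<Rightarrow> 'e::euclidean_space measure"
  assumes prob: "\<And>n. prob_space (P n)" and sets: "\<And>n. sets (P n) = sets borel"
    and int: "\<And>n. integrable (P n) (\<lambda>w. (norm w)\<^sup>2)" and bound: "\<And>n. (\<integral>w. (norm w)\<^sup>2 \<partial>P n) \<le> B"
  obtains r :: "nat \<Rightarrow> nat" and Q :: "'e measure"
  where "strict_mono r" "prob_space Q" "sets Q = sets borel"
    "\<forall>(f :: 'e \<Rightarrow> real) C. continuous_on UNIV f \<longrightarrow> (\<forall>w. \<bar>f w\<bar> \<le> C) \<longrightarrow>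
       (\<lambda>n. \<integral>w. f w \<partial>P (r n)) \<longlonglongrightarrow> (\<integral>w. f w \<partial>Q)"
proof -
  note [measurable_cong] = sets
  have sp: "space (P n) = UNIV" for n using sets_eq_imp_space_eq[OF sets] by simp
  obtain \<gamma> :: "real \<Rightarrow> 'e" and e :: "'e \<Rightarrow> real" where \<gamma>: "continuous_on UNIV \<gamma>"
    and e[measurable]: "e \<in> borel_measurable borel" and \<gamma>e: "\<And>y. \<gamma> (e y) = y"
    and e0: "\<And>y. 0 \<le> e y" and eb: "\<And>y k. norm y < real k \<Longrightarrow> e y \<le> 2 * real k + 1"
    using continuous_surjection_with_measurable_section by blast
  have [measurable]: "\<gamma> \<in> borel_measurable borel" using \<gamma> by (rule borel_measurable_continuous_onI)
  define M where "M n = distr (P n) borel e" for n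
  have M: "real_distribution (M n)" for n
  proof -
    interpret prob_space "P n" by (rule prob)
    have "prob_space (M n)" unfolding M_def by (rule prob_space_distr) simp
    then show ?thesis
      by (intro real_distribution.intro real_distribution_axioms.intro) (auto simp: M_def)
  qed
  have "tight M"
    unfolding tight_def
  proof (intro conjI allI impI)
    show "real_distribution (M n)" for n by (rule M)
    fix \<epsilon> :: real assume \<epsilon>: "0 < \<epsilon>"
    obtain k0 :: nat where k0: "(\<bar>B\<bar> + 1) / \<epsilon> < real k0"
      using reals_Archimedean2 by blast
    define k where "k = Suc k0"
    have k: "1 \<le> real k" "(\<bar>B\<bar> + 1) / \<epsilon> < real k" using k0 by (auto simp: k_def)
    \<comment> \<open>The interval is open on the left and e may take the value 0, hence the left
      end -1.\<close>
    have "measure (M n) {-1<..2 * real k + 1} > 1 - \<epsilon>" for n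
    proof -
      interpret prob_space "P n" by (rule prob)
      have "measure (P n) {w \<in> space (P n). (real k)\<^sup>2 \<le> (norm w)\<^sup>2} \<le> (\<integral>w. (norm w)\<^sup>2 \<partial>P n) / (real k)\<^sup>2"
        using k by (intro integral_Markov_inequality_measure[OF int sets.empty_sets]) auto
      also have "\<dots> \<le> \<bar>B\<bar> / (real k)\<^sup>2"
        using bound[of n] by (intro divide_right_mono) auto
      also have "\<dots> \<le> \<bar>B\<bar> / real k"
        using k by (intro divide_left_mono) (auto simp: power2_eq_square)
      also have "\<dots> < \<epsilon>"
        using k \<epsilon> by (simp add: field_simps)
      finally have small: "prob {w \<in> space (P n). (real k)\<^sup>2 \<le> (norm w)\<^sup>2} < \<epsilon>" .
      have "1 - prob {w \<in> space (P n). (real k)\<^sup>2 \<le> (norm w)\<^sup>2}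
          = prob (space (P n) - {w \<in> space (P n). (real k)\<^sup>2 \<le> (norm w)\<^sup>2})"
        by (subst prob_compl) auto
      also have "\<dots> \<le> prob (e -` {-1<..2 * real k + 1} \<inter> space (P n))"
      proof (intro finite_measure_mono)
        show "space (P n) - {w \<in> space (P n). (real k)\<^sup>2 \<le> (norm w)\<^sup>2}
            \<subseteq> e -` {-1<..2 * real k + 1} \<inter> space (P n)"
        proof
          fix w assume "w \<in> space (P n) - {w \<in> space (P n). (real k)\<^sup>2 \<le> (norm w)\<^sup>2}"
          then have "norm w < real k" "w \<in> space (P n)" by auto
          from eb[OF this(1)] e0[of w] \<open>w \<in> space (P n)\<close>
          show "w \<in> e -` {-1<..2 * real k + 1} \<inter> space (P n)" by auto
        qed
      qed simp
      also have "\<dots> = measure (M n) {-1<..2 * real k + 1}"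
        unfolding M_def by (subst measure_distr) auto
      finally show ?thesis using small by linarith
    qed
    moreover have "-1 < 2 * real k + 1" using k by linarith
    ultimately show "\<exists>a b. a < b \<and> (\<forall>n. 1 - \<epsilon> < measure (M n) {a<..b})" by blast
  qed
  from tight_imp_convergent_subsubsequence[OF this, of id]
  obtain r N where r: "strict_mono r" and N: "real_distribution N" and w: "weak_conv_m (M \<circ> r) N"
    by (auto simp: strict_mono_def)
  interpret N: real_distribution N by fact
  note [measurable_cong] = N.events_eq_borel
  define Q where "Q = distr N borel \<gamma>"
  show thesis
  proof (rule that[OF r])
    show "prob_space Q" unfolding Q_def by (rule N.prob_space_distr) simp
    show "sets Q = sets borel" by (simp add: Q_def)
    show "\<forall>(f :: 'e \<Rightarrow> real) C. continuous_on UNIV f \<longrightarrow> (\<forall>w. \<bar>f w\<bar> \<le> C) \<longrightarrow>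
       (\<lambda>n. \<integral>w. f w \<partial>P (r n)) \<longlonglongrightarrow> (\<integral>w. f w \<partial>Q)"
    proof (intro allI impI)
      fix f :: "'e \<Rightarrow> real" and C assume f: "continuous_on UNIV f" "\<forall>w. \<bar>f w\<bar> \<le> C"
      have [measurable]: "f \<in> borel_measurable borel"
        using f(1) by (rule borel_measurable_continuous_onI)
      have "(\<lambda>n. \<integral>t. f (\<gamma> t) \<partial>(M \<circ> r) n) \<longlonglongrightarrow> (\<integral>t. f (\<gamma> t) \<partial>N)"
      proof (rule weak_conv_imp_integral_bdd_continuous_conv[OF _ N w, where B=C])
        show "real_distribution ((M \<circ> r) n)" for n using M by simp
        have "continuous_on UNIV (\<lambda>t. f (\<gamma> t))"
          by (rule continuous_on_compose2[OF f(1) \<gamma>]) auto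
        then show "isCont (\<lambda>t. f (\<gamma> t)) x" for x
          by (simp add: continuous_on_eq_continuous_at)
      qed (use f in auto)
      moreover have "(\<integral>t. f (\<gamma> t) \<partial>(M \<circ> r) n) = (\<integral>w. f w \<partial>P (r n))" for n
        unfolding M_def comp_def by (subst integral_distr) (auto simp: \<gamma>e)
      moreover have "(\<integral>t. f (\<gamma> t) \<partial>N) = (\<integral>w. f w \<partial>Q)"
        unfolding Q_def by (subst integral_distr) auto
      ultimately show "(\<lambda>n. \<integral>w. f w \<partial>P (r n)) \<longlonglongrightarrow> (\<integral>w. f w \<partial>Q)" by simp
    qed
  qed
qed

text \<open>Cutting c off at height A * (1 + R) gives a bounded continuous function, to which weak
  convergence applies; the error is at most A times the excess of W over R, whose integral is small
  uniformly for large n.\<close>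

lemma uniformly_integrable_convergence:
  fixes P :: "nat \<Rightarrow> 'e::euclidean_space measure" and Q :: "'e measure" and W c :: "'e \<Rightarrow> real"
  assumes prob: "\<And>n. prob_space (P n)" "prob_space Q"
    and sets: "\<And>n. sets (P n) = sets borel" "sets Q = sets borel"
    and weak: "\<And>(f :: 'e \<Rightarrow> real) C. continuous_on UNIV f \<Longrightarrow> (\<And>w. \<bar>f w\<bar> \<le> C) \<Longrightarrow>
       (\<lambda>n. \<integral>w. f w \<partial>P n) \<longlonglongrightarrow> (\<integral>w. f w \<partial>Q)"
    and W: "continuous_on UNIV W" "\<And>w. 0 \<le> W w" "\<And>n. integrable (P n) W"
    and tail: "\<And>\<epsilon>. 0 < \<epsilon> \<Longrightarrow> \<exists>R. 0 \<le> R \<and> (\<forall>\<^sub>F n in sequentially. (\<integral>w. max 0 (W w - R) \<partial>P n) \<le> \<epsilon>)"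
    and c: "continuous_on UNIV c" "\<And>w. \<bar>c w\<bar> \<le> A * (1 + W w)"
  shows "integrable Q W" "integrable Q c" "(\<lambda>n. \<integral>w. c w \<partial>P n) \<longlonglongrightarrow> (\<integral>w. c w \<partial>Q)"
proof -
  note [measurable_cong] = sets
  interpret P: prob_space "P n" for n by (rule prob)
  interpret Q: prob_space Q by (rule prob)
  have [measurable]: "W \<in> borel_measurable borel" "c \<in> borel_measurable borel"
    using W(1) c(1) by (auto intro: borel_measurable_continuous_onI)
  have A: "0 \<le> A"
  proof -
    have "0 \<le> A * (1 + W 0)" using c(2)[of 0] abs_ge_zero[of "c 0"] by linarith
    then show ?thesis using W(2)[of 0] by (simp add: zero_le_mult_iff)
  qed
  have Wtail: "integrable (P n) (\<lambda>w. max 0 (W w - R))" for n R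
    by (intro integrable_max Bochner_Integration.integrable_diff W(3)) auto
  \<comment> \<open>Weak convergence only tests bounded functions, so the excess is first capped at
    k and the cap is then removed by monotone convergence.\<close>
  have tailQ: "(\<integral>\<^sup>+w. ennreal (max 0 (W w - R)) \<partial>Q) \<le> ennreal \<epsilon>"
    if ev: "\<forall>\<^sub>F n in sequentially. (\<integral>w. max 0 (W w - R) \<partial>P n) \<le> \<epsilon>" and "0 < \<epsilon>" for R \<epsilon>
  proof -
    let ?h = "\<lambda>k w. min (real k) (max 0 (W w - R))"
    have int: "integrable M (?h k)" if "finite_measure M" "sets M = sets borel" for k and M :: "'e measure"
    proof -
      interpret finite_measure M by fact
      have [measurable_cong]: "sets M = sets borel" by fact
      show ?thesis by (rule integrable_const_bound[where B="real k"]) auto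
    qed
    have le: "(\<integral>w. ?h k w \<partial>Q) \<le> \<epsilon>" for k
    proof (rule tendsto_upperbound)
      show "(\<lambda>n. \<integral>w. ?h k w \<partial>P n) \<longlonglongrightarrow> (\<integral>w. ?h k w \<partial>Q)"
        using W(1) by (intro weak[where C="real k"]) (auto intro!: continuous_intros)
      show "\<forall>\<^sub>F n in sequentially. (\<integral>w. ?h k w \<partial>P n) \<le> \<epsilon>"
        using ev
      proof eventually_elim
        case (elim n)
        have "(\<integral>w. ?h k w \<partial>P n) \<le> (\<integral>w. max 0 (W w - R) \<partial>P n)"
          by (intro integral_mono int Wtail) (auto simp: P.finite_measure_axioms sets)
        then show ?case using elim by simp
      qed
    qed simp
    have "(\<integral>\<^sup>+w. ennreal (max 0 (W w - R)) \<partial>Q) = (\<integral>\<^sup>+w. (SUP k. ennreal (?h k w)) \<partial>Q)"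
    proof (intro nn_integral_cong)
      fix w
      show "ennreal (max 0 (W w - R)) = (SUP k. ennreal (?h k w))"
      proof (rule antisym)
        obtain k :: nat where "max 0 (W w - R) \<le> real k" using real_arch_simple by blast
        then have "ennreal (max 0 (W w - R)) \<le> ennreal (?h k w)" by (intro ennreal_leI) auto
        then show "ennreal (max 0 (W w - R)) \<le> (SUP k. ennreal (?h k w))"
          by (rule SUP_upper2[OF UNIV_I])
      qed (intro SUP_least ennreal_leI min.cobounded2)
    qed
    also have "\<dots> = (SUP k. \<integral>\<^sup>+w. ennreal (?h k w) \<partial>Q)"
      by (intro nn_integral_monotone_convergence_SUP) (auto simp: incseq_def le_fun_def intro!: ennreal_leI)
    also have "\<dots> \<le> ennreal \<epsilon>"
    proof (rule SUP_least)
      fix k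
      have "(\<integral>\<^sup>+w. ennreal (?h k w) \<partial>Q) = ennreal (\<integral>w. ?h k w \<partial>Q)"
        by (intro nn_integral_eq_integral int) (auto simp: Q.finite_measure_axioms sets)
      then show "(\<integral>\<^sup>+w. ennreal (?h k w) \<partial>Q) \<le> ennreal \<epsilon>"
        using le[of k] by (simp add: ennreal_leI)
    qed
    finally show ?thesis .
  qed
  have Qtail: "integrable Q (\<lambda>w. max 0 (W w - R))" "(\<integral>w. max 0 (W w - R) \<partial>Q) \<le> \<epsilon>"
    if ev: "\<forall>\<^sub>F n in sequentially. (\<integral>w. max 0 (W w - R) \<partial>P n) \<le> \<epsilon>" and "0 < \<epsilon>" for R \<epsilon>
  proof -
    show i: "integrable Q (\<lambda>w. max 0 (W w - R))"
      by (rule integrableI_nonneg) (use le_less_trans[OF tailQ[OF that]] in auto)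
    have "ennreal (\<integral>w. max 0 (W w - R) \<partial>Q) \<le> ennreal \<epsilon>"
      using tailQ[OF that] by (subst (asm) nn_integral_eq_integral[OF i]) auto
    then show "(\<integral>w. max 0 (W w - R) \<partial>Q) \<le> \<epsilon>" using that(2) by simp
  qed
  obtain R1 where R1: "0 \<le> R1" "\<forall>\<^sub>F n in sequentially. (\<integral>w. max 0 (W w - R1) \<partial>P n) \<le> 1"
    using tail[of 1] by auto
  show iW: "integrable Q W"
    by (rule Bochner_Integration.integrable_bound[of _ "\<lambda>w. max 0 (W w - R1) + R1"])
      (use W(2) R1(1) Qtail(1)[OF R1(2)] in auto)
  have ic: "integrable M c" if "integrable M W" "finite_measure M" "sets M = sets borel" for M :: "'e measure"
  proof -
    interpret finite_measure M by fact
    have [measurable_cong]: "sets M = sets borel" by fact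
    show ?thesis
      by (rule Bochner_Integration.integrable_bound[of _ "\<lambda>w. A * (1 + W w)"])
        (use that c(2) in \<open>auto intro!: AE_I2 order_trans[OF c(2)]\<close>)
  qed
  show icQ: "integrable Q c" by (rule ic[OF iW]) (auto simp: sets Q.finite_measure_axioms)
  have icP: "integrable (P n) c" for n by (rule ic[OF W(3)]) (auto simp: sets P.finite_measure_axioms)
  show "(\<lambda>n. \<integral>w. c w \<partial>P n) \<longlonglongrightarrow> (\<integral>w. c w \<partial>Q)"
  proof (rule LIMSEQ_I)
    fix \<epsilon> :: real assume \<epsilon>: "0 < \<epsilon>"
    \<comment> \<open>The error is spent on two truncations and one limit, a quarter of \<epsilon>
      each; A + 1 avoids a division by zero.\<close>
    define \<epsilon>' where "\<epsilon>' = \<epsilon> / (4 * (A + 1))"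
    have \<epsilon>': "0 < \<epsilon>'" "A * \<epsilon>' \<le> \<epsilon> / 4"
      using \<epsilon> A by (auto simp: \<epsilon>'_def field_simps)
    obtain R where R: "0 \<le> R" and ev: "\<forall>\<^sub>F n in sequentially. (\<integral>w. max 0 (W w - R) \<partial>P n) \<le> \<epsilon>'"
      using tail[OF \<epsilon>'(1)] by auto
    define K where "K = A * (1 + R)"
    have K: "0 \<le> K" using A R by (simp add: K_def)
    define c' where "c' w = max (- K) (min K (c w))" for w
    have c'm[measurable]: "c' \<in> borel_measurable borel" unfolding c'_def by measurable
    have ic': "integrable M c'" if "finite_measure M" "sets M = sets borel" for M :: "'e measure"
    proof -
      interpret finite_measure M by fact
      have [measurable_cong]: "sets M = sets borel" by fact
      show ?thesis
        by (rule integrable_const_bound[where B=K]) (use K in \<open>auto simp: c'_def\<close>)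
    qed
    have cc': "\<bar>c w - c' w\<bar> \<le> A * max 0 (W w - R)" for w
    proof -
      have "A * (1 + W w) \<le> K + A * max 0 (W w - R)"
      proof -
        have "A * (1 + W w) \<le> A * (1 + R + max 0 (W w - R))" using A by (intro mult_left_mono) auto
        then show ?thesis by (simp add: K_def distrib_left)
      qed
      moreover have "0 \<le> A * max 0 (W w - R)" using A by simp
      ultimately show ?thesis
        using c(2)[of w] K unfolding c'_def by linarith
    qed
    have near: "\<bar>(\<integral>w. c w \<partial>M) - (\<integral>w. c' w \<partial>M)\<bar> \<le> \<epsilon> / 4"
      if M: "integrable M c" "finite_measure M" "sets M = sets borel"
        "integrable M (\<lambda>w. max 0 (W w - R))" "(\<integral>w. max 0 (W w - R) \<partial>M) \<le> \<epsilon>'" for M :: "'e measure"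
    proof -
      have "\<bar>(\<integral>w. c w \<partial>M) - (\<integral>w. c' w \<partial>M)\<bar> = \<bar>\<integral>w. c w - c' w \<partial>M\<bar>"
        using M ic' by simp
      also have "\<dots> \<le> (\<integral>w. \<bar>c w - c' w\<bar> \<partial>M)" by (rule integral_abs_bound)
      also have "\<dots> \<le> (\<integral>w. A * max 0 (W w - R) \<partial>M)"
        using M ic' by (intro integral_mono cc' integrable_abs Bochner_Integration.integrable_diff integrable_mult_right) auto
      also have "\<dots> \<le> A * \<epsilon>'" using M(5) A by (simp add: mult_left_mono)
      finally show ?thesis using \<epsilon>' by simp
    qed
    have "(\<lambda>n. \<integral>w. c' w \<partial>P n) \<longlonglongrightarrow> (\<integral>w. c' w \<partial>Q)"
      using c(1) K unfolding c'_def by (intro weak[where C=K]) (auto intro!: continuous_intros)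
    from LIMSEQ_D[OF this, of "\<epsilon> / 4"] \<epsilon>
    have "\<forall>\<^sub>F n in sequentially. \<bar>(\<integral>w. c' w \<partial>P n) - (\<integral>w. c' w \<partial>Q)\<bar> < \<epsilon> / 4"
      by (auto simp: eventually_sequentially)
    then have "\<forall>\<^sub>F n in sequentially. \<bar>(\<integral>w. c w \<partial>P n) - (\<integral>w. c w \<partial>Q)\<bar> < \<epsilon>"
      using ev
    proof eventually_elim
      case (elim n)
      have "\<bar>(\<integral>w. c w \<partial>P n) - (\<integral>w. c' w \<partial>P n)\<bar> \<le> \<epsilon> / 4"
        using elim by (intro near icP Wtail) (auto simp: sets P.finite_measure_axioms)
      moreover have "\<bar>(\<integral>w. c w \<partial>Q) - (\<integral>w. c' w \<partial>Q)\<bar> \<le> \<epsilon> / 4"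
        using Qtail[OF ev \<epsilon>'(1)] by (intro near icQ) (auto simp: sets Q.finite_measure_axioms)
      ultimately show ?case using elim(1) \<epsilon> by linarith
    qed
    then show "\<exists>no. \<forall>n\<ge>no. norm ((\<integral>w. c w \<partial>P n) - (\<integral>w. c w \<partial>Q)) < \<epsilon>"
      by (auto simp: eventually_sequentially)
  qed
qed

section \<open>Monotone relations and small sets\<close>

text \<open>One \<epsilon> bounds both the mesh and the total of the cover. This implies Hausdorff
  measure zero and passes to countable unions with the usual geometric split of \<epsilon>.\<close>

definition thin :: "real \<Rightarrow> 'a::metric_space set \<Rightarrow> bool" where
  "thin s A \<longleftrightarrow> (\<forall>\<epsilon>>0. \<exists>C :: nat \<Rightarrow> 'a set. A \<subseteq> (\<Union>i. C i) \<and>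
     (\<forall>i. bounded (C i) \<and> diameter (C i) \<le> \<epsilon>) \<and>
     (\<Sum>i. ennreal (diameter (C i) powr s)) \<le> ennreal \<epsilon>)"

lemma hausdorff_measure_thin:
  assumes "thin s A"
  shows "hausdorff_measure s A = 0"
proof -
  have "hausdorff_content \<delta> s A \<le> 0" if "0 < \<delta>" for \<delta>
  proof (rule ennreal_le_epsilon)
    fix e :: real assume "0 < e"
    then have "0 < min e \<delta>" using that by simp
    then obtain C :: "nat \<Rightarrow> 'a set" where C: "A \<subseteq> (\<Union>i. C i)"
      "\<forall>i. bounded (C i) \<and> diameter (C i) \<le> min e \<delta>"
      "(\<Sum>i. ennreal (diameter (C i) powr s)) \<le> ennreal (min e \<delta>)"
      using assms unfolding thin_def by blast
    have "hausdorff_content \<delta> s A \<le> (\<Sum>i. ennreal (diameter (C i) powr s))"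
      unfolding hausdorff_content_def using C by (intro Inf_lower) auto
    also have "\<dots> \<le> ennreal e" by (rule order_trans[OF C(3)]) (simp add: ennreal_leI)
    finally show "hausdorff_content \<delta> s A \<le> 0 + ennreal e" by simp
  qed
  then show ?thesis
    unfolding hausdorff_measure_def by (intro antisym SUP_least) auto
qed

lemma thin_UN_nat:
  assumes "\<And>n. thin s (A n)"
  shows "thin s (\<Union>n::nat. A n)"
  unfolding thin_def
proof (intro allI impI)
  fix \<epsilon> :: real assume \<epsilon>: "0 < \<epsilon>"
  have "\<exists>C :: nat \<Rightarrow> 'a set. A n \<subseteq> (\<Union>i. C i) \<and>
     (\<forall>i. bounded (C i) \<and> diameter (C i) \<le> \<epsilon> * (1/2) ^ Suc n) \<and>
     (\<Sum>i. ennreal (diameter (C i) powr s)) \<le> ennreal (\<epsilon> * (1/2) ^ Suc n)" for n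
  proof -
    have "0 < \<epsilon> * (1/2) ^ Suc n" using \<epsilon> by simp
    then show ?thesis using assms[of n] unfolding thin_def by blast
  qed
  then obtain C :: "nat \<Rightarrow> nat \<Rightarrow> 'a set" where C: "\<And>n. A n \<subseteq> (\<Union>i. C n i)"
     "\<And>n i. bounded (C n i)" "\<And>n i. diameter (C n i) \<le> \<epsilon> * (1/2) ^ Suc n"
     "\<And>n. (\<Sum>i. ennreal (diameter (C n i) powr s)) \<le> ennreal (\<epsilon> * (1/2) ^ Suc n)"
    by metis
  define C' where "C' k = (case prod_decode k of (n, i) \<Rightarrow> C n i)" for k
  show "\<exists>C :: nat \<Rightarrow> 'a set. (\<Union>n. A n) \<subseteq> (\<Union>i. C i) \<and>
     (\<forall>i. bounded (C i) \<and> diameter (C i) \<le> \<epsilon>) \<and>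
     (\<Sum>i. ennreal (diameter (C i) powr s)) \<le> ennreal \<epsilon>"
  proof (intro exI[of _ C'] conjI allI)
    show "(\<Union>n. A n) \<subseteq> (\<Union>k. C' k)"
    proof
      fix x assume "x \<in> (\<Union>n. A n)"
      then obtain n i where "x \<in> C n i" using C(1) by blast
      then have "x \<in> C' (prod_encode (n, i))" by (simp add: C'_def)
      then show "x \<in> (\<Union>k. C' k)" by blast
    qed
    fix k
    obtain n i where ni: "prod_decode k = (n, i)" by force
    show "bounded (C' k)" using C(2) by (simp add: C'_def ni)
    have "(1/2 :: real) ^ Suc n \<le> 1" by (rule power_le_one) auto
    then have "\<epsilon> * (1/2) ^ Suc n \<le> \<epsilon> * 1" using \<epsilon> by (intro mult_left_mono) auto
    then show "diameter (C' k) \<le> \<epsilon>" using C(3)[of n i] by (simp add: C'_def ni)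
  next
    have "(\<Sum>k. ennreal (diameter (C' k) powr s)) = (\<Sum>k. (\<lambda>(n, i). ennreal (diameter (C n i) powr s)) (prod_decode k))"
      by (simp add: C'_def case_prod_unfold)
    also have "\<dots> = (\<Sum>n. \<Sum>i. ennreal (diameter (C n i) powr s))"
      by (rule suminf_ennreal_2dimen) simp
    also have "\<dots> \<le> (\<Sum>n. ennreal (\<epsilon> * (1/2) ^ Suc n))"
      using C(4) by (intro suminf_le) auto
    also have "\<dots> = ennreal \<epsilon>"
    proof (rule suminf_ennreal_eq)
      show "(\<lambda>n. \<epsilon> * (1/2) ^ Suc n) sums \<epsilon>"
        using sums_mult[OF power_half_series, of \<epsilon>] by simp
    qed (use \<epsilon> in auto)
    finally show "(\<Sum>k. ennreal (diameter (C' k) powr s)) \<le> ennreal \<epsilon>" .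
  qed
qed

lemma thin_subset: "thin s B \<Longrightarrow> A \<subseteq> B \<Longrightarrow> thin s A"
  unfolding thin_def by (meson subset_trans)

lemma thin_UN:
  assumes "countable I" "\<And>i. i \<in> I \<Longrightarrow> thin s (A i)" "I \<noteq> {}"
  shows "thin s (\<Union>i\<in>I. A i)"
proof -
  have "(\<Union>i\<in>I. A i) = (\<Union>n. A (from_nat_into I n))"
    using range_from_nat_into[OF assms(3,1)] by force
  then show ?thesis
    using thin_UN_nat[of s "\<lambda>n. A (from_nat_into I n)"] assms by (simp add: from_nat_into)
qed

text \<open>A bounded piece of a hyperplane splits into \<open>N ^ (d - 1)\<close> cubes of side 2k
  / N, where d is the dimension. The relation maps each cube to a set whose diameter is of order 1 /
  N, and the total, of order \<open>N powr (d - 1 - s)\<close>, vanishes in the limit since s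
  exceeds d - 1.\<close>

lemma thin_lipschitz_image_hyperplane:
  fixes \<Phi> :: "('a::euclidean_space \<times> 'a) set"
  assumes lip: "\<And>v z v' z'. (v, z) \<in> \<Phi> \<Longrightarrow> (v', z') \<in> \<Phi> \<Longrightarrow> dist z z' \<le> dist v v'"
    and s: "real DIM('a) - 1 < s" and b: "b \<in> Basis" and k: "0 < k"
  shows "thin s {z. \<exists>v. (v, z) \<in> \<Phi> \<and> v \<bullet> b = r \<and> norm v \<le> k}"
  unfolding thin_def
proof (intro allI impI)
  fix \<epsilon> :: real assume \<epsilon>: "0 < \<epsilon>"
  let ?B = "Basis - {b}"
  let ?d = "DIM('a) - 1"
  \<comment> \<open>Diameters are estimated through the l1 norm: at most 2k / N for each of the
    \<open>DIM('a)\<close> coordinates.\<close>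
  define M where "M = 2 * k * real DIM('a)"
  have M: "0 < M" using k by (simp add: M_def)
  have s0: "0 \<le> s" using s DIM_positive[where 'a='a] by linarith
  have "(\<lambda>N. M / real N) \<longlonglongrightarrow> 0" by (rule lim_const_over_n)
  then have ev1: "\<forall>\<^sub>F N in sequentially. M / real N < \<epsilon>" using \<epsilon> by (rule order_tendstoD)
  have "(\<lambda>N. M powr s * real N powr (real ?d - s)) \<longlonglongrightarrow> M powr s * 0"
    using s by (intro tendsto_mult tendsto_const tendsto_neg_powr filterlim_real_sequentially) (auto simp: of_nat_diff Suc_leI)
  then have ev2: "\<forall>\<^sub>F N in sequentially. M powr s * real N powr (real ?d - s) < \<epsilon>"
    using \<epsilon> by (intro order_tendstoD) auto
  have "\<forall>\<^sub>F N in sequentially. M / real N < \<epsilon> \<and> M powr s * real N powr (real ?d - s) < \<epsilon> \<and> 0 < N"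
    using ev1 ev2 eventually_gt_at_top[of 0] by eventually_elim auto
  then obtain N where N: "M / real N < \<epsilon>" "M powr s * real N powr (real ?d - s) < \<epsilon>" "0 < N"
    using eventually_happens'[OF sequentially_bot] by blast
  define I where "I = (\<Pi>\<^sub>E c\<in>?B. {..<N})"
  have I: "finite I" "card I = N ^ ?d"
    using b by (auto simp: I_def card_PiE intro!: finite_PiE)
  define Q where "Q f = {v :: 'a. v \<bullet> b = r \<and> (\<forall>c\<in>?B. - k + 2 * k * real (f c) / real N \<le> v \<bullet> c \<and>
      v \<bullet> c \<le> - k + 2 * k * (real (f c) + 1) / real N)}" for f :: "'a \<Rightarrow> nat"
  define C where "C f = {z. \<exists>v\<in>Q f. (v, z) \<in> \<Phi>}" for f
  have dist: "dist z z' \<le> M / real N" if "z \<in> C f" "z' \<in> C f" for z z' f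
  proof -
    from that obtain v v' where v: "v \<in> Q f" "(v, z) \<in> \<Phi>" "v' \<in> Q f" "(v', z') \<in> \<Phi>"
      by (auto simp: C_def)
    have "dist z z' \<le> norm (v - v')" using lip[OF v(2,4)] by (simp add: dist_norm)
    also have "\<dots> \<le> (\<Sum>c\<in>Basis. \<bar>(v - v') \<bullet> c\<bar>)" by (rule norm_le_l1)
    also have "\<dots> \<le> (\<Sum>c\<in>(Basis::'a set). 2 * k / real N)"
    proof (rule sum_mono)
      fix c :: 'a assume c: "c \<in> Basis"
      show "\<bar>(v - v') \<bullet> c\<bar> \<le> 2 * k / real N"
      proof (cases "c = b")
        case True
        then show ?thesis using v k by (auto simp: Q_def inner_diff_left)
      next
        case False
        with c v have "- k + 2 * k * real (f c) / real N \<le> v \<bullet> c" "v \<bullet> c \<le> - k + 2 * k * (real (f c) + 1) / real N"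
          "- k + 2 * k * real (f c) / real N \<le> v' \<bullet> c" "v' \<bullet> c \<le> - k + 2 * k * (real (f c) + 1) / real N"
          by (auto simp: Q_def)
        moreover have "2 * k * (real (f c) + 1) / real N = 2 * k * real (f c) / real N + 2 * k / real N"
          by (simp add: distrib_left add_divide_distrib)
        ultimately show ?thesis unfolding inner_diff_left by linarith
      qed
    qed
    also have "\<dots> = M / real N" by (simp add: M_def)
    finally show ?thesis .
  qed
  have cover: "{z. \<exists>v. (v, z) \<in> \<Phi> \<and> v \<bullet> b = r \<and> norm v \<le> k} \<subseteq> (\<Union>f\<in>I. C f)"
  proof clarify
    fix z v assume v: "(v, z) \<in> \<Phi>" "norm v \<le> k" "r = v \<bullet> b"
    have "\<exists>j<N. - k + 2 * k * real j / real N \<le> v \<bullet> c \<and> v \<bullet> c \<le> - k + 2 * k * (real j + 1) / real N"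
      if c: "c \<in> ?B" for c
    proof -
      define y where "y = (v \<bullet> c + k) * real N / (2 * k)"
      have "\<bar>v \<bullet> c\<bar> \<le> k" using Basis_le_norm[of c v] c v(2) by auto
      then have a: "0 \<le> v \<bullet> c + k" "v \<bullet> c + k \<le> 2 * k" by linarith+
      have "y \<le> 2 * k * real N / (2 * k)"
        unfolding y_def using a k by (intro divide_right_mono mult_right_mono) auto
      then have y: "0 \<le> y" "y \<le> real N"
        using a k by (auto simp: y_def)
      have vc: "v \<bullet> c = - k + 2 * k * y / real N" using k N(3) by (simp add: y_def field_simps)
      have mono: "2 * k * a / real N \<le> 2 * k * a' / real N" if "a \<le> a'" for a a'
        using that k by (intro divide_right_mono mult_left_mono) auto
      show ?thesis
      proof (cases "y < real N")
        case True
        then have "nat \<lfloor>y\<rfloor> < N" using y by linarith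
        moreover have "real (nat \<lfloor>y\<rfloor>) \<le> y" "y \<le> real (nat \<lfloor>y\<rfloor>) + 1" using y by linarith+
        ultimately show ?thesis
          unfolding vc by (intro exI[of _ "nat \<lfloor>y\<rfloor>"] conjI add_left_mono mono)
      next
        case False
        \<comment> \<open>The right end of the range, y = N, belongs to the last cell.\<close>
        then have "real (N - 1) \<le> y" "y \<le> real (N - 1) + 1" "N - 1 < N" using y N(3) by (auto simp: of_nat_diff)
        then show ?thesis
          unfolding vc by (intro exI[of _ "N - 1"] conjI add_left_mono mono)
      qed
    qed
    then obtain j where j: "\<And>c. c \<in> ?B \<Longrightarrow> j c < N \<and> - k + 2 * k * real (j c) / real N \<le> v \<bullet> c \<and>
        v \<bullet> c \<le> - k + 2 * k * (real (j c) + 1) / real N" by metis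
    have "restrict j ?B \<in> I" using j by (auto simp: I_def)
    moreover have "z \<in> C (restrict j ?B)" using j v by (auto simp: C_def Q_def intro!: bexI[of _ v])
    ultimately show "z \<in> (\<Union>f\<in>I. C f)" by blast
  qed
  obtain h where h: "bij_betw h {..<card I} I"
    using ex_bij_betw_nat_finite[OF I(1)] by (auto simp: atLeast0LessThan)
  \<comment> \<open>The finite cover becomes a sequence by padding with empty sets, whose terms are
    \<open>0 powr s = 0\<close>.\<close>
  define C' where "C' i = (if i < card I then C (h i) else {})" for i
  have bnd: "bounded (C f)" for f
  proof (cases "C f = {}")
    case False
    then obtain z where "z \<in> C f" by blast
    then show ?thesis unfolding bounded_def using dist by blast
  qed simp
  have diam: "diameter (C f) \<le> M / real N" for f
    using dist M N by (intro diameter_le) (auto simp: dist_norm)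
  show "\<exists>C :: nat \<Rightarrow> 'a set. {z. \<exists>v. (v, z) \<in> \<Phi> \<and> v \<bullet> b = r \<and> norm v \<le> k} \<subseteq> (\<Union>i. C i) \<and>
     (\<forall>i. bounded (C i) \<and> diameter (C i) \<le> \<epsilon>) \<and>
     (\<Sum>i. ennreal (diameter (C i) powr s)) \<le> ennreal \<epsilon>"
  proof (intro exI[of _ C'] conjI allI)
    have "(\<Union>f\<in>I. C f) \<subseteq> (\<Union>i. C' i)"
    proof clarify
      fix z f assume "f \<in> I" "z \<in> C f"
      then obtain i where "i < card I" "h i = f" using h by (metis bij_betw_def imageE lessThan_iff)
      then have "z \<in> C' i" using \<open>z \<in> C f\<close> by (simp add: C'_def)
      then show "z \<in> (\<Union>i. C' i)" by blast
    qed
    then show "{z. \<exists>v. (v, z) \<in> \<Phi> \<and> v \<bullet> b = r \<and> norm v \<le> k} \<subseteq> (\<Union>i. C' i)"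
      using cover by blast
    show "bounded (C' i)" for i using bnd by (simp add: C'_def)
    show "diameter (C' i) \<le> \<epsilon>" for i using diam[of "h i"] N(1) \<epsilon> by (simp add: C'_def)
    have "(\<Sum>i. ennreal (diameter (C' i) powr s)) = (\<Sum>i<card I. ennreal (diameter (C' i) powr s))"
      by (rule suminf_finite) (auto simp: C'_def)
    also have "\<dots> \<le> (\<Sum>i<card I. ennreal ((M / real N) powr s))"
      using diam s0 by (intro sum_mono ennreal_leI powr_mono2) (auto simp: C'_def diameter_ge_0 bnd)
    also have "\<dots> = ennreal (real (N ^ ?d) * (M / real N) powr s)"
      by (simp add: I(2) ennreal_mult ennreal_of_nat_eq_real_of_nat)
    also have "real (N ^ ?d) * (M / real N) powr s = M powr s * real N powr (real ?d - s)"
    proof -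
      have "real (N ^ d) * (M / real N) powr s = M powr s * real N powr (real d - s)" for d
        using N(3) M by (simp add: powr_divide powr_diff powr_realpow)
      then show ?thesis .
    qed
    also have "ennreal \<dots> \<le> ennreal \<epsilon>" using N(2) by (intro ennreal_leI) simp
    finally show "(\<Sum>i. ennreal (diameter (C' i) powr s)) \<le> ennreal \<epsilon>" .
  qed
qed

text \<open>If a monotone relation takes two values at \<open>z\<close>, then \<open>z\<close> plus the segment between them meets
  a hyperplane \<open>v \<bullet> b = r\<close> with rational \<open>r\<close>, and \<open>z\<close> is a 1-Lipschitz function of that meeting
  point (the resolvent of the monotone relation).\<close>

lemma hausdorff_dim_multivalued_monotone:
  fixes \<Gamma> :: "('a::euclidean_space \<times> 'a) set"
  assumes mono: "\<And>z y z' y'. (z, y) \<in> \<Gamma> \<Longrightarrow> (z', y') \<in> \<Gamma> \<Longrightarrow> 0 \<le> (z - z') \<bullet> (y - y')"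
    and A: "\<And>z. z \<in> A \<Longrightarrow> \<exists>y y'. y \<noteq> y' \<and> (z, y) \<in> \<Gamma> \<and> (z, y') \<in> \<Gamma>"
  shows "hausdorff_dim A \<le> real DIM('a) - 1"
proof -
  define \<Phi> where "\<Phi> = {(z + ((1 - t) *\<^sub>R y + t *\<^sub>R y'), z) | z y y' t. (z, y) \<in> \<Gamma> \<and> (z, y') \<in> \<Gamma> \<and> 0 \<le> t \<and> t \<le> 1}"
  have lip: "dist z z' \<le> dist v v'" if "(v, z) \<in> \<Phi>" "(v', z') \<in> \<Phi>" for v z v' z'
  proof -
    from that obtain y1 y2 t y1' y2' t' where
      v: "v = z + ((1 - t) *\<^sub>R y1 + t *\<^sub>R y2)" "(z, y1) \<in> \<Gamma>" "(z, y2) \<in> \<Gamma>" "0 \<le> t" "t \<le> 1" and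
      v': "v' = z' + ((1 - t') *\<^sub>R y1' + t' *\<^sub>R y2')" "(z', y1') \<in> \<Gamma>" "(z', y2') \<in> \<Gamma>" "0 \<le> t'" "t' \<le> 1"
      by (auto simp: \<Phi>_def)
    \<comment> \<open>The inner product is affine in each value, so monotonicity extends to convex
      combinations of values, one point of the relation at a time.\<close>
    have half: "0 \<le> (z - z') \<bullet> (((1 - t) *\<^sub>R y1 + t *\<^sub>R y2) - y')" if "(z', y') \<in> \<Gamma>" for y'
    proof -
      have "(z - z') \<bullet> (((1 - t) *\<^sub>R y1 + t *\<^sub>R y2) - y') =
          (1 - t) * ((z - z') \<bullet> (y1 - y')) + t * ((z - z') \<bullet> (y2 - y'))"
        by (simp add: inner_diff_right inner_add_right algebra_simps)
      then show ?thesis using mono[OF v(2) that] mono[OF v(3) that] v by simp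
    qed
    have "(z - z') \<bullet> (((1 - t) *\<^sub>R y1 + t *\<^sub>R y2) - ((1 - t') *\<^sub>R y1' + t' *\<^sub>R y2')) =
        (1 - t') * ((z - z') \<bullet> (((1 - t) *\<^sub>R y1 + t *\<^sub>R y2) - y1')) +
        t' * ((z - z') \<bullet> (((1 - t) *\<^sub>R y1 + t *\<^sub>R y2) - y2'))"
      by (simp add: inner_diff_right inner_add_right algebra_simps)
    then have "0 \<le> (z - z') \<bullet> (((1 - t) *\<^sub>R y1 + t *\<^sub>R y2) - ((1 - t') *\<^sub>R y1' + t' *\<^sub>R y2'))"
      using half[OF v'(2)] half[OF v'(3)] v' by simp
    then have "(norm (z - z'))\<^sup>2 \<le> (z - z') \<bullet> (v - v')"
      by (simp add: v v' power2_norm_eq_inner inner_diff_right inner_add_right)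
    also have "\<dots> \<le> norm (z - z') * norm (v - v')" by (rule norm_cauchy_schwarz)
    finally have "norm (z - z') * norm (z - z') \<le> norm (z - z') * norm (v - v')"
      by (simp add: power2_eq_square)
    then have "norm (z - z') \<le> norm (v - v')"
      by (cases "z = z'") (auto dest: mult_left_le_imp_le)
    then show ?thesis by (simp add: dist_norm)
  qed
  define T where "T b r k = {z. \<exists>v. (v, z) \<in> \<Phi> \<and> v \<bullet> b = r \<and> norm v \<le> real (Suc k)}" for b r k
  have cover: "A \<subseteq> (\<Union>(b, r, k)\<in>Basis \<times> \<rat> \<times> UNIV. T b r k)"
  proof
    fix z assume "z \<in> A"
    then obtain y y' where y: "y \<noteq> y'" "(z, y) \<in> \<Gamma>" "(z, y') \<in> \<Gamma>" using A by blast
    then obtain b where b: "b \<in> Basis" "y \<bullet> b \<noteq> y' \<bullet> b" using euclidean_eqI by blast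
    obtain y1 y2 where y12: "y1 \<bullet> b < y2 \<bullet> b" "(z, y1) \<in> \<Gamma>" "(z, y2) \<in> \<Gamma>"
      using b y by (metis linorder_neqE_linordered_idom)
    obtain r where r: "r \<in> \<rat>" "(z + y1) \<bullet> b < r" "r < (z + y2) \<bullet> b"
      using Rats_dense_in_real[of "(z + y1) \<bullet> b" "(z + y2) \<bullet> b"] y12 by (auto simp: inner_add_left)
    define t where "t = (r - (z + y1) \<bullet> b) / (y2 \<bullet> b - y1 \<bullet> b)"
    have t: "0 \<le> t" "t \<le> 1" using r y12 by (auto simp: t_def inner_add_left field_simps)
    define v where "v = z + ((1 - t) *\<^sub>R y1 + t *\<^sub>R y2)"
    have "v \<bullet> b = (z + y1) \<bullet> b + t * (y2 \<bullet> b - y1 \<bullet> b)"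
      by (simp add: v_def inner_add_left algebra_simps)
    then have "v \<bullet> b = r" using y12 by (simp add: t_def)
    moreover have "(v, z) \<in> \<Phi>" using t y12 by (auto simp: \<Phi>_def v_def)
    moreover obtain k where "norm v \<le> real k" using real_arch_simple by blast
    ultimately have "z \<in> T b r k" by (auto simp: T_def intro!: exI[of _ v])
    then show "z \<in> (\<Union>(b, r, k)\<in>Basis \<times> \<rat> \<times> UNIV. T b r k)" using b r by blast
  qed
  \<comment> \<open>The cover by cubes is small only for exponents strictly above d - 1; the bound d
    - 1 itself follows by letting s decrease.\<close>
  have "hausdorff_dim A \<le> s" if s: "real DIM('a) - 1 < s" for s
  proof -
    have "thin s (\<Union>i\<in>Basis \<times> \<rat> \<times> UNIV. (case i of (b, r, k) \<Rightarrow> T b r k))"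
    proof (rule thin_UN)
      show "countable ((Basis :: 'a set) \<times> (\<rat> :: real set) \<times> (UNIV :: nat set))"
        by (intro countable_SIGMA countable_rat countableI_type) (simp add: countable_finite)
      show "(Basis :: 'a set) \<times> (\<rat> :: real set) \<times> (UNIV :: nat set) \<noteq> {}" by auto
      show "thin s (case i of (b, r, k) \<Rightarrow> T b r k)" if "i \<in> Basis \<times> \<rat> \<times> UNIV" for i
      proof -
        obtain b r k where i: "i = (b, r, k)" by (cases i)
        then have "b \<in> Basis" using that by simp
        then show ?thesis
          unfolding i T_def prod.case by (intro thin_lipschitz_image_hyperplane[OF lip s]) auto
      qed
    qed
    then have "hausdorff_measure s A = 0"
      using cover by (intro hausdorff_measure_thin) (rule thin_subset)
    moreover have "0 \<le> s" using s DIM_positive[where 'a='a] by linarith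
    ultimately show ?thesis
      unfolding hausdorff_dim_def by (intro cInf_lower) (auto intro!: bdd_belowI[of _ 0])
  qed
  then show ?thesis by (rule dense_ge)
qed

section \<open>Duality for moment problems\<close>

text \<open>The perturbation used below: a mixture of p with the point mass at x. Expectations are
  affine in s, so a quadratic penalty becomes a quadratic polynomial in s.\<close>

lemma expectation_bind_bernoulli:
  fixes f :: "'a \<Rightarrow> real"
  assumes "finite (set_pmf p)" "0 \<le> s" "s \<le> 1"
  shows "measure_pmf.expectation (bind_pmf (bernoulli_pmf s) (\<lambda>b. if b then return_pmf x else p)) f =
    measure_pmf.expectation p f + s * (f x - measure_pmf.expectation p f)"
  using assms
  by (subst pmf_expectation_bind[where A=UNIV]) (auto simp: UNIV_bool algebra_simps)

text \<open>A penalised near-maximiser \<open>p\<close> is perturbed towards the point mass at \<open>x\<close> with step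
  \<open>\<sigma> / w x\<close>; the first order condition then exhibits a dual feasible function, the multipliers
  being proportional to the constraint violations of \<open>p\<close>.\<close>

lemma approximate_moment_duality:
  fixes L :: "(('e \<Rightarrow> real) \<times> real) set" and c w :: "'e \<Rightarrow> real"
  assumes L_add: "\<And>g b g' b'. (g, b) \<in> L \<Longrightarrow> (g', b') \<in> L \<Longrightarrow> ((\<lambda>x. g x + g' x), b + b') \<in> L"
    and L_scale: "\<And>g b r. (g, b) \<in> L \<Longrightarrow> ((\<lambda>x. r * g x), r * b) \<in> L"
    and L_one: "((\<lambda>_. 1), 1) \<in> L"
    and L_w: "(w, bw) \<in> L" and w1: "\<And>x. 1 \<le> w x"
    and growth: "\<And>g b. (g, b) \<in> L \<Longrightarrow> \<exists>C. \<forall>x. \<bar>g x\<bar> \<le> C * w x"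
    and c: "\<And>x. \<bar>c x\<bar> \<le> C * w x"
    and D: "\<And>g b. (g, b) \<in> L \<Longrightarrow> (\<And>x. c x \<le> g x) \<Longrightarrow> D \<le> b"
    and F: "finite F" "F \<subseteq> L" and \<epsilon>: "0 < \<epsilon>"
  obtains p :: "'e pmf" where "finite (set_pmf p)"
    "\<And>g b. (g, b) \<in> F \<Longrightarrow> \<bar>measure_pmf.expectation p g - b\<bar> \<le> \<epsilon>"
    "D - \<epsilon> \<le> measure_pmf.expectation p c"
proof -
  \<comment> \<open>The weight w joins the penalised constraints. Thus the penalty also controls the
    expectation of w, and with it everything dominated by w.\<close>
  define I where "I = insert (w, bw) F"
  have I: "finite I" "I \<subseteq> L" "(w, bw) \<in> I" using F L_w by (auto simp: I_def)
  define E where "E p f = measure_pmf.expectation p f" for p :: "'e pmf" and f :: "'e \<Rightarrow> real"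
  define \<tau> where "\<tau> i p = E p (fst i) - snd i" for i :: "('e \<Rightarrow> real) \<times> real" and p
  have C0: "0 \<le> C"
  proof -
    have "0 \<le> C * w undefined" using c[of undefined] abs_ge_zero[of "c undefined"] by linarith
    then show ?thesis using w1[of undefined] by (auto simp: zero_le_mult_iff)
  qed
  \<comment> \<open>A is the bound on N times the sum of squared violations that the last estimate
    yields; N is chosen so that this forces the sum below the square of \<epsilon>.\<close>
  define A where "A = \<bar>C * bw - D\<bar> + \<epsilon> + C\<^sup>2"
  have A: "0 \<le> A" using \<epsilon> by (simp add: A_def)
  define N where "N = 1 + A / \<epsilon>\<^sup>2"
  have N: "1 \<le> N" "A \<le> N * \<epsilon>\<^sup>2" using A \<epsilon> by (auto simp: N_def field_simps)
  define J where "J p = E p c - N * (\<Sum>i\<in>I. (\<tau> i p)\<^sup>2)" for p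
  have Eint: "integrable (measure_pmf p) f" if "finite (set_pmf p)" for p and f :: "'e \<Rightarrow> real"
    using that by (rule integrable_measure_pmf_finite)
  have Emono: "E p f \<le> E p g" if "finite (set_pmf p)" "\<And>x. f x \<le> g x" for p f g
    unfolding E_def using that by (intro integral_mono Eint) auto
  have Eabs: "\<bar>E p f\<bar> \<le> E p (\<lambda>x. \<bar>f x\<bar>)" for p f
    unfolding E_def by (rule integral_abs_bound)
  have Ec: "E p c \<le> C * (bw + \<tau> (w, bw) p)" if "finite (set_pmf p)" for p
  proof -
    have "E p c \<le> E p (\<lambda>x. C * w x)"
    proof (rule Emono[OF that])
      show "c x \<le> C * w x" for x using c[of x] by linarith
    qed
    also have "\<dots> = C * E p w" by (simp add: E_def)
    finally show ?thesis by (simp add: \<tau>_def)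
  qed
  \<comment> \<open>Young's inequality lets the squared violation of the w constraint absorb the
    term linear in it.\<close>
  have quad: "2 * (C * t) \<le> C\<^sup>2 + t\<^sup>2" for t :: real
    using zero_le_power2[of "C - t"] by (simp add: power2_diff)
  have wI: "(\<tau> (w, bw) p)\<^sup>2 \<le> (\<Sum>i\<in>I. (\<tau> i p)\<^sup>2)" for p
    using I by (intro member_le_sum) auto
  have Jle: "J p \<le> C * bw + C * \<tau> (w, bw) p - (\<tau> (w, bw) p)\<^sup>2" if "finite (set_pmf p)" for p
  proof -
    have "(\<tau> (w, bw) p)\<^sup>2 \<le> N * (\<Sum>i\<in>I. (\<tau> i p)\<^sup>2)"
      using wI[of p] N(1) mult_right_mono[of 1 N "\<Sum>i\<in>I. (\<tau> i p)\<^sup>2"] zero_le_power2[of "\<tau> (w, bw) p"]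
      by linarith
    then show ?thesis using Ec[OF that] by (simp add: J_def distrib_left)
  qed
  define FP where "FP = {p :: 'e pmf. finite (set_pmf p)}"
  define S where "S = Sup (J ` FP)"
  have bdd: "bdd_above (J ` FP)"
  proof (rule bdd_aboveI2)
    fix p assume "p \<in> FP"
    then have "J p \<le> C * bw + C * \<tau> (w, bw) p - (\<tau> (w, bw) p)\<^sup>2" by (intro Jle) (simp add: FP_def)
    then show "J p \<le> C * bw + C\<^sup>2" 
      using quad[of "\<tau> (w, bw) p"] zero_le_power2[of "\<tau> (w, bw) p"] zero_le_power2[of C] by linarith
  qed
  have Jup: "J p \<le> S" if "finite (set_pmf p)" for p
    unfolding S_def using that by (intro cSUP_upper bdd) (auto simp: FP_def)
  have ex_near: "\<exists>p. finite (set_pmf p) \<and> S - \<delta> < J p" if "0 < \<delta>" for \<delta>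
  proof -
    have "return_pmf undefined \<in> FP" by (simp add: FP_def)
    then have "\<exists>y\<in>J ` FP. S - \<delta> < y"
      using that bdd unfolding S_def by (subst less_cSup_iff[symmetric]) auto
    then show ?thesis by (auto simp: FP_def)
  qed
  \<comment> \<open>These constants bound the expectation of w for every p that is optimal up to 1.
    They do not depend on \<sigma>, which can therefore be chosen after them.\<close>
  define Z where "Z = C * bw + 1 - S"
  define T where "T = 1 + 2 * \<bar>Z\<bar> + C\<^sup>2"
  define B where "B = \<bar>bw\<bar> + T + 1"
  have B: "E p w \<le> B" if "finite (set_pmf p)" "S - 1 \<le> J p" for p
  proof -
    let ?t = "\<tau> (w, bw) p"
    have "?t\<^sup>2 \<le> Z + C * ?t" using Jle[OF that(1)] that(2) by (simp add: Z_def)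
    then have "?t\<^sup>2 \<le> 2 * Z + C\<^sup>2" using quad[of ?t] by linarith
    moreover have "?t \<le> 1 + ?t\<^sup>2"
    proof -
      have "2 * ?t \<le> 1 + ?t\<^sup>2" using zero_le_power2[of "1 - ?t"] by (simp add: power2_diff)
      then show ?thesis using zero_le_power2[of ?t] by linarith
    qed
    moreover have "E p w = bw + ?t" by (simp add: \<tau>_def)
    ultimately show ?thesis
      using abs_ge_self[of Z] abs_ge_self[of bw] unfolding B_def T_def by linarith
  qed
  have B0: "0 \<le> B" by (simp add: B_def T_def)
  have "\<exists>G. \<forall>i\<in>I. \<forall>x. \<bar>fst i x\<bar> \<le> G i * w x"
  proof (rule bchoice[THEN exE])
    show "\<forall>i\<in>I. \<exists>C. \<forall>x. \<bar>fst i x\<bar> \<le> C * w x" using growth I(2) by (metis prod.collapse subsetD)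
  qed blast
  then obtain G where G: "\<And>i x. i \<in> I \<Longrightarrow> \<bar>fst i x\<bar> \<le> G i * w x" by blast
  have G0: "0 \<le> G i" if "i \<in> I" for i
  proof -
    have "0 \<le> G i * w undefined" using G[OF that, of undefined] abs_ge_zero[of "fst i undefined"] by linarith
    then show ?thesis using w1[of undefined] by (auto simp: zero_le_mult_iff)
  qed
  define B2 where "B2 = (\<Sum>i\<in>I. (G i * (1 + B))\<^sup>2)"
  have B20: "0 \<le> B2" by (simp add: B2_def sum_nonneg)
  \<comment> \<open>The summand 1 accounts for the optimality defect of p, and N * B2 for the second
    order term of the penalty.\<close>
  define \<kappa> where "\<kappa> = 1 + N * B2"
  have \<kappa>: "1 \<le> \<kappa>" using N B20 by (simp add: \<kappa>_def)
  define m where "m = \<kappa> * (\<bar>bw\<bar> + 1)"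
  have m: "0 < m" "\<kappa> * bw \<le> m"
    using \<kappa> mult_left_mono[of bw "\<bar>bw\<bar> + 1" \<kappa>] by (auto simp: m_def)
  \<comment> \<open>Small enough that the correction \<sigma> * \<kappa> * w adds at most \<epsilon>
    / 2 to the dual value.\<close>
  define \<sigma> where "\<sigma> = min 1 (\<epsilon> / (2 * m))"
  have \<sigma>: "0 < \<sigma>" "\<sigma> \<le> 1" using \<epsilon> m by (auto simp: \<sigma>_def)
  have \<sigma>bw: "\<sigma> * \<kappa> * bw \<le> \<epsilon> / 2"
  proof -
    have "\<sigma> * \<kappa> * bw \<le> \<sigma> * m"
      using \<sigma> m by (simp add: mult.assoc mult_left_mono)
    also have "\<dots> \<le> \<epsilon> / (2 * m) * m"
      using m by (intro mult_right_mono) (auto simp: \<sigma>_def)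
    also have "\<dots> = \<epsilon> / 2" using m by simp
    finally show ?thesis .
  qed
  obtain p where p: "finite (set_pmf p)" "S - \<sigma>\<^sup>2 < J p"
    using ex_near[of "\<sigma>\<^sup>2"] \<sigma> by auto
  have pB: "E p w \<le> B"
    using p \<sigma> power_le_one[of \<sigma> 2] by (intro B) auto
  \<comment> \<open>The linearisation of the penalised objective at p plus the error term. It is a
    combination of 1, w and the constraint functions, hence an admissible dual function.\<close>
  define \<Lambda> where "\<Lambda> x = E p c + (\<Sum>i\<in>I. 2 * N * \<tau> i p * (fst i x - E p (fst i))) + \<sigma> * \<kappa> * w x" for x
  have feasible: "c x \<le> \<Lambda> x" for x
  proof -
    \<comment> \<open>With this step size the optimality defect and the second order term are both
      bounded by s times a multiple of \<sigma> * w x. Division by s leaves an error that is itself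
      a multiple of a constraint function.\<close>
    define s where "s = \<sigma> / w x"
    have wx: "0 < w x" using w1[of x] by linarith
    have s: "0 < s" "s \<le> 1" using \<sigma> w1[of x] wx by (auto simp: s_def)
    define p' where "p' = bind_pmf (bernoulli_pmf s) (\<lambda>b. if b then return_pmf x else p)"
    have fp': "finite (set_pmf p')" using p(1) by (auto simp: p'_def)
    have Ep': "E p' f = E p f + s * (f x - E p f)" for f
      unfolding E_def p'_def using s p(1) by (intro expectation_bind_bernoulli) auto
    define d where "d i = fst i x - E p (fst i)" for i :: "('e \<Rightarrow> real) \<times> real"
    have "\<tau> i p' = \<tau> i p + s * d i" for i by (simp add: \<tau>_def Ep' d_def)
    then have "(\<Sum>i\<in>I. (\<tau> i p')\<^sup>2) = (\<Sum>i\<in>I. (\<tau> i p)\<^sup>2) + s * (\<Sum>i\<in>I. 2 * \<tau> i p * d i) + s\<^sup>2 * (\<Sum>i\<in>I. (d i)\<^sup>2)"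
      by (simp add: power2_sum power_mult_distrib sum.distrib sum_distrib_left algebra_simps)
    then have J': "J p' = J p + s * ((c x - E p c) - N * (\<Sum>i\<in>I. 2 * \<tau> i p * d i)) - s\<^sup>2 * N * (\<Sum>i\<in>I. (d i)\<^sup>2)"
      unfolding J_def by (simp add: Ep' algebra_simps)
    have "(d i)\<^sup>2 \<le> (G i * (1 + B))\<^sup>2 * (w x)\<^sup>2" if i: "i \<in> I" for i
    proof -
      have "\<bar>E p (fst i)\<bar> \<le> E p (\<lambda>x. G i * w x)"
        by (rule order_trans[OF Eabs Emono[OF p(1) G[OF i]]])
      also have "\<dots> = G i * E p w" by (simp add: E_def)
      also have "\<dots> \<le> G i * B" using G0[OF i] pB by (intro mult_left_mono)
      also have "\<dots> \<le> G i * (B * w x)"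
        using G0[OF i] B0 w1[of x] mult_left_mono[of 1 "w x" B] by (intro mult_left_mono) auto
      finally have "\<bar>d i\<bar> \<le> G i * (1 + B) * w x"
        using G[OF i, of x] by (simp add: d_def algebra_simps)
      then have "\<bar>d i\<bar>\<^sup>2 \<le> (G i * (1 + B) * w x)\<^sup>2" by (intro power_mono) auto
      then show ?thesis by (simp add: power_mult_distrib)
    qed
    then have "(\<Sum>i\<in>I. (d i)\<^sup>2) \<le> B2 * (w x)\<^sup>2"
      unfolding B2_def sum_distrib_right by (rule sum_mono)
    then have d2: "s * (N * (\<Sum>i\<in>I. (d i)\<^sup>2)) \<le> s * (N * (B2 * (w x)\<^sup>2))"
      using s N by (intro mult_left_mono) auto
    also have "\<dots> = \<sigma> * (N * B2) * w x"
      using wx by (simp add: s_def power2_eq_square)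
    finally have d2: "s * (N * (\<Sum>i\<in>I. (d i)\<^sup>2)) \<le> \<sigma> * (N * B2) * w x" .
    have \<sigma>s: "\<sigma>\<^sup>2 = s * (\<sigma> * w x)" using wx by (simp add: s_def power2_eq_square)
    have "J p' < J p + \<sigma>\<^sup>2" using Jup[OF fp'] p(2) by linarith
    then have "s * ((c x - E p c) - N * (\<Sum>i\<in>I. 2 * \<tau> i p * d i)) < s * (\<sigma> * w x + s * (N * (\<Sum>i\<in>I. (d i)\<^sup>2)))"
      unfolding J' \<sigma>s by (simp add: algebra_simps power2_eq_square)
    then have "(c x - E p c) - N * (\<Sum>i\<in>I. 2 * \<tau> i p * d i) \<le> \<sigma> * w x + s * (N * (\<Sum>i\<in>I. (d i)\<^sup>2))"
      using s by simp
    also have "\<dots> \<le> \<sigma> * \<kappa> * w x" using d2 by (simp add: \<kappa>_def algebra_simps)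
    finally show ?thesis
      unfolding \<Lambda>_def d_def by (simp add: sum_distrib_left algebra_simps)
  qed
  have L_sum: "((\<lambda>x. \<Sum>i\<in>H. r i * fst i x), \<Sum>i\<in>H. r i * snd i) \<in> L"
    if "finite H" "H \<subseteq> L" for H and r :: "('e \<Rightarrow> real) \<times> real \<Rightarrow> real"
    using that
  proof (induction H rule: finite_induct)
    case empty
    show ?case using L_scale[OF L_one, of 0] by simp
  next
    case (insert i H)
    then show ?case
      using L_add[OF L_scale[of "fst i" "snd i" "r i"]] by simp
  qed
  define K where "K = E p c - (\<Sum>i\<in>I. 2 * N * \<tau> i p * E p (fst i))"
  have mem: "((\<lambda>x. (\<Sum>i\<in>I. (2 * N * \<tau> i p) * fst i x) + (K * 1 + (\<sigma> * \<kappa>) * w x)),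
      (\<Sum>i\<in>I. (2 * N * \<tau> i p) * snd i) + (K * 1 + (\<sigma> * \<kappa>) * bw)) \<in> L"
    using L_add[OF L_sum[OF I(1,2)] L_add[OF L_scale[OF L_one] L_scale[OF L_w]]] .
  have e1: "(\<lambda>x. (\<Sum>i\<in>I. (2 * N * \<tau> i p) * fst i x) + (K * 1 + (\<sigma> * \<kappa>) * w x)) = \<Lambda>"
    by (simp add: fun_eq_iff \<Lambda>_def K_def sum_subtractf right_diff_distrib)
  have e2: "(\<Sum>i\<in>I. (2 * N * \<tau> i p) * snd i) + (K * 1 + (\<sigma> * \<kappa>) * bw) =
      E p c - 2 * N * (\<Sum>i\<in>I. (\<tau> i p)\<^sup>2) + \<sigma> * \<kappa> * bw"
  proof -
    have "(\<Sum>i\<in>I. (2 * N * \<tau> i p) * E p (fst i)) - (\<Sum>i\<in>I. (2 * N * \<tau> i p) * snd i) = 2 * N * (\<Sum>i\<in>I. (\<tau> i p)\<^sup>2)"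
      by (simp add: \<tau>_def power2_eq_square sum_distrib_left algebra_simps flip: sum_subtractf)
    then show ?thesis by (simp add: K_def)
  qed
  have "(\<Lambda>, E p c - 2 * N * (\<Sum>i\<in>I. (\<tau> i p)\<^sup>2) + \<sigma> * \<kappa> * bw) \<in> L"
    using mem unfolding e1 e2 .
  \<comment> \<open>The multipliers are 2N times the violations, so replacing the moments of p by
    the prescribed ones lowers the value by twice the penalty.\<close>
  from D[OF this feasible] \<sigma>bw
  have key: "D + 2 * N * (\<Sum>i\<in>I. (\<tau> i p)\<^sup>2) - \<epsilon> / 2 \<le> E p c" by linarith
  have sq0: "0 \<le> (\<Sum>i\<in>I. (\<tau> i p)\<^sup>2)" by (rule sum_nonneg) simp
  \<comment> \<open>One half of the doubled penalty absorbs the square coming from Young's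
    inequality; the other half remains below A.\<close>
  have "2 * N * (\<Sum>i\<in>I. (\<tau> i p)\<^sup>2) \<le> C * bw - D + \<epsilon> / 2 + C * \<tau> (w, bw) p"
    using key Ec[OF p(1)] by (simp add: distrib_left)
  also have "\<dots> \<le> A + (\<tau> (w, bw) p)\<^sup>2"
    using quad[of "\<tau> (w, bw) p"] \<epsilon> zero_le_power2[of C] zero_le_power2[of "\<tau> (w, bw) p"] abs_ge_self[of "C * bw - D"] unfolding A_def by linarith
  also have "\<dots> \<le> A + N * (\<Sum>i\<in>I. (\<tau> i p)\<^sup>2)"
    using wI[of p] N(1) mult_right_mono[OF N(1) sq0] zero_le_power2[of "\<tau> (w, bw) p"] by linarith
  finally have "N * (\<Sum>i\<in>I. (\<tau> i p)\<^sup>2) \<le> N * \<epsilon>\<^sup>2" using N(2) by linarith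
  then have sum_le: "(\<Sum>i\<in>I. (\<tau> i p)\<^sup>2) \<le> \<epsilon>\<^sup>2" using N(1) by simp
  show thesis
  proof (rule that[OF p(1)])
    fix g b assume "(g, b) \<in> F"
    then have "(\<tau> (g, b) p)\<^sup>2 \<le> (\<Sum>i\<in>I. (\<tau> i p)\<^sup>2)"
      using I by (intro member_le_sum) (auto simp: I_def)
    then have "\<bar>\<tau> (g, b) p\<bar> \<le> \<epsilon>"
      using sum_le \<epsilon> abs_le_square_iff[of "\<tau> (g, b) p" \<epsilon>] by simp
    then show "\<bar>measure_pmf.expectation p g - b\<bar> \<le> \<epsilon>" by (simp add: \<tau>_def E_def)
  next
    have "0 \<le> 2 * N * (\<Sum>i\<in>I. (\<tau> i p)\<^sup>2)" using N sq0 by simp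
    then have "D - \<epsilon> / 2 \<le> E p c" using key by linarith
    then show "D - \<epsilon> \<le> measure_pmf.expectation p c" using \<epsilon> unfolding E_def by linarith
  qed
qed

text \<open>Approximate solutions for growing finite sets of constraints have bounded second moments
  and a weak limit point. \<open>UI\<close> supplies members of L that dominate the tails and have
  small prescribed values; imposing them as further constraints gives uniform integrability, so that
  quadratic constraints and the objective pass to the limit.\<close>

theorem moment_problem_duality:
  fixes L :: "(('e::euclidean_space \<Rightarrow> real) \<times> real) set" and c :: "'e \<Rightarrow> real"
  assumes L_add: "\<And>g b g' b'. (g, b) \<in> L \<Longrightarrow> (g', b') \<in> L \<Longrightarrow> ((\<lambda>x. g x + g' x), b + b') \<in> L"
    and L_scale: "\<And>g b r. (g, b) \<in> L \<Longrightarrow> ((\<lambda>x. r * g x), r * b) \<in> L"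
    and L_one: "((\<lambda>_. 1), 1) \<in> L"
    and L_sq: "((\<lambda>x. (norm x)\<^sup>2), bW) \<in> L"
    and cont: "\<And>g b. (g, b) \<in> L \<Longrightarrow> continuous_on UNIV g"
    and growth: "\<And>g b. (g, b) \<in> L \<Longrightarrow> \<exists>C. \<forall>x. \<bar>g x\<bar> \<le> C * (1 + (norm x)\<^sup>2)"
    and UI: "\<And>\<epsilon>. 0 < \<epsilon> \<Longrightarrow> \<exists>R g b. 0 \<le> R \<and> (g, b) \<in> L \<and> (\<forall>x. max 0 ((norm x)\<^sup>2 - R) \<le> g x) \<and> b < \<epsilon>"
    and c: "continuous_on UNIV c" "\<And>x. \<bar>c x\<bar> \<le> C * (1 + (norm x)\<^sup>2)"
    and D: "\<And>g b. (g, b) \<in> L \<Longrightarrow> (\<And>x. c x \<le> g x) \<Longrightarrow> D \<le> b"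
    and S: "countable S" "S \<subseteq> L"
  obtains P :: "'e measure" where "prob_space P" "sets P = sets borel" "integrable P (\<lambda>x. (norm x)\<^sup>2)"
    "\<And>g b. (g, b) \<in> S \<Longrightarrow> (\<integral>x. g x \<partial>P) = b" "D \<le> (\<integral>x. c x \<partial>P)"
proof -
  have "\<exists>R g b. 0 \<le> R \<and> (g, b) \<in> L \<and> (\<forall>x. max 0 ((norm x)\<^sup>2 - R) \<le> g x) \<and> b < 1 / real (Suc k)" for k
    by (rule UI) simp
  then obtain R u v where R: "\<And>k. 0 \<le> R k" and uv: "\<And>k. (u k, v k) \<in> L"
    and u: "\<And>k x. max 0 ((norm x)\<^sup>2 - R k) \<le> u k x" and v: "\<And>k. v k < 1 / real (Suc k)"
    by metis
  \<comment> \<open>The enumerated constraints comprise S, the squared norm and the tail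
    functions.\<close>
  define H where "H = from_nat_into (insert ((\<lambda>x. (norm x)\<^sup>2), bW) (S \<union> range (\<lambda>k. (u k, v k))))"
  have H: "range H = insert ((\<lambda>x. (norm x)\<^sup>2), bW) (S \<union> range (\<lambda>k. (u k, v k)))"
    unfolding H_def using S by (intro range_from_nat_into) auto
  have HL: "H n \<in> L" for n
    using H S L_sq uv rangeI[of H n] by auto
  have Lw: "((\<lambda>x. 1 + (norm x)\<^sup>2), 1 + bW) \<in> L" by (rule L_add[OF L_one L_sq])
  \<comment> \<open>The squared norm belongs to every stage, so that the moment bound holds from n =
    0 on.\<close>
  define F where "F n = insert ((\<lambda>x. (norm x)\<^sup>2), bW) (H ` {..n})" for n
  have "\<exists>p. finite (set_pmf p) \<and>
    (\<forall>g b. (g, b) \<in> F n \<longrightarrow> \<bar>measure_pmf.expectation p g - b\<bar> \<le> 1 / real (Suc n)) \<and>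
    D - 1 / real (Suc n) \<le> measure_pmf.expectation p c" for n
    by (rule approximate_moment_duality[of L "\<lambda>x. 1 + (norm x)\<^sup>2" "1 + bW" c C D "F n" "1 / real (Suc n)",
            OF L_add L_scale L_one Lw _ growth c(2) D])
      (use HL L_sq in \<open>auto simp: F_def\<close>)
  then obtain p where p: "\<And>n. finite (set_pmf (p n))"
    "\<And>n g b. (g, b) \<in> F n \<Longrightarrow> \<bar>measure_pmf.expectation (p n) g - b\<bar> \<le> 1 / real (Suc n)"
    "\<And>n. D - 1 / real (Suc n) \<le> measure_pmf.expectation (p n) c"
    by metis
  \<comment> \<open>A \<open>pmf\<close> lives on all subsets; the identity map transfers it to the
    Borel sets.\<close>
  define M where "M n = distr (measure_pmf (p n)) borel (\<lambda>x. x)" for n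
  have Mprob: "prob_space (M n)" for n
    unfolding M_def by (rule measure_pmf.prob_space_distr) simp
  have Msets: "sets (M n) = sets borel" for n by (simp add: M_def)
  have Mint: "(\<integral>x. f x \<partial>M n) = measure_pmf.expectation (p n) f" "integrable (M n) f"
    if "continuous_on UNIV f" for n and f :: "'e \<Rightarrow> real"
  proof -
    have [measurable]: "f \<in> borel_measurable borel" using that by (rule borel_measurable_continuous_onI)
    show "(\<integral>x. f x \<partial>M n) = measure_pmf.expectation (p n) f"
      unfolding M_def by (subst integral_distr) auto
    show "integrable (M n) f"
      unfolding M_def using p(1) by (subst integrable_distr_eq) (auto intro: integrable_measure_pmf_finite)
  qed
  have csq: "continuous_on UNIV (\<lambda>x :: 'e. (norm x)\<^sup>2)" by (intro continuous_intros)
  have bnd: "(\<integral>x. (norm x)\<^sup>2 \<partial>M n) \<le> bW + 1" for n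
  proof -
    have "\<bar>(\<integral>x. (norm x)\<^sup>2 \<partial>M n) - bW\<bar> \<le> 1 / real (Suc n)"
      unfolding Mint(1)[OF csq] by (rule p(2)) (simp add: F_def)
    moreover have "1 / real (Suc n) \<le> 1" by simp
    ultimately show ?thesis by linarith
  qed
  obtain r Q where r: "strict_mono r" and Q: "prob_space Q" "sets Q = sets borel"
    and weak: "\<forall>(f :: 'e \<Rightarrow> real) C. continuous_on UNIV f \<longrightarrow> (\<forall>w. \<bar>f w\<bar> \<le> C) \<longrightarrow>
       (\<lambda>n. \<integral>w. f w \<partial>M (r n)) \<longlonglongrightarrow> (\<integral>w. f w \<partial>Q)"
    by (rule bounded_second_moments_imp_convergent_subsequence[of M, OF Mprob Msets Mint(2)[OF csq] bnd])
  have rlim: "(\<lambda>n. 1 / real (Suc (r n))) \<longlonglongrightarrow> 0"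
    using LIMSEQ_subseq_LIMSEQ[OF LIMSEQ_inverse_real_of_nat r] by (simp add: comp_def inverse_eq_divide)
  have conv: "(\<lambda>n. \<integral>x. g x \<partial>M (r n)) \<longlonglongrightarrow> b" if "(g, b) \<in> range H" for g b
  proof -
    from that obtain m where m: "H m = (g, b)" by (metis imageE)
    have "(\<lambda>n. (\<integral>x. g x \<partial>M (r n)) - b) \<longlonglongrightarrow> 0"
    proof (rule Lim_null_comparison[OF _ rlim])
      have "\<forall>\<^sub>F n in sequentially. m \<le> n" by (rule eventually_ge_at_top)
      then show "\<forall>\<^sub>F n in sequentially. norm ((\<integral>x. g x \<partial>M (r n)) - b) \<le> 1 / real (Suc (r n))"
      proof eventually_elim
        case (elim n)
        then have "m \<le> r n" using seq_suble[OF r, of n] by linarith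
        then have gb: "(g, b) \<in> F (r n)" using m by (auto simp: F_def image_iff intro!: bexI[of _ m])
        have "continuous_on UNIV g" using HL[of m] m by (intro cont[of g b]) simp
        then show ?case using p(2)[OF gb] by (simp add: Mint(1))
      qed
    qed
    then show ?thesis by (simp add: LIM_zero_iff)
  qed
  have tail: "\<exists>R. 0 \<le> R \<and> (\<forall>\<^sub>F n in sequentially. (\<integral>x. max 0 ((norm x)\<^sup>2 - R) \<partial>M (r n)) \<le> \<epsilon>)"
    if \<epsilon>: "0 < \<epsilon>" for \<epsilon>
  proof -
    obtain k where k: "1 / real (Suc k) < \<epsilon>"
      using reals_Archimedean[OF \<epsilon>] by (auto simp: inverse_eq_divide)
    then have "v k < \<epsilon>" using v[of k] by linarith
    then have "\<forall>\<^sub>F n in sequentially. (\<integral>x. u k x \<partial>M (r n)) < \<epsilon>"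
      using conv[of "u k" "v k"] H by (intro order_tendstoD) auto
    then have "\<forall>\<^sub>F n in sequentially. (\<integral>x. max 0 ((norm x)\<^sup>2 - R k) \<partial>M (r n)) \<le> \<epsilon>"
    proof eventually_elim
      case (elim n)
      have "(\<integral>x. max 0 ((norm x)\<^sup>2 - R k) \<partial>M (r n)) \<le> (\<integral>x. u k x \<partial>M (r n))"
        using cont[OF uv] by (intro integral_mono Mint u) (auto intro!: continuous_intros)
      then show ?case using elim by linarith
    qed
    then show ?thesis using R by blast
  qed
  note lim = uniformly_integrable_convergence[of "\<lambda>n. M (r n)", OF Mprob Q(1) Msets Q(2) weak[rule_format] csq _ Mint(2)[OF csq] tail]
  show thesis
  proof (rule that[OF Q])
    show "integrable Q (\<lambda>x. (norm x)\<^sup>2)" by (rule lim(1)[OF _ _ _ _ c]) auto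
    show "(\<integral>x. g x \<partial>Q) = b" if gb: "(g, b) \<in> S" for g b
    proof -
      have "(g, b) \<in> L" using gb S by auto
      then obtain C' where C': "\<And>x. \<bar>g x\<bar> \<le> C' * (1 + (norm x)\<^sup>2)" and g: "continuous_on UNIV g"
        using growth cont by blast
      have "(\<lambda>n. \<integral>x. g x \<partial>M (r n)) \<longlonglongrightarrow> (\<integral>x. g x \<partial>Q)" by (rule lim(3)[OF _ _ _ _ g C']) auto
      moreover have "(\<lambda>n. \<integral>x. g x \<partial>M (r n)) \<longlonglongrightarrow> b" using gb H by (intro conv) auto
      ultimately show ?thesis by (rule LIMSEQ_unique)
    qed
    show "D \<le> (\<integral>x. c x \<partial>Q)"
    proof (rule LIMSEQ_le)
      show "(\<lambda>n. \<integral>x. c x \<partial>M (r n)) \<longlonglongrightarrow> (\<integral>x. c x \<partial>Q)" by (rule lim(3)[OF _ _ _ _ c]) auto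
      show "(\<lambda>n. D - 1 / real (Suc (r n))) \<longlonglongrightarrow> D" using tendsto_diff[OF tendsto_const rlim, of D] by simp
      show "\<exists>N. \<forall>n\<ge>N. D - 1 / real (Suc (r n)) \<le> (\<integral>x. c x \<partial>M (r n))"
        using p(3) by (simp add: Mint(1)[OF c(1)])
    qed
  qed
qed

section \<open>Disintegration\<close>

lemma borel_measurable_fst_snd [measurable]:
  "fst \<in> borel_measurable (borel :: ('a::second_countable_topology \<times> 'b::second_countable_topology) measure)"
  "snd \<in> borel_measurable (borel :: ('a::second_countable_topology \<times> 'b::second_countable_topology) measure)"
  by (simp_all flip: borel_prod)

text \<open>Conditional distribution functions are controlled off a null set only at countably many
  levels, hence a countable generator.\<close>

lemma sets_borel_rat_atMost:
  "sets (borel :: real measure) = sigma_sets UNIV (range (\<lambda>r::rat. {..real_of_rat r}))"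
proof -
  have "(borel :: real measure) = sigma UNIV (range (\<lambda>r::rat. {..real_of_rat r}))"
    unfolding borel_eq_atMost
  proof (intro sigma_eqI sigma_sets_eqI)
    fix A :: "real set" assume "A \<in> range atMost"
    then obtain a where A: "A = {..a}" by auto
    have "{..a} = (\<Inter>r\<in>{r::rat. a < real_of_rat r}. {..real_of_rat r})"
    proof (intro equalityI subsetI)
      fix x assume x: "x \<in> (\<Inter>r\<in>{r::rat. a < real_of_rat r}. {..real_of_rat r})"
      show "x \<in> {..a}"
      proof (rule ccontr)
        assume "x \<notin> {..a}"
        then obtain r where "a < real_of_rat r" "real_of_rat r < x" using of_rat_dense[of a x] by auto
        then show False using x by force
      qed
    qed auto
    also have "\<dots> \<in> sigma_sets UNIV (range (\<lambda>r::rat. {..real_of_rat r}))"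
    proof -
      interpret sigma_algebra UNIV "sigma_sets UNIV (range (\<lambda>r::rat. {..real_of_rat r}))"
        by (rule sigma_algebra_sigma_sets) simp
      show ?thesis
      proof (rule countable_INT')
        show "{r::rat. a < real_of_rat r} \<noteq> {}" using of_rat_dense[of a "a + 1"] by auto
      qed auto
    qed
    finally show "A \<in> sigma_sets UNIV (range (\<lambda>r::rat. {..real_of_rat r}))" by (simp add: A)
  qed auto
  then show ?thesis by (metis Pow_UNIV sets_measure_of top_greatest)
qed

lemma Int_stable_rat_atMost: "Int_stable (range (\<lambda>r::rat. {..real_of_rat r}))"
proof (rule Int_stableI)
  fix a b assume "a \<in> range (\<lambda>r::rat. {..real_of_rat r})" "b \<in> range (\<lambda>r::rat. {..real_of_rat r})"
  then obtain r s where "a = {..real_of_rat r}" "b = {..real_of_rat s}" by blast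
  then have "a \<inter> b = {..real_of_rat (min r s)}" by (auto simp: min_def of_rat_less_eq)
  then show "a \<inter> b \<in> range (\<lambda>r::rat. {..real_of_rat r})" by blast
qed

text \<open>The infimum over rationals to the right is a right-continuous extension; the second
  hypothesis makes it agree with f at the rationals. Values vanish at negative levels since the
  section e is nonnegative.\<close>

lemma distribution_from_rational_cdf:
  fixes f :: "rat \<Rightarrow> real"
  assumes mono: "\<And>r s. r \<le> s \<Longrightarrow> f r \<le> f s"
    and right: "\<And>r. (\<lambda>n. f (r + 1 / of_nat (Suc n))) \<longlonglongrightarrow> f r"
    and zero: "\<And>r. r < 0 \<Longrightarrow> f r = 0" and one: "(\<lambda>n. f (of_nat n)) \<longlonglongrightarrow> 1"
  shows "\<exists>M. real_distribution M \<and> (\<forall>r. emeasure M {..real_of_rat r} = ennreal (f r))"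
proof -
  have f0: "0 \<le> f r" for r
    using mono[of "min r (-1)" r] zero[of "min r (-1)"] by simp
  have f1: "f r \<le> 1" for r
  proof (rule LIMSEQ_le_const[OF one])
    obtain N :: nat where "r \<le> of_nat N" using real_arch_simple[of r] by blast
    then show "\<exists>N. \<forall>n\<ge>N. f r \<le> f (of_nat n)"
      by (intro exI[of _ N]) (auto intro!: mono elim!: order_trans)
  qed
  define G where "G t = (INF r\<in>{r. t < real_of_rat r}. f r)" for t
  have ne: "{r. t < real_of_rat r} \<noteq> {}" for t
    using of_rat_dense[of t "t + 1"] by auto
  have bdd: "bdd_below (f ` S)" for S using f0 by (auto intro!: bdd_belowI[of _ 0])
  have Gle: "G t \<le> f r" if "t < real_of_rat r" for t r
    unfolding G_def using that by (intro cINF_lower bdd) auto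
  have Grat: "G (real_of_rat r) = f r" for r
  proof (rule antisym)
    show "G (real_of_rat r) \<le> f r"
    proof (rule LIMSEQ_le_const[OF right])
      show "\<exists>N. \<forall>n\<ge>N. G (real_of_rat r) \<le> f (r + 1 / of_nat (Suc n))"
        by (intro exI[of _ 0] allI impI Gle) (simp add: of_rat_less del: of_nat_Suc)
    qed
    show "f r \<le> G (real_of_rat r)"
      unfolding G_def by (intro cINF_greatest[OF ne]) (auto intro!: mono simp: of_rat_less)
  qed
  have Gmono: "G s \<le> G t" if "s \<le> t" for s t
    unfolding G_def[of t] using ne that by (intro cINF_greatest) (auto intro!: Gle)
  have Gright: "continuous (at_right a) G" for a
    unfolding continuous_within
  proof (rule order_tendstoI)
    fix y assume "y < G a"
    then show "\<forall>\<^sub>F x in at_right a. y < G x"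
      using Gmono by (auto simp: eventually_at_right_field intro!: exI[of _ "a + 1"]) (meson less_le_trans less_imp_le)
  next
    fix y assume "G a < y"
    then obtain r where r: "a < real_of_rat r" "f r < y"
      unfolding G_def using cINF_less_iff[OF ne bdd, of a y] by auto
    show "\<forall>\<^sub>F x in at_right a. G x < y"
      unfolding eventually_at_right_field
      using r Gle by (intro exI[of _ "real_of_rat r"]) (auto intro: le_less_trans)
  qed
  have Gbot: "(G \<longlongrightarrow> 0) at_bot"
  proof (rule tendsto_eventually)
    have "\<forall>\<^sub>F t in at_bot. t < (-1 :: real)" by (rule eventually_gt_at_bot)
    then show "\<forall>\<^sub>F t in at_bot. G t = 0"
    proof eventually_elim
      case (elim t)
      have "G t \<le> f (-1)" using elim by (intro Gle) simp
      moreover have "0 \<le> G t" unfolding G_def using ne f0 by (intro cINF_greatest) auto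
      ultimately show ?case using zero[of "-1"] by simp
    qed
  qed
  have Gtop: "(G \<longlongrightarrow> 1) at_top"
  proof (rule order_tendstoI)
    fix y :: real assume "y < 1"
    then obtain n where n: "y < f (of_nat n)"
      using order_tendstoD(1)[OF one] by (auto simp: eventually_sequentially)
    have "\<forall>\<^sub>F t in at_top. real n \<le> t" by (rule eventually_ge_at_top)
    then show "\<forall>\<^sub>F t in at_top. y < G t"
      by eventually_elim (use n Gmono[of "real n"] Grat[of "of_nat n"] in force)
  next
    fix y :: real assume "1 < y"
    moreover have "G t \<le> 1" for t
    proof -
      obtain r where "t < real_of_rat r" using ne[of t] by auto
      then show ?thesis using Gle f1 order_trans by blast
    qed
    ultimately show "\<forall>\<^sub>F t in at_top. G t < y"
      by (intro always_eventually allI) (rule le_less_trans)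
  qed
  have M: "real_distribution (interval_measure G)"
    by (rule real_distribution_interval_measure[OF Gmono Gright Gbot Gtop])
  then interpret M: real_distribution "interval_measure G" .
  have "emeasure (interval_measure G) {..real_of_rat r} = ennreal (f r)" for r
    using cdf_interval_measure[OF Gmono Gright Gbot] Grat[of r]
    by (simp add: M.emeasure_eq_measure cdf_def fun_eq_iff)
  then show ?thesis using M by blast
qed

lemma prod_measure_eqI:
  fixes M N :: "('a::euclidean_space \<times> 'b::euclidean_space) measure"
  assumes "finite_measure M" and sets: "sets M = sets borel" "sets N = sets borel"
    and eq: "\<And>A B. A \<in> sets borel \<Longrightarrow> B \<in> sets borel \<Longrightarrow> emeasure M (A \<times> B) = emeasure N (A \<times> B)"
  shows "M = N"
proof -
  interpret M: finite_measure M by fact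
  let ?E = "{A \<times> B | A B. A \<in> sets (borel :: 'a measure) \<and> B \<in> sets (borel :: 'b measure)}"
  have sig: "sets (borel :: ('a \<times> 'b) measure) = sigma_sets UNIV ?E"
    unfolding borel_prod[symmetric] sets_pair_measure by simp
  show ?thesis
  proof (rule measure_eqI_generator_eq[where E="?E" and A="\<lambda>_. UNIV" and \<Omega>=UNIV])
    show "Int_stable ?E"
      using Int_stable_pair_measure_generator[of "borel :: 'a measure" "borel :: 'b measure"] .
    show "range (\<lambda>_. UNIV) \<subseteq> ?E" by (auto intro!: exI[of _ UNIV])
    show "emeasure M UNIV \<noteq> \<infinity>" by simp
  qed (use eq sets sig in auto)
qed

lemma measurable_joint_kernel:
  fixes \<mu> :: "'a::euclidean_space measure" and \<kappa> :: "'a \<Rightarrow> 'b::euclidean_space measure"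
  assumes "sets \<mu> = sets borel" "\<kappa> \<in> measurable \<mu> (prob_algebra borel)"
  shows "(\<lambda>x. distr (\<kappa> x) (borel :: ('a \<times> 'b) measure) (Pair x)) \<in> measurable \<mu> (prob_algebra borel)"
proof (rule measurable_distr_prob_space2[OF assms(2)])
  have "sets (\<mu> \<Otimes>\<^sub>M (borel :: 'b measure)) = sets (borel :: ('a \<times> 'b) measure)"
    unfolding borel_prod[symmetric] by (rule sets_pair_measure_cong[OF assms(1) refl])
  then have "(\<lambda>w. w) \<in> \<mu> \<Otimes>\<^sub>M (borel :: 'b measure) \<rightarrow>\<^sub>M borel"
    by (rule measurable_ident_sets)
  moreover have "(\<lambda>(x, y). (x, y)) = (\<lambda>w :: 'a \<times> 'b. w)" by auto
  ultimately show "(\<lambda>(x, y). (x, y)) \<in> \<mu> \<Otimes>\<^sub>M (borel :: 'b measure) \<rightarrow>\<^sub>M borel"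
    by simp
qed

text \<open>Conditioning is carried out on the line: the conditional distribution function of e(y)
  comes from Radon-Nikodym derivatives at rational levels, and the resulting laws are mapped back by
  \<gamma>.\<close>

lemma disintegration:
  fixes P :: "('a::euclidean_space \<times> 'b::euclidean_space) measure"
  assumes P: "prob_space P" "sets P = sets borel" and \<mu>: "distr P borel fst = \<mu>"
  obtains \<kappa> where "\<kappa> \<in> measurable \<mu> (prob_algebra borel)"
    "P = bind \<mu> (\<lambda>x. distr (\<kappa> x) borel (Pair x))"
proof -
  interpret P: prob_space P by fact
  note [measurable_cong] = P(2)
  have spP: "space P = UNIV" using sets_eq_imp_space_eq[OF P(2)] by simp
  have s\<mu>[measurable_cong]: "sets \<mu> = sets borel" using \<mu> by auto
  have sp\<mu>: "space \<mu> = UNIV" using \<mu> by auto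
  have "prob_space \<mu>" unfolding \<mu>[symmetric] by (rule P.prob_space_distr) simp
  then interpret \<mu>: prob_space \<mu> .
  have \<mu>P: "emeasure \<mu> A = emeasure P (A \<times> UNIV)" if "A \<in> sets borel" for A
    unfolding \<mu>[symmetric] using that
    by (subst emeasure_distr) (auto simp: spP intro!: arg_cong[where f="emeasure P"])
  have prod_sets[measurable]: "A \<times> B \<in> sets borel" if "A \<in> sets borel" "B \<in> sets borel"
    for A :: "'a set" and B :: "'b set"
    using that unfolding borel_prod[symmetric] by auto
  \<comment> \<open>The law of the first coordinate on the event that the second lies in B; its
    density is the conditional probability of B.\<close>
  define \<nu> where "\<nu> B = distr (density P (indicator (UNIV \<times> B))) borel fst" for B :: "'b set"
  define k where "k B = RN_deriv \<mu> (\<nu> B)" for B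
  have km[measurable]: "k B \<in> borel_measurable \<mu>" for B unfolding k_def by simp
  have \<nu>: "emeasure (\<nu> B) A = emeasure P (A \<times> B)" if [measurable]: "A \<in> sets borel" "B \<in> sets borel" for A B
  proof -
    have [simp]: "fst -` A = A \<times> UNIV" by auto
    have "emeasure (\<nu> B) A = (\<integral>\<^sup>+w. indicator (UNIV \<times> B) w * indicator (fst -` A) w \<partial>P)"
      unfolding \<nu>_def by (subst emeasure_distr, simp, simp, subst emeasure_density) (auto simp: spP)
    also have "\<dots> = (\<integral>\<^sup>+w. indicator (A \<times> B) w \<partial>P)"
      by (intro nn_integral_cong) (auto simp: indicator_def)
    finally show ?thesis by simp
  qed
  have s\<nu>: "sets (\<nu> B) = sets \<mu>" for B by (simp add: \<nu>_def s\<mu>)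
  have dk: "density \<mu> (k B) = \<nu> B" if B: "B \<in> sets borel" for B
    unfolding k_def
  proof (rule \<mu>.density_RN_deriv)
    show "absolutely_continuous \<mu> (\<nu> B)"
      unfolding absolutely_continuous_def
    proof
      fix A assume "A \<in> null_sets \<mu>"
      then have A[measurable]: "A \<in> sets borel" and "emeasure \<mu> A = 0" by (auto simp: null_sets_def s\<mu>)
      then have "emeasure P (A \<times> UNIV) = 0" using \<mu>P by simp
      moreover have "emeasure P (A \<times> B) \<le> emeasure P (A \<times> UNIV)" by (intro emeasure_mono) auto
      ultimately show "A \<in> null_sets (\<nu> B)" using \<nu>[OF A B] by (auto simp: s\<nu>)
    qed
  qed (rule s\<nu>)
  have kint: "(\<integral>\<^sup>+x. k B x * indicator A x \<partial>\<mu>) = emeasure P (A \<times> B)"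
    if [measurable]: "A \<in> sets borel" "B \<in> sets borel" for A B
    using dk[OF that(2)] \<nu>[OF that] by (metis emeasure_density km s\<mu> that(1))
  \<comment> \<open>Each rule for conditional probabilities used below (additivity, monotonicity,
    continuity from above) follows from almost sure uniqueness of the density.\<close>
  have kuniq: "AE x in \<mu>. f x = k B x"
    if [measurable]: "f \<in> borel_measurable \<mu>" and B: "B \<in> sets borel"
      and eq: "\<And>A. A \<in> sets borel \<Longrightarrow> (\<integral>\<^sup>+x. f x * indicator A x \<partial>\<mu>) = emeasure P (A \<times> B)" for f B
    unfolding k_def
  proof (rule \<mu>.RN_deriv_unique)
    show "density \<mu> f = \<nu> B"
      by (rule measure_eqI) (auto simp: s\<nu> s\<mu> emeasure_density eq \<nu> B)
  qed fact
  have kadd: "AE x in \<mu>. k B x + k B' x = k (B \<union> B') x"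
    if [measurable]: "B \<in> sets borel" "B' \<in> sets borel" and "B \<inter> B' = {}" for B B'
  proof (rule kuniq)
    fix A :: "'a set" assume [measurable]: "A \<in> sets borel"
    have "(\<integral>\<^sup>+x. (k B x + k B' x) * indicator A x \<partial>\<mu>) = emeasure P (A \<times> B) + emeasure P (A \<times> B')"
      by (simp add: distrib_right nn_integral_add kint)
    also have "\<dots> = emeasure P (A \<times> B \<union> A \<times> B')"
      using that(3) by (intro plus_emeasure) auto
    also have "A \<times> B \<union> A \<times> B' = A \<times> (B \<union> B')" by auto
    finally show "(\<integral>\<^sup>+x. (k B x + k B' x) * indicator A x \<partial>\<mu>) = emeasure P (A \<times> (B \<union> B'))" .
  qed auto
  have k1: "AE x in \<mu>. 1 = k UNIV x"
    by (rule kuniq) (auto simp: \<mu>P)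
  have k0: "AE x in \<mu>. 0 = k {} x"
    by (rule kuniq) auto
  have kmono: "AE x in \<mu>. k B x \<le> k B' x" if [measurable]: "B \<in> sets borel" "B' \<in> sets borel" and "B \<subseteq> B'" for B B'
  proof -
    have u: "B \<union> (B' - B) = B'" using that by auto
    have "AE x in \<mu>. k B x + k (B' - B) x = k B' x"
      using kadd[of B "B' - B"] unfolding u by auto
    then show ?thesis by eventually_elim (metis le_iff_add)
  qed
  have kdec: "AE x in \<mu>. (INF n. k (B n) x) = k (\<Inter>n. B n) x"
    if [measurable]: "\<And>n. B n \<in> sets borel" and dec: "decseq B" for B :: "nat \<Rightarrow> 'b set"
  proof (rule kuniq)
    fix A :: "'a set" assume [measurable]: "A \<in> sets borel"
    have "(\<integral>\<^sup>+x. (INF n. k (B n) x) * indicator A x \<partial>\<mu>) = (\<integral>\<^sup>+x. (INF n. k (B n) x * indicator A x) \<partial>\<mu>)"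
      by (intro nn_integral_cong) (auto simp: indicator_def)
    also have "\<dots> = (INF n. \<integral>\<^sup>+x. k (B n) x * indicator A x \<partial>\<mu>)"
    proof (rule nn_integral_monotone_convergence_INF_AE)
      show "AE x in \<mu>. k (B (Suc i)) x * indicator A x \<le> k (B i) x * indicator A x" for i
        using kmono[of "B (Suc i)" "B i"] dec by (auto elim!: eventually_mono intro!: mult_right_mono simp: decseq_Suc_iff)
      show "(\<integral>\<^sup>+x. k (B 0) x * indicator A x \<partial>\<mu>) < \<infinity>"
        by (simp add: kint P.emeasure_eq_measure)
    qed simp
    also have "\<dots> = (INF n. emeasure P (A \<times> B n))" by (simp add: kint)
    also have "\<dots> = emeasure P (\<Inter>n. A \<times> B n)"
      using dec by (intro INF_emeasure_decseq) (auto simp: decseq_def)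
    also have "(\<Inter>n. A \<times> B n) = A \<times> (\<Inter>n. B n)" by auto
    finally show "(\<integral>\<^sup>+x. (INF n. k (B n) x) * indicator A x \<partial>\<mu>) = emeasure P (A \<times> (\<Inter>n. B n))" .
  qed auto
  obtain \<gamma> :: "real \<Rightarrow> 'b" and e :: "'b \<Rightarrow> real" where \<gamma>: "continuous_on UNIV \<gamma>"
    and e[measurable]: "e \<in> borel_measurable borel" and \<gamma>e: "\<And>y. \<gamma> (e y) = y"
    and e0: "\<And>y. 0 \<le> e y"
    by (rule continuous_surjection_with_measurable_section) (rule that)
  have \<gamma>m[measurable]: "\<gamma> \<in> borel_measurable borel" using \<gamma> by (rule borel_measurable_continuous_onI)
  define L where "L r = {y. e y \<le> real_of_rat r}" for r :: rat
  have L[measurable]: "L r \<in> sets borel" for r unfolding L_def by measurable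
  have decs: "AE x in \<mu>. \<forall>r s. r \<le> s \<longrightarrow> k (L r) x \<le> k (L s) x"
  proof (subst AE_all_countable, intro allI)
    fix r show "AE x in \<mu>. \<forall>s. r \<le> s \<longrightarrow> k (L r) x \<le> k (L s) x"
    proof (subst AE_all_countable, intro allI)
      fix s show "AE x in \<mu>. r \<le> s \<longrightarrow> k (L r) x \<le> k (L s) x"
      proof (cases "r \<le> s")
        case True
        then have "L r \<subseteq> L s" by (auto simp: L_def of_rat_less_eq elim!: order_trans)
        then show ?thesis using kmono[OF L L] by (auto elim!: eventually_mono)
      qed simp
    qed
  qed
  have infs: "AE x in \<mu>. \<forall>r. (INF n. k (L (r + 1 / of_nat (Suc n))) x) = k (L r) x"
  proof (subst AE_all_countable, intro allI)
    fix r
    have "decseq (\<lambda>n. L (r + 1 / of_nat (Suc n)))"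
      unfolding decseq_def L_def
      by (auto simp: of_rat_less_eq frac_le elim!: order_trans simp del: of_nat_Suc)
    moreover have "(\<Inter>n. L (r + 1 / of_nat (Suc n))) = L r"
    proof
      show "(\<Inter>n. L (r + 1 / of_nat (Suc n))) \<subseteq> L r"
      proof
        fix y assume y: "y \<in> (\<Inter>n. L (r + 1 / of_nat (Suc n)))"
        have "e y \<le> real_of_rat r"
        proof (rule LIMSEQ_le_const)
          show "(\<lambda>n. real_of_rat r + 1 / real (Suc n)) \<longlonglongrightarrow> real_of_rat r"
            using tendsto_add[OF tendsto_const LIMSEQ_inverse_real_of_nat, of "real_of_rat r"]
            by (simp add: inverse_eq_divide)
          show "\<exists>N. \<forall>n\<ge>N. e y \<le> real_of_rat r + 1 / real (Suc n)"
            using y by (auto simp: L_def of_rat_add of_rat_divide simp del: of_nat_Suc)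
        qed
        then show "y \<in> L r" by (simp add: L_def)
      qed
      show "L r \<subseteq> (\<Inter>n. L (r + 1 / of_nat (Suc n)))"
        by (auto simp: L_def of_rat_less_eq elim!: order_trans simp del: of_nat_Suc)
    qed
    ultimately show "AE x in \<mu>. (INF n. k (L (r + 1 / of_nat (Suc n))) x) = k (L r) x"
      using kdec[of "\<lambda>n. L (r + 1 / of_nat (Suc n))"] by simp
  qed
  have negs: "AE x in \<mu>. \<forall>r<0. k (L r) x = 0"
  proof -
    have "L r = {}" if "r < 0" for r
      using e0 that by (auto simp: L_def not_le) (meson less_le_trans of_rat_less_0_iff)
    then show ?thesis using k0 by (auto elim!: eventually_mono)
  qed
  have ones: "AE x in \<mu>. (\<lambda>n. k (L (of_nat n)) x) \<longlonglongrightarrow> 1"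
  proof -
    \<comment> \<open>Convergence to total mass is obtained from continuity from above, applied to
      the complements.\<close>
    have dec: "decseq (\<lambda>n. - L (of_nat n))"
      unfolding decseq_def L_def by (auto simp: of_rat_less_eq)
    have emp: "(\<Inter>n. - L (of_nat n)) = {}"
      using real_arch_simple by (auto simp: L_def)
    have 1: "AE x in \<mu>. (INF n. k (- L (of_nat n)) x) = 0"
      using kdec[OF _ dec] k0 unfolding emp by auto
    have 2: "AE x in \<mu>. \<forall>n. k (- L (of_nat n)) x + k (L (of_nat n)) x = 1"
    proof (subst AE_all_countable, intro allI)
      fix n :: nat
      show "AE x in \<mu>. k (- L (of_nat n)) x + k (L (of_nat n)) x = 1"
        using kadd[of "- L (of_nat n)" "L (of_nat n)"] k1 by auto
    qed
    have 3: "AE x in \<mu>. \<forall>n. k (- L (of_nat (Suc n))) x \<le> k (- L (of_nat n)) x"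
    proof (subst AE_all_countable, intro allI)
      fix n :: nat
      show "AE x in \<mu>. k (- L (of_nat (Suc n))) x \<le> k (- L (of_nat n)) x"
        using dec by (intro kmono) (auto simp: decseq_Suc_iff)
    qed
    from 1 2 3 show ?thesis
    proof eventually_elim
      case (elim x)
      have "decseq (\<lambda>n. k (- L (of_nat n)) x)" using elim(3) by (simp add: decseq_Suc_iff)
      then have lim: "(\<lambda>n. k (- L (of_nat n)) x) \<longlonglongrightarrow> 0" using LIMSEQ_INF elim(1) by metis
      have "k (L (of_nat n)) x = 1 - k (- L (of_nat n)) x" for n
        using elim(2) by (metis ennreal_add_diff_cancel_left ennreal_add_eq_top ennreal_one_neq_top)
      then show ?case using tendsto_diff_ennreal[OF tendsto_const lim, of 1] by simp
    qed
  qed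
  have les: "AE x in \<mu>. \<forall>r. k (L r) x \<le> 1"
  proof (subst AE_all_countable, intro allI)
    fix r show "AE x in \<mu>. k (L r) x \<le> 1"
      using kmono[of "L r" UNIV] k1 by auto
  qed
  define good where "good x \<longleftrightarrow> (\<exists>M. real_distribution M \<and> (\<forall>r. emeasure M {..real_of_rat r} = k (L r) x))" for x
  have "AE x in \<mu>. good x"
    using decs infs negs ones les
  proof eventually_elim
    case (elim x)
    define f where "f r = enn2real (k (L r) x)" for r
    have fk: "ennreal (f r) = k (L r) x" for r
      unfolding f_def using elim(5) by (intro ennreal_enn2real) (metis ennreal_one_less_top le_less_trans)
    have fk': "f r \<le> f s \<longleftrightarrow> k (L r) x \<le> k (L s) x" for r s
    proof -
      have "0 \<le> f s" by (simp add: f_def)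
      from ennreal_le_iff[OF this, of "f r"] show ?thesis by (simp only: fk)
    qed
    have "\<exists>M. real_distribution M \<and> (\<forall>r. emeasure M {..real_of_rat r} = ennreal (f r))"
    proof (rule distribution_from_rational_cdf)
      show "f r \<le> f s" if "r \<le> s" for r s using elim(1) that by (simp add: fk')
      show "f r = 0" if "r < 0" for r using elim(3) that by (simp add: f_def)
      show "(\<lambda>n. f (of_nat n)) \<longlonglongrightarrow> 1"
        unfolding f_def using elim(4) by (intro tendsto_enn2real) auto
      show "(\<lambda>n. f (r + 1 / of_nat (Suc n))) \<longlonglongrightarrow> f r" for r
        unfolding f_def[of "r + _"]
      proof (rule tendsto_enn2real)
        have "decseq (\<lambda>n. k (L (r + 1 / of_nat (Suc n))) x)"
          using elim(1) by (auto simp: decseq_def frac_le simp del: of_nat_Suc)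
        then show "(\<lambda>n. k (L (r + 1 / of_nat (Suc n))) x) \<longlonglongrightarrow> ennreal (f r)"
          using LIMSEQ_INF elim(2) fk by metis
      qed (simp add: f_def)
    qed
    then show ?case by (simp add: good_def fk)
  qed
  then obtain N where N: "N \<in> null_sets \<mu>" "{x. \<not> good x} \<subseteq> N"
    using sp\<mu> by (auto elim!: AE_E simp: null_sets_def)
  \<comment> \<open>Points where \<open>good\<close> fails are enclosed in a measurable null set N,
    on which an arbitrary law is put so that the kernel stays measurable.\<close>
  define \<kappa>' where "\<kappa>' x = (if x \<in> N then return borel 0 else
     (SOME M. real_distribution M \<and> (\<forall>r. emeasure M {..real_of_rat r} = k (L r) x)))" for x
  have \<kappa>': "real_distribution (\<kappa>' x) \<and> (\<forall>r. emeasure (\<kappa>' x) {..real_of_rat r} = k (L r) x)" if "x \<notin> N" for x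
  proof -
    have "good x" using that N by auto
    from someI_ex[OF this[unfolded good_def]] show ?thesis using that by (simp add: \<kappa>'_def)
  qed
  have Nm[measurable]: "N \<in> sets borel" using N(1) by (auto simp: null_sets_def s\<mu>)
  have \<kappa>'_prob: "prob_space (\<kappa>' x)" "sets (\<kappa>' x) = sets borel" for x
  proof -
    show "prob_space (\<kappa>' x)"
      using \<kappa>'[of x] by (cases "x \<in> N") (auto simp: \<kappa>'_def[of x] prob_space_return real_distribution_def)
    show "sets (\<kappa>' x) = sets borel"
      using \<kappa>'[of x] by (cases "x \<in> N") (auto simp: \<kappa>'_def[of x] real_distribution.events_eq_borel)
  qed
  have \<kappa>'m[measurable]: "\<kappa>' \<in> measurable \<mu> (prob_algebra borel)"
  proof (rule measurable_prob_algebra_generated[OF sets_borel_rat_atMost Int_stable_rat_atMost])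
    fix A assume "A \<in> range (\<lambda>r. {..real_of_rat r})"
    then obtain r where A: "A = {..real_of_rat r}" by blast
    have "emeasure (\<kappa>' x) A = (if x \<in> N then indicator A 0 else k (L r) x)" for x
      using \<kappa>'[of x] by (auto simp: A \<kappa>'_def[of x])
    then show "(\<lambda>x. emeasure (\<kappa>' x) A) \<in> borel_measurable \<mu>" by simp
  qed (auto simp: \<kappa>'_prob)
  define \<kappa> where "\<kappa> x = distr (\<kappa>' x) borel \<gamma>" for x
  have \<kappa>m[measurable]: "\<kappa> \<in> measurable \<mu> (prob_algebra borel)"
    unfolding \<kappa>_def by (rule measurable_compose[OF \<kappa>'m measurable_distr_prob_space[OF \<gamma>m]])
  note [measurable] = measurable_prob_algebraD[OF \<kappa>'m] measurable_prob_algebraD[OF \<kappa>m]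
  have rect: "emeasure P (A \<times> B) = (\<integral>\<^sup>+x. emeasure (\<kappa> x) B * indicator A x \<partial>\<mu>)"
    if A[measurable]: "A \<in> sets borel" and B[measurable]: "B \<in> sets borel" for A B
  proof -
    \<comment> \<open>For fixed A, the law of e(y) on the event x \<in> A is compared with its
      reconstruction from the kernel; on rational half lines both reduce to the densities.\<close>
    define N1 where "N1 = distr (density P (indicator (A \<times> UNIV))) borel (\<lambda>w. e (snd w))"
    define N2 where "N2 = density \<mu> (indicator A) \<bind> \<kappa>'"
    have \<kappa>'m2: "\<kappa>' \<in> measurable (density \<mu> (indicator A)) (subprob_algebra borel)" by simp
    have N1: "emeasure N1 C = emeasure P (A \<times> (e -` C))" if [measurable]: "C \<in> sets borel" for C
    proof -
      have [measurable]: "e -` C \<in> sets borel" using measurable_sets[OF e that] by simp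
      have [simp]: "(\<lambda>w :: 'a \<times> 'b. e (snd w)) -` C = UNIV \<times> (e -` C)" by auto
      have "emeasure N1 C = (\<integral>\<^sup>+w. indicator (A \<times> UNIV) w * indicator ((\<lambda>w. e (snd w)) -` C) w \<partial>P)"
        unfolding N1_def by (subst emeasure_distr, simp, simp, subst emeasure_density) (auto simp: spP)
      also have "\<dots> = (\<integral>\<^sup>+w. indicator (A \<times> (e -` C)) w \<partial>P)"
        by (intro nn_integral_cong) (auto simp: indicator_def)
      finally show ?thesis by simp
    qed
    have N2: "emeasure N2 C = (\<integral>\<^sup>+x. emeasure (\<kappa>' x) C * indicator A x \<partial>\<mu>)" if [measurable]: "C \<in> sets borel" for C
    proof -
      have "emeasure N2 C = (\<integral>\<^sup>+x. emeasure (\<kappa>' x) C \<partial>density \<mu> (indicator A))"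
        unfolding N2_def by (rule emeasure_bind[OF _ \<kappa>'m2 that]) (simp add: sp\<mu>)
      also have "\<dots> = (\<integral>\<^sup>+x. indicator A x * emeasure (\<kappa>' x) C \<partial>\<mu>)"
        by (subst nn_integral_density) auto
      finally show ?thesis by (simp add: mult.commute)
    qed
    have "N1 = N2"
    proof (rule measure_eqI_generator_eq[OF Int_stable_rat_atMost, where \<Omega>=UNIV and A="\<lambda>n. {..real_of_rat (of_nat n)}"])
      fix X assume "X \<in> range (\<lambda>r. {..real_of_rat r})"
      then obtain r where X: "X = {..real_of_rat r}" by blast
      have "emeasure N2 X = (\<integral>\<^sup>+x. k (L r) x * indicator A x \<partial>\<mu>)"
      proof (subst N2)
        have "AE x in \<mu>. x \<notin> N" using N(1) by (rule AE_not_in)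
        then show "(\<integral>\<^sup>+x. emeasure (\<kappa>' x) X * indicator A x \<partial>\<mu>) = (\<integral>\<^sup>+x. k (L r) x * indicator A x \<partial>\<mu>)"
          by (intro nn_integral_cong_AE) (auto elim!: eventually_mono dest!: \<kappa>' simp: X)
      qed (simp add: X)
      also have "\<dots> = emeasure P (A \<times> L r)" by (rule kint) auto
      also have "\<dots> = emeasure N1 X" by (subst N1) (auto simp: X L_def vimage_def)
      finally show "emeasure N1 X = emeasure N2 X" by simp
    next
      show "sets N1 = sigma_sets UNIV (range (\<lambda>r. {..real_of_rat r}))"
        by (simp add: N1_def sets_borel_rat_atMost)
      show "sets N2 = sigma_sets UNIV (range (\<lambda>r. {..real_of_rat r}))"
        unfolding N2_def sets_borel_rat_atMost[symmetric]
        by (rule sets_bind) (auto simp: \<kappa>'_prob sp\<mu>)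
      show "(\<Union>n. {..real_of_rat (of_nat n)}) = UNIV" using real_arch_simple by auto
      show "emeasure N1 {..real_of_rat (of_nat i)} \<noteq> \<infinity>" for i
        by (subst N1) (auto simp: P.emeasure_eq_measure)
      show "range (\<lambda>n. {..real_of_rat (of_nat n)}) \<subseteq> range (\<lambda>r. {..real_of_rat r})" by blast
    qed simp
    have "\<gamma> -` B \<in> sets borel" using measurable_sets[OF \<gamma>m B] by simp
    then have "emeasure P (A \<times> (e -` (\<gamma> -` B))) = (\<integral>\<^sup>+x. emeasure (\<kappa>' x) (\<gamma> -` B) * indicator A x \<partial>\<mu>)"
      using N1[of "\<gamma> -` B"] N2[of "\<gamma> -` B"] \<open>N1 = N2\<close> by simp
    moreover have "e -` (\<gamma> -` B) = B" by (auto simp: \<gamma>e)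
    moreover have "emeasure (\<kappa>' x) (\<gamma> -` B) = emeasure (\<kappa> x) B" for x
    proof -
      have "\<gamma> \<in> borel_measurable (\<kappa>' x)"
        using \<gamma>m measurable_cong_sets[OF \<kappa>'_prob(2) refl] by blast
      moreover
      have "space (\<kappa>' x) = UNIV" using sets_eq_imp_space_eq[OF \<kappa>'_prob(2)] by simp
      ultimately show ?thesis unfolding \<kappa>_def by (subst emeasure_distr) auto
    qed
    ultimately show ?thesis by simp
  qed
  have jm: "(\<lambda>x. distr (\<kappa> x) borel (Pair x)) \<in> measurable \<mu> (subprob_algebra (borel :: ('a \<times> 'b) measure))"
    by (rule measurable_prob_algebraD[OF measurable_joint_kernel[OF s\<mu> \<kappa>m]])
  show thesis
  proof (rule that[OF \<kappa>m], rule prod_measure_eqI)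
    show "finite_measure P" by unfold_locales
    show "sets P = sets borel" by fact
    show "sets (\<mu> \<bind> (\<lambda>x. distr (\<kappa> x) borel (Pair x))) = sets borel"
      by (rule sets_bind) (auto simp: sp\<mu>)
    fix A :: "'a set" and B :: "'b set" assume [measurable]: "A \<in> sets borel" "B \<in> sets borel"
    have "emeasure (\<mu> \<bind> (\<lambda>x. distr (\<kappa> x) borel (Pair x))) (A \<times> B) =
        (\<integral>\<^sup>+x. emeasure (distr (\<kappa> x) borel (Pair x)) (A \<times> B) \<partial>\<mu>)"
      by (rule emeasure_bind[OF _ jm]) (auto simp: sp\<mu>)
    also have "\<dots> = (\<integral>\<^sup>+x. emeasure (\<kappa> x) B * indicator A x \<partial>\<mu>)"
    proof (intro nn_integral_cong)
      fix x
      have s: "sets (\<kappa> x) = sets borel" by (simp add: \<kappa>_def)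
      have "space (\<kappa> x) = UNIV" using sets_eq_imp_space_eq[OF s] by simp
      moreover have "Pair x \<in> measurable borel (borel :: ('a \<times> 'b) measure)"
        by (simp flip: borel_prod)
      then have "Pair x \<in> measurable (\<kappa> x) (borel :: ('a \<times> 'b) measure)"
        using measurable_cong_sets[OF s refl] by blast
      ultimately show "emeasure (distr (\<kappa> x) borel (Pair x)) (A \<times> B) = emeasure (\<kappa> x) B * indicator A x"
        by (subst emeasure_distr) (auto simp: indicator_def)
    qed
    finally show "emeasure P (A \<times> B) = emeasure (\<mu> \<bind> (\<lambda>x. distr (\<kappa> x) borel (Pair x))) (A \<times> B)"
      using rect by simp
  qed
qed

section \<open>Weak duality\<close>

lemma nn_integral_finite_imp_enn2real:
  assumes [measurable]: "a \<in> borel_measurable M" and "(\<integral>\<^sup>+x. a x \<partial>M) < \<infinity>"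
  shows "integrable M (\<lambda>x. enn2real (a x))" "(\<integral>x. enn2real (a x) \<partial>M) = enn2real (\<integral>\<^sup>+x. a x \<partial>M)"
proof -
  have "AE x in M. a x \<noteq> \<infinity>"
    using assms by (intro nn_integral_PInf_AE) auto
  then have eq: "(\<integral>\<^sup>+x. ennreal (enn2real (a x)) \<partial>M) = (\<integral>\<^sup>+x. a x \<partial>M)"
    by (intro nn_integral_cong_AE) (auto elim!: eventually_mono simp: less_top)
  show "integrable M (\<lambda>x. enn2real (a x))"
    using assms(2) by (intro integrableI_nonneg) (auto simp: eq)
  show "(\<integral>x. enn2real (a x) \<partial>M) = enn2real (\<integral>\<^sup>+x. a x \<partial>M)"
    by (subst integral_eq_nn_integral) (auto simp: eq)
qed

text \<open>Fubini for a kernel. It is reduced to the nonnegative case by splitting f into positive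
  and negative parts inside both integrals.\<close>

lemma integral_bind_kernel:
  fixes f :: "'b::euclidean_space \<Rightarrow> real"
  assumes \<kappa>: "\<kappa> \<in> measurable \<mu> (prob_algebra borel)"
    and f: "integrable (bind \<mu> \<kappa>) f" and fm[measurable]: "f \<in> borel_measurable borel"
  shows "AE x in \<mu>. integrable (\<kappa> x) f" "integrable \<mu> (\<lambda>x. \<integral>y. f y \<partial>\<kappa> x)"
    "(\<integral>y. f y \<partial>(bind \<mu> \<kappa>)) = (\<integral>x. \<integral>y. f y \<partial>\<kappa> x \<partial>\<mu>)"
proof -
  note [measurable] = measurable_prob_algebraD[OF \<kappa>]
  have s: "sets (\<kappa> x) = sets borel" if "x \<in> space \<mu>" for x
    using measurable_space[OF \<kappa> that] by (simp add: space_prob_algebra)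
  have [measurable]: "f \<in> borel_measurable (\<kappa> x)" if "x \<in> space \<mu>" for x
    using fm measurable_cong_sets[OF s[OF that] refl] by blast
  have bind: "(\<integral>\<^sup>+y. g y \<partial>(bind \<mu> \<kappa>)) = (\<integral>\<^sup>+x. \<integral>\<^sup>+y. g y \<partial>\<kappa> x \<partial>\<mu>)" if "g \<in> borel_measurable borel" for g
    by (rule nn_integral_bind[OF that]) simp
  have m: "(\<lambda>x. \<integral>\<^sup>+y. g y \<partial>\<kappa> x) \<in> borel_measurable \<mu>" if [measurable]: "g \<in> borel_measurable borel" for g
    by simp
  have fin: "(\<integral>\<^sup>+x. \<integral>\<^sup>+y. ennreal (norm (f y)) \<partial>\<kappa> x \<partial>\<mu>) < \<infinity>"
    using f by (subst bind[symmetric]) (auto simp: integrable_iff_bounded)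
  then have "AE x in \<mu>. (\<integral>\<^sup>+y. ennreal (norm (f y)) \<partial>\<kappa> x) \<noteq> \<infinity>"
    by (intro nn_integral_PInf_AE m) auto
  then show ae: "AE x in \<mu>. integrable (\<kappa> x) f"
    by (rule AE_mp) (auto intro!: AE_I2 simp: integrable_iff_bounded less_top)
  have le: "(\<integral>\<^sup>+x. \<integral>\<^sup>+y. ennreal (g y) \<partial>\<kappa> x \<partial>\<mu>) < \<infinity>" if "\<And>y. g y \<le> norm (f y)" for g
    by (rule le_less_trans[OF _ fin]) (intro nn_integral_mono ennreal_leI that)
  note pos = nn_integral_finite_imp_enn2real[OF m[of "\<lambda>y. ennreal (f y)"] le]
  note neg = nn_integral_finite_imp_enn2real[OF m[of "\<lambda>y. ennreal (- f y)"] le]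
  have eq: "AE x in \<mu>. (\<integral>y. f y \<partial>\<kappa> x) =
      enn2real (\<integral>\<^sup>+y. ennreal (f y) \<partial>\<kappa> x) - enn2real (\<integral>\<^sup>+y. ennreal (- f y) \<partial>\<kappa> x)"
    using ae by eventually_elim (rule real_lebesgue_integral_def)
  have meas: "(\<lambda>x. \<integral>y. f y \<partial>\<kappa> x) \<in> borel_measurable \<mu>" by simp
  have "integrable \<mu> (\<lambda>x. enn2real (\<integral>\<^sup>+y. ennreal (f y) \<partial>\<kappa> x) - enn2real (\<integral>\<^sup>+y. ennreal (- f y) \<partial>\<kappa> x))"
    using pos(1) neg(1) by auto
  then show "integrable \<mu> (\<lambda>x. \<integral>y. f y \<partial>\<kappa> x)"
    by (rule integrable_cong_AE_imp[OF _ meas]) (use eq in \<open>auto elim!: eventually_mono\<close>)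
  have "(\<integral>x. \<integral>y. f y \<partial>\<kappa> x \<partial>\<mu>) =
      (\<integral>x. enn2real (\<integral>\<^sup>+y. ennreal (f y) \<partial>\<kappa> x) - enn2real (\<integral>\<^sup>+y. ennreal (- f y) \<partial>\<kappa> x) \<partial>\<mu>)"
    using eq by (intro integral_cong_AE) auto
  also have "\<dots> = enn2real (\<integral>\<^sup>+y. ennreal (f y) \<partial>(bind \<mu> \<kappa>)) - enn2real (\<integral>\<^sup>+y. ennreal (- f y) \<partial>(bind \<mu> \<kappa>))"
    using pos neg by (simp add: bind)
  also have "\<dots> = (\<integral>y. f y \<partial>(bind \<mu> \<kappa>))"
    using real_lebesgue_integral_def[OF f] by simp
  finally show "(\<integral>y. f y \<partial>(bind \<mu> \<kappa>)) = (\<integral>x. \<integral>y. f y \<partial>\<kappa> x \<partial>\<mu>)" by simp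
qed

lemma eint_mono_AE:
  assumes "AE x in M. f x \<le> g x"
  shows "eint M f \<le> eint M g"
  unfolding eint_def
  by (intro ereal_minus_mono nn_integral_mono_AE iffD1[OF less_eq_ennreal.rep_eq])
    (use assms in \<open>auto elim!: eventually_mono intro!: e2ennreal_mono\<close>)

lemma eint_eq_integral:
  assumes "integrable M f" "AE x in M. g x = ereal (f x)"
  shows "eint M g = ereal (\<integral>x. f x \<partial>M)"
proof -
  have "(\<integral>\<^sup>+x. e2ennreal (g x) \<partial>M) = (\<integral>\<^sup>+x. ennreal (f x) \<partial>M)"
    "(\<integral>\<^sup>+x. e2ennreal (- g x) \<partial>M) = (\<integral>\<^sup>+x. ennreal (- f x) \<partial>M)"
    using assms(2) by (auto intro!: nn_integral_cong_AE elim!: eventually_mono)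
  moreover have "(\<integral>\<^sup>+x. ennreal (f x) \<partial>M) \<noteq> \<infinity>" "(\<integral>\<^sup>+x. ennreal (- f x) \<partial>M) \<noteq> \<infinity>"
    using assms(1) by (auto simp: real_integrable_def)
  ultimately show ?thesis
    unfolding eint_def real_lebesgue_integral_def[OF assms(1)]
    by (cases "\<integral>\<^sup>+x. ennreal (f x) \<partial>M"; cases "\<integral>\<^sup>+x. ennreal (- f x) \<partial>M") (auto simp: enn2ereal_ennreal)
qed

text \<open>A supremum of continuous functions is lower semicontinuous; an infinite value of \<psi>
  contributes an empty or full superlevel set.\<close>

lemma borel_measurable_conj: "conj \<psi> \<in> borel_measurable borel"
proof (rule borel_measurable_ereal_iff_Ioi[THEN iffD2], intro allI)
  fix a :: ereal
  have "conj \<psi> -` {a <..} = (\<Union>y. {x. a < ereal (x \<bullet> y) - \<psi> y})"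
    by (auto simp: conj_def less_SUP_iff)
  moreover have "open {x. a < ereal (x \<bullet> y) - \<psi> y}" for y
  proof (cases "\<psi> y")
    case (real r)
    have "continuous_on UNIV (\<lambda>x. ereal (x \<bullet> y - r))" by (intro continuous_intros)
    from open_Collect_less[OF continuous_on_const this, of a] show ?thesis by (simp add: real)
  qed auto
  ultimately show "conj \<psi> -` {a <..} \<inter> space borel \<in> sets borel"
    by (auto intro!: borel_open open_UN)
qed

lemma integrable_of_square:
  fixes M :: "'a::euclidean_space measure"
  assumes "prob_space M" "sets M = sets borel" "integrable M (\<lambda>x. (norm x)\<^sup>2)"
  shows "integrable M (\<lambda>x. x)"
proof -
  interpret prob_space M by fact
  have [measurable_cong]: "sets M = sets borel" by fact
  show ?thesis
  proof (rule Bochner_Integration.integrable_bound[of _ "\<lambda>x. 1 + (norm x)\<^sup>2"])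
    show "AE x in M. norm x \<le> norm (1 + (norm x)\<^sup>2)"
    proof (intro AE_I2)
      fix x :: 'a
      have "2 * norm x \<le> 1 + (norm x)\<^sup>2" using zero_le_power2[of "1 - norm x"] by (simp add: power2_diff)
      then have "norm x \<le> 1 + (norm x)\<^sup>2" using norm_ge_zero[of x] by linarith
      then show "norm x \<le> norm (1 + (norm x)\<^sup>2)" by simp
    qed
  qed (use assms in auto)
qed

lemma abs_inner_le_squares: "\<bar>x \<bullet> y\<bar> \<le> (norm x)\<^sup>2 + (norm y)\<^sup>2" for x y :: "'a::real_inner"
proof -
  have "\<bar>x \<bullet> y\<bar> \<le> norm x * norm y" by (rule Cauchy_Schwarz_ineq2)
  moreover have "2 * (norm x * norm y) \<le> (norm x)\<^sup>2 + (norm y)\<^sup>2"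
    using zero_le_power2[of "norm x - norm y"] by (simp add: power2_diff)
  moreover have "0 \<le> norm x * norm y" by simp
  ultimately show ?thesis by linarith
qed

section \<open>Couplings of laws with finite second moments\<close>

lemma prod_in_Cpl:
  fixes \<rho> q :: "'a::euclidean_space measure"
  assumes "prob_space \<rho>" "sets \<rho> = sets borel" "prob_space q" "sets q = sets borel"
  shows "\<rho> \<Otimes>\<^sub>M q \<in> Cpl \<rho> q"
proof -
  interpret \<rho>: prob_space \<rho> by fact
  interpret q: prob_space q by fact
  interpret pair_prob_space \<rho> q ..
  note [measurable_cong] = assms(2,4)
  have sp: "space \<rho> = UNIV" "space q = UNIV"
    using sets_eq_imp_space_eq[OF assms(2)] sets_eq_imp_space_eq[OF assms(4)] by auto
  have "sets (\<rho> \<Otimes>\<^sub>M q) = sets borel"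
    unfolding borel_prod[symmetric] by (rule sets_pair_measure_cong[OF assms(2,4)])
  moreover have "distr (\<rho> \<Otimes>\<^sub>M q) borel fst = \<rho>"
  proof (rule measure_eqI)
    fix A assume "A \<in> sets (distr (\<rho> \<Otimes>\<^sub>M q) borel fst)"
    then have A: "A \<in> sets \<rho>" using assms by simp
    have "fst -` A \<inter> space (\<rho> \<Otimes>\<^sub>M q) = A \<times> space q" by (auto simp: space_pair_measure sp)
    then show "emeasure (distr (\<rho> \<Otimes>\<^sub>M q) borel fst) A = emeasure \<rho> A"
      using A assms by (subst emeasure_distr) (auto simp: q.emeasure_pair_measure_Times q.emeasure_space_1)
  qed (simp add: assms)
  moreover have "distr (\<rho> \<Otimes>\<^sub>M q) borel snd = q"
  proof (rule measure_eqI)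
    fix A assume "A \<in> sets (distr (\<rho> \<Otimes>\<^sub>M q) borel snd)"
    then have A: "A \<in> sets q" using assms by simp
    have "snd -` A \<inter> space (\<rho> \<Otimes>\<^sub>M q) = space \<rho> \<times> A" by (auto simp: space_pair_measure sp)
    then show "emeasure (distr (\<rho> \<Otimes>\<^sub>M q) borel snd) A = emeasure q A"
      using A assms by (subst emeasure_distr) (auto simp: q.emeasure_pair_measure_Times \<rho>.emeasure_space_1)
  qed (simp add: assms)
  ultimately show ?thesis by (simp add: Cpl_def)
qed

lemma
  fixes \<rho> q :: "'a::euclidean_space measure"
  assumes \<gamma>: "\<gamma> \<in> Cpl \<rho> q" and \<rho>: "P2 \<rho>" and q: "P2 q"
  shows Cpl_prob_space: "prob_space \<gamma>"
    and Cpl_integrable: "integrable \<gamma> (\<lambda>p. fst p \<bullet> snd p)"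
    and Cpl_integral_bound: "\<bar>\<integral>p. fst p \<bullet> snd p \<partial>\<gamma>\<bar> \<le> (\<integral>y. (norm y)\<^sup>2 \<partial>\<rho>) + (\<integral>z. (norm z)\<^sup>2 \<partial>q)"
proof -
  have s[measurable_cong]: "sets \<gamma> = sets borel" and d: "distr \<gamma> borel fst = \<rho>" "distr \<gamma> borel snd = q"
    using \<gamma> by (auto simp: Cpl_def)
  show p: "prob_space \<gamma>"
  proof
    have "emeasure \<rho> (space \<rho>) = 1" using \<rho> by (simp add: P2_def prob_space.emeasure_space_1)
    then show "emeasure \<gamma> (space \<gamma>) = 1"
      unfolding d(1)[symmetric] by (subst (asm) emeasure_distr) auto
  qed
  have i: "integrable \<gamma> (\<lambda>p. (norm (fst p))\<^sup>2)" "integrable \<gamma> (\<lambda>p. (norm (snd p))\<^sup>2)"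
    using \<rho> q unfolding P2_def d[symmetric] by (auto simp: integrable_distr_eq)
  have e: "(\<integral>p. (norm (fst p))\<^sup>2 \<partial>\<gamma>) = (\<integral>y. (norm y)\<^sup>2 \<partial>\<rho>)" "(\<integral>p. (norm (snd p))\<^sup>2 \<partial>\<gamma>) = (\<integral>z. (norm z)\<^sup>2 \<partial>q)"
    unfolding d[symmetric] by (auto simp: integral_distr)
  show int: "integrable \<gamma> (\<lambda>p. fst p \<bullet> snd p)"
    by (rule Bochner_Integration.integrable_bound[OF Bochner_Integration.integrable_add[OF i]])
      (auto intro!: AE_I2 abs_inner_le_squares)
  have "\<bar>\<integral>p. fst p \<bullet> snd p \<partial>\<gamma>\<bar> \<le> (\<integral>p. \<bar>fst p \<bullet> snd p\<bar> \<partial>\<gamma>)" by (rule integral_abs_bound)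
  also have "\<dots> \<le> (\<integral>p. (norm (fst p))\<^sup>2 + (norm (snd p))\<^sup>2 \<partial>\<gamma>)"
    using int i by (intro integral_mono abs_inner_le_squares) auto
  finally show "\<bar>\<integral>p. fst p \<bullet> snd p \<partial>\<gamma>\<bar> \<le> (\<integral>y. (norm y)\<^sup>2 \<partial>\<rho>) + (\<integral>z. (norm z)\<^sup>2 \<partial>q)"
    using i e by simp
qed

text \<open>The Fenchel-Young inequality between y and w + z is integrated over the coupling. The
  barycentre of \<rho> appears as the coefficient of w, and the supremum over w gives the outer
  conjugate.\<close>

lemma conj_conv_meas_le:
  fixes \<rho> q :: "'a::euclidean_space measure"
  assumes \<gamma>: "\<gamma> \<in> Cpl \<rho> q" and \<rho>: "P2 \<rho>" and q: "P2 q"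
    and fin: "AE y in \<rho>. \<bar>\<psi> y\<bar> \<noteq> \<infinity>" and int: "integrable \<rho> (\<lambda>y. real_of_ereal (\<psi> y))"
  shows "conj (conv_meas (conj \<psi>) q) (\<integral>y. y \<partial>\<rho>) \<le>
    ereal ((\<integral>y. real_of_ereal (\<psi> y) \<partial>\<rho>) - (\<integral>p. fst p \<bullet> snd p \<partial>\<gamma>))"
  unfolding conj_def[of "conv_meas _ _"]
proof (rule SUP_least)
  fix w :: 'a
  interpret \<gamma>: prob_space \<gamma> by (rule Cpl_prob_space[OF \<gamma> \<rho> q])
  have s[measurable_cong]: "sets \<gamma> = sets borel" and d: "distr \<gamma> borel fst = \<rho>" "distr \<gamma> borel snd = q"
    using \<gamma> by (auto simp: Cpl_def)
  have sets: "sets \<rho> = sets borel" "sets q = sets borel" using \<rho> q by (auto simp: P2_def)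
  note cm[measurable] = borel_measurable_conj[of \<psi>]
  have m: "(\<lambda>y. real_of_ereal (\<psi> y)) \<in> borel_measurable borel"
    using borel_measurable_integrable[OF int] measurable_cong_sets[OF sets(1) refl] by blast
  have id: "integrable \<rho> (\<lambda>y. y)" using \<rho> by (auto simp: P2_def intro!: integrable_of_square)
  have i1: "integrable \<gamma> (\<lambda>p. fst p)"
    using id unfolding d(1)[symmetric] by (subst (asm) integrable_distr_eq) auto
  have i2: "integrable \<gamma> (\<lambda>p. real_of_ereal (\<psi> (fst p)))"
    using int unfolding d(1)[symmetric] by (subst (asm) integrable_distr_eq) (auto simp: m)
  have i3: "integrable \<gamma> (\<lambda>p. fst p \<bullet> snd p)" by (rule Cpl_integrable[OF \<gamma> \<rho> q])
  have e1: "(\<integral>p. fst p \<partial>\<gamma>) = (\<integral>y. y \<partial>\<rho>)" unfolding d(1)[symmetric] by (subst integral_distr) auto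
  have e2: "(\<integral>p. real_of_ereal (\<psi> (fst p)) \<partial>\<gamma>) = (\<integral>y. real_of_ereal (\<psi> y) \<partial>\<rho>)"
    unfolding d(1)[symmetric] by (subst integral_distr) (auto simp: m)
  have q_eq: "conv_meas (conj \<psi>) q w = eint \<gamma> (\<lambda>p. conj \<psi> (w + snd p))"
    unfolding conv_meas_def eint_def d(2)[symmetric] by (subst (1 2) nn_integral_distr) auto
  have "AE p in \<gamma>. \<bar>\<psi> (fst p)\<bar> \<noteq> \<infinity>"
    using fin unfolding d(1)[symmetric] by (rule AE_distrD[rotated]) simp
  then have "AE p in \<gamma>. ereal (fst p \<bullet> w + fst p \<bullet> snd p - real_of_ereal (\<psi> (fst p))) \<le> conj \<psi> (w + snd p)"
  proof eventually_elim
    case (elim p)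
    then obtain r where r: "\<psi> (fst p) = ereal r" by auto
    have "ereal ((w + snd p) \<bullet> fst p) - \<psi> (fst p) \<le> conj \<psi> (w + snd p)"
      unfolding conj_def by (rule SUP_upper) simp
    then show ?case by (simp add: r inner_add_left inner_add_right inner_commute)
  qed
  then have "eint \<gamma> (\<lambda>p. ereal (fst p \<bullet> w + fst p \<bullet> snd p - real_of_ereal (\<psi> (fst p)))) \<le> conv_meas (conj \<psi>) q w"
    unfolding q_eq by (rule eint_mono_AE)
  also have "eint \<gamma> (\<lambda>p. ereal (fst p \<bullet> w + fst p \<bullet> snd p - real_of_ereal (\<psi> (fst p)))) =
      ereal ((\<integral>y. y \<partial>\<rho>) \<bullet> w + (\<integral>p. fst p \<bullet> snd p \<partial>\<gamma>) - (\<integral>y. real_of_ereal (\<psi> y) \<partial>\<rho>))"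
    using i1 i2 i3 by (subst eint_eq_integral[of _ "\<lambda>p. fst p \<bullet> w + fst p \<bullet> snd p - real_of_ereal (\<psi> (fst p))"]) (auto simp: e1 e2)
  finally show "ereal ((\<integral>y. y \<partial>\<rho>) \<bullet> w) - conv_meas (conj \<psi>) q w \<le>
      ereal ((\<integral>y. real_of_ereal (\<psi> y) \<partial>\<rho>) - (\<integral>p. fst p \<bullet> snd p \<partial>\<gamma>))"
    by (cases "conv_meas (conj \<psi>) q w") auto
qed

lemma MT_kernel_AE:
  fixes \<mu> \<nu> :: "'a::euclidean_space measure"
  assumes K: "K \<in> MT_kernels \<mu> \<nu>" and \<nu>: "P2 \<nu>"
  shows "AE x in \<mu>. P2 (K x) \<and> (\<integral>y. y \<partial>K x) = x"
    and "integrable \<mu> (\<lambda>x. \<integral>y. (norm y)\<^sup>2 \<partial>K x)"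
proof -
  have Km: "K \<in> measurable \<mu> (prob_algebra borel)" and b: "bind \<mu> K = \<nu>"
    and mean: "AE x in \<mu>. integrable (K x) (\<lambda>y. y) \<and> (\<integral>y. y \<partial>(K x)) = x"
    using K by (auto simp: MT_kernels_def)
  have "integrable (bind \<mu> K) (\<lambda>y. (norm y)\<^sup>2)" using \<nu> by (simp add: b P2_def)
  note ib = integral_bind_kernel[OF Km this]
  show "integrable \<mu> (\<lambda>x. \<integral>y. (norm y)\<^sup>2 \<partial>K x)" by (rule ib(2)) simp
  have "AE x in \<mu>. x \<in> space \<mu>" by (rule AE_space)
  moreover have "AE x in \<mu>. integrable (K x) (\<lambda>y. (norm y)\<^sup>2)" by (rule ib(1)) simp
  ultimately show "AE x in \<mu>. P2 (K x) \<and> (\<integral>y. y \<partial>K x) = x"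
    using mean
  proof eventually_elim
    case (elim x)
    then show ?case using measurable_space[OF Km elim(1)] by (simp add: P2_def space_prob_algebra)
  qed
qed

text \<open>The preceding bound is applied to \<mu>-almost every \<open>K x\<close>, whose
  barycentre is x, and to all of its couplings with q. Most of the work is to exclude indeterminate
  differences of infinite integrals.\<close>

lemma weak_duality:
  fixes \<mu> \<nu> q :: "'a::euclidean_space measure"
  assumes K: "K \<in> MT_kernels \<mu> \<nu>" and \<mu>: "P2 \<mu>" and \<nu>: "P2 \<nu>" and q: "P2 q" and \<psi>: "L1e \<nu> \<psi>"
  shows "primal_obj q \<mu> K \<le> ereal (\<integral>y. real_of_ereal (\<psi> y) \<partial>\<nu>) - eint \<mu> (conj (conv_meas (conj \<psi>) q))"
proof -
  define f where "f = conj (conv_meas (conj \<psi>) q)"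
  have Km: "K \<in> measurable \<mu> (prob_algebra borel)" and b: "bind \<mu> K = \<nu>"
    using K by (auto simp: MT_kernels_def)
  have s\<nu>: "sets \<nu> = sets borel" and s\<mu>[measurable_cong]: "sets \<mu> = sets borel" using \<mu> \<nu> by (auto simp: P2_def)
  interpret \<mu>: prob_space \<mu> using \<mu> by (simp add: P2_def)
  have \<psi>i: "integrable \<nu> (\<lambda>y. real_of_ereal (\<psi> y))" and \<psi>f: "AE y in \<nu>. \<bar>\<psi> y\<bar> \<noteq> \<infinity>"
    using \<psi> by (auto simp: L1e_def)
  have m: "(\<lambda>y. real_of_ereal (\<psi> y)) \<in> borel_measurable borel"
    using borel_measurable_integrable[OF \<psi>i] measurable_cong_sets[OF s\<nu> refl] by blast
  define a where "a x = (\<integral>y. real_of_ereal (\<psi> y) \<partial>K x)" for x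
  note ib = integral_bind_kernel[OF Km, unfolded b, OF \<psi>i m]
  have ai: "integrable \<mu> a" and ae: "(\<integral>x. a x \<partial>\<mu>) = (\<integral>y. real_of_ereal (\<psi> y) \<partial>\<nu>)"
    using ib by (auto simp: a_def[abs_def])
  have fin: "AE x in \<mu>. AE y in K x. \<bar>\<psi> y\<bar> \<noteq> \<infinity>"
  proof -
    obtain N where N: "\<And>y. y \<in> space \<nu> - N \<Longrightarrow> \<bar>\<psi> y\<bar> \<noteq> \<infinity>" "N \<in> null_sets \<nu>"
      using AE_E3[OF \<psi>f] by metis
    have [measurable]: "N \<in> sets borel" using N(2) by (simp add: null_sets_def s\<nu>)
    have "AE y in bind \<mu> K. y \<notin> N" unfolding b using N(2) by (rule AE_not_in)
    then have ae_N: "AE x in \<mu>. AE y in K x. y \<notin> N"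
      using measurable_prob_algebraD[OF Km] by (subst (asm) AE_bind[where B=borel]) auto
    have "space \<nu> = UNIV" using sets_eq_imp_space_eq[OF s\<nu>] by simp
    then have N': "\<bar>\<psi> y\<bar> \<noteq> \<infinity>" if "y \<notin> N" for y using N(1)[of y] that by simp
    from ae_N show ?thesis
    proof eventually_elim
      case (elim x)
      then show ?case by eventually_elim (rule N')
    qed
  qed
  define s where "s x = (\<integral>y. (norm y)\<^sup>2 \<partial>K x) + (\<integral>z. (norm z)\<^sup>2 \<partial>q)" for x
  have si: "integrable \<mu> s" unfolding s_def[abs_def] using MT_kernel_AE(2)[OF K \<nu>] by simp
  have key: "AE x in \<mu>. P2 (K x) \<and> (\<forall>\<gamma>\<in>Cpl (K x) q. f x \<le> ereal (a x - (\<integral>p. fst p \<bullet> snd p \<partial>\<gamma>)))"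
    using MT_kernel_AE(1)[OF K \<nu>] fin ib(1)
  proof eventually_elim
    case (elim x)
    then show ?case using conj_conv_meas_le[OF _ _ q, of _ "K x" \<psi>] by (auto simp: f_def a_def)
  qed
  \<comment> \<open>A single coupling suffices to bound f from above by an integrable function, so
    its positive part has a finite integral; the product coupling is always available.\<close>
  have up: "AE x in \<mu>. f x \<le> ereal (a x + s x)"
    using key
  proof eventually_elim
    case (elim x)
    have "K x \<Otimes>\<^sub>M q \<in> Cpl (K x) q" using elim q by (intro prod_in_Cpl) (auto simp: P2_def)
    then have "f x \<le> ereal (a x - (\<integral>p. fst p \<bullet> snd p \<partial>(K x \<Otimes>\<^sub>M q)))"
      and "\<bar>\<integral>p. fst p \<bullet> snd p \<partial>(K x \<Otimes>\<^sub>M q)\<bar> \<le> s x"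
      using elim q Cpl_integral_bound[of _ "K x" q] by (auto simp: s_def)
    then show ?case by (elim order_trans) auto
  qed
  have "AE x in \<mu>. MCov (K x) q \<le> ereal (a x) - f x"
    using key
  proof eventually_elim
    case (elim x)
    show ?case unfolding MCov_def
    proof (rule SUP_least)
      fix \<gamma> assume "\<gamma> \<in> Cpl (K x) q"
      then have "f x \<le> ereal (a x - (\<integral>p. fst p \<bullet> snd p \<partial>\<gamma>))" using elim by blast
      then show "ereal (\<integral>p. fst p \<bullet> snd p \<partial>\<gamma>) \<le> ereal (a x) - f x" by (cases "f x") auto
    qed
  qed
  then have le: "primal_obj q \<mu> K \<le> eint \<mu> (\<lambda>x. ereal (a x) - f x)"
    unfolding primal_obj_def by (rule eint_mono_AE)
  show ?thesis
  \<comment> \<open>If the integral of f is minus infinity, the right-hand side is plus infinity.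
    Otherwise f is almost surely finite and integrable, and real arithmetic applies.\<close>
  proof (cases "eint \<mu> f = - \<infinity>")
    case True
    then show ?thesis by (simp add: f_def)
  next
    case False
    have fm[measurable]: "f \<in> borel_measurable \<mu>"
      unfolding f_def using borel_measurable_conj measurable_cong_sets[OF s\<mu> refl] by blast
    have "(\<integral>\<^sup>+x. e2ennreal (f x) \<partial>\<mu>) \<le> (\<integral>\<^sup>+x. ennreal (a x + s x) \<partial>\<mu>)"
    proof (rule nn_integral_mono_AE)
      show "AE x in \<mu>. e2ennreal (f x) \<le> ennreal (a x + s x)"
        using up by eventually_elim (use e2ennreal_mono in fastforce)
    qed
    also have "\<dots> < \<infinity>"
      using Bochner_Integration.integrable_add[OF ai si] by (simp add: real_integrable_def less_top)
    finally have pos: "(\<integral>\<^sup>+x. e2ennreal (f x) \<partial>\<mu>) \<noteq> \<infinity>" by simp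
    have neg: "(\<integral>\<^sup>+x. e2ennreal (- f x) \<partial>\<mu>) \<noteq> \<infinity>"
    proof
      assume "(\<integral>\<^sup>+x. e2ennreal (- f x) \<partial>\<mu>) = \<infinity>"
      then have "eint \<mu> f = - \<infinity>"
        unfolding eint_def using pos by (cases "\<integral>\<^sup>+x. e2ennreal (f x) \<partial>\<mu>") (auto simp: enn2ereal_ennreal)
      then show False using False by simp
    qed
    have "AE x in \<mu>. e2ennreal (f x) \<noteq> \<infinity>" by (rule nn_integral_PInf_AE[OF _ pos]) simp
    moreover have "AE x in \<mu>. e2ennreal (- f x) \<noteq> \<infinity>" by (rule nn_integral_PInf_AE[OF _ neg]) simp
    ultimately have real: "AE x in \<mu>. f x = ereal (real_of_ereal (f x))"
    proof eventually_elim
      case (elim x)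
      then show ?case by (cases "f x") auto
    qed
    have "(\<integral>\<^sup>+x. ennreal (real_of_ereal (f x)) \<partial>\<mu>) = (\<integral>\<^sup>+x. e2ennreal (f x) \<partial>\<mu>)"
      "(\<integral>\<^sup>+x. ennreal (- real_of_ereal (f x)) \<partial>\<mu>) = (\<integral>\<^sup>+x. e2ennreal (- f x) \<partial>\<mu>)"
    proof -
      have "AE x in \<mu>. ennreal (real_of_ereal (f x)) = e2ennreal (f x) \<and> ennreal (- real_of_ereal (f x)) = e2ennreal (- f x)"
        using real
      proof eventually_elim
        case (elim x)
        then obtain r where "f x = ereal r" by metis
        then show ?case by simp
      qed
      then show "(\<integral>\<^sup>+x. ennreal (real_of_ereal (f x)) \<partial>\<mu>) = (\<integral>\<^sup>+x. e2ennreal (f x) \<partial>\<mu>)"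
      "(\<integral>\<^sup>+x. ennreal (- real_of_ereal (f x)) \<partial>\<mu>) = (\<integral>\<^sup>+x. e2ennreal (- f x) \<partial>\<mu>)"
        by (auto intro!: nn_integral_cong_AE elim!: eventually_mono)
    qed
    then have ri: "integrable \<mu> (\<lambda>x. real_of_ereal (f x))"
      using pos neg by (simp add: real_integrable_def)
    have "eint \<mu> (\<lambda>x. ereal (a x) - f x) = ereal (\<integral>x. a x - real_of_ereal (f x) \<partial>\<mu>)"
    proof (rule eint_eq_integral)
      show "AE x in \<mu>. ereal (a x) - f x = ereal (a x - real_of_ereal (f x))"
        using real
      proof eventually_elim
        case (elim x)
        then obtain r where "f x = ereal r" by metis
        then show ?case by simp
      qed
    qed (use ai ri in auto)
    also have "\<dots> = ereal (\<integral>y. real_of_ereal (\<psi> y) \<partial>\<nu>) - ereal (\<integral>x. real_of_ereal (f x) \<partial>\<mu>)"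
      using ai ri by (simp add: ae)
    also have "ereal (\<integral>x. real_of_ereal (f x) \<partial>\<mu>) = eint \<mu> f"
      using eint_eq_integral[OF ri real] by simp
    finally show ?thesis using le by (simp add: f_def)
  qed
qed

section \<open>Transport problems with a prescribed law of (x, z)\<close>

text \<open>Growth matched to \<open>P2\<close>: such functions are integrable under every law with
  finite second moment, and their integrals converge once the squared norms are uniformly
  integrable.\<close>

definition subquadratic :: "('e::euclidean_space \<Rightarrow> real) \<Rightarrow> bool" where
  "subquadratic f \<longleftrightarrow> continuous_on UNIV f \<and> (\<exists>C. \<forall>x. \<bar>f x\<bar> \<le> C * (1 + (norm x)\<^sup>2))"

lemma subquadraticI:
  assumes "continuous_on UNIV f" "\<And>x. \<bar>f x\<bar> \<le> C * (1 + (norm x)\<^sup>2)"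
  shows "subquadratic f"
  using assms by (auto simp: subquadratic_def)

lemma subquadratic_continuous: "subquadratic f \<Longrightarrow> continuous_on UNIV f"
  by (simp add: subquadratic_def)

lemma subquadratic_measurable: "subquadratic f \<Longrightarrow> f \<in> borel_measurable borel"
  by (simp add: subquadratic_def borel_measurable_continuous_onI)

lemma subquadratic_add:
  assumes "subquadratic f" "subquadratic g"
  shows "subquadratic (\<lambda>x. f x + g x)"
proof -
  obtain C C' where C: "\<And>x. \<bar>f x\<bar> \<le> C * (1 + (norm x)\<^sup>2)" "\<And>x. \<bar>g x\<bar> \<le> C' * (1 + (norm x)\<^sup>2)"
    using assms by (auto simp: subquadratic_def)
  show ?thesis
  proof (rule subquadraticI)
    show "continuous_on UNIV (\<lambda>x. f x + g x)"
      using assms by (auto simp: subquadratic_def intro!: continuous_intros)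
    show "\<bar>f x + g x\<bar> \<le> (C + C') * (1 + (norm x)\<^sup>2)" for x
      using C(1)[of x] C(2)[of x] by (simp add: distrib_right)
  qed
qed

lemma subquadratic_scale:
  assumes "subquadratic f"
  shows "subquadratic (\<lambda>x. r * f x)"
proof -
  obtain C where C: "\<And>x. \<bar>f x\<bar> \<le> C * (1 + (norm x)\<^sup>2)"
    using assms by (auto simp: subquadratic_def)
  show ?thesis
  proof (rule subquadraticI)
    show "continuous_on UNIV (\<lambda>x. r * f x)"
      using assms by (auto simp: subquadratic_def intro!: continuous_intros)
    show "\<bar>r * f x\<bar> \<le> (\<bar>r\<bar> * C) * (1 + (norm x)\<^sup>2)" for x
      using mult_left_mono[OF C[of x], of "\<bar>r\<bar>"] by (simp add: abs_mult mult.assoc)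
  qed
qed

lemma subquadratic_bounded:
  fixes f :: "'e::euclidean_space \<Rightarrow> real"
  assumes "continuous_on UNIV f" "\<And>x. \<bar>f x\<bar> \<le> C"
  shows "subquadratic f"
proof (rule subquadraticI[OF assms(1)])
  fix x :: 'e
  have "0 \<le> C" using assms(2)[of x] by linarith
  then have "C * 1 \<le> C * (1 + (norm x)\<^sup>2)" by (intro mult_left_mono) auto
  then show "\<bar>f x\<bar> \<le> C * (1 + (norm x)\<^sup>2)" using assms(2)[of x] by linarith
qed

text \<open>Meant for coordinate projections, which do not increase the norm.\<close>

lemma subquadratic_compose:
  assumes "subquadratic f" "continuous_on UNIV g" "\<And>x. norm (g x) \<le> norm x"
  shows "subquadratic (\<lambda>x. f (g x))"
proof -
  obtain C where C: "\<And>x. \<bar>f x\<bar> \<le> C * (1 + (norm x)\<^sup>2)"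
    using assms by (auto simp: subquadratic_def)
  show ?thesis
  proof (rule subquadraticI)
    show "continuous_on UNIV (\<lambda>x. f (g x))"
      using assms by (auto simp: subquadratic_def intro!: continuous_on_compose2[of UNIV f])
    show "\<bar>f (g x)\<bar> \<le> \<bar>C\<bar> * (1 + (norm x)\<^sup>2)" for x
    proof -
      have "\<bar>f (g x)\<bar> \<le> \<bar>C\<bar> * (1 + (norm (g x))\<^sup>2)"
        by (rule order_trans[OF C]) (auto intro!: mult_right_mono)
      also have "\<dots> \<le> \<bar>C\<bar> * (1 + (norm x)\<^sup>2)"
        using assms(3)[of x] by (intro mult_left_mono add_left_mono power_mono) auto
      finally show ?thesis .
    qed
  qed
qed

lemma subquadratic_norm_square: "subquadratic (\<lambda>x. (norm x)\<^sup>2)"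
  by (rule subquadraticI[where C=1]) (auto intro!: continuous_intros)

lemma subquadratic_tail: "0 \<le> R \<Longrightarrow> subquadratic (\<lambda>x. max 0 ((norm x)\<^sup>2 - R))"
  by (rule subquadraticI[where C=1]) (auto intro!: continuous_intros)

lemma subquadratic_integrable:
  assumes "subquadratic f" and M: "finite_measure M" "sets M = sets borel" "integrable M (\<lambda>x. (norm x)\<^sup>2)"
  shows "integrable M f"
proof -
  interpret finite_measure M by fact
  obtain C where C: "\<And>x. \<bar>f x\<bar> \<le> C * (1 + (norm x)\<^sup>2)"
    using assms(1) by (auto simp: subquadratic_def)
  have "f \<in> borel_measurable M"
    using subquadratic_measurable[OF assms(1)] measurable_cong_sets[OF M(2) refl] by blast
  then show ?thesis
    using M(3) by (intro Bochner_Integration.integrable_bound[of _ "\<lambda>x. C * (1 + (norm x)\<^sup>2)" f])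
      (auto intro!: AE_I2 order_trans[OF C])
qed

lemma tail_integral_small:
  assumes M: "prob_space M" "sets M = sets borel" "integrable M (\<lambda>x. (norm x)\<^sup>2)" and "0 < \<epsilon>"
  shows "\<forall>\<^sub>F n in sequentially. (\<integral>x. max 0 ((norm x)\<^sup>2 - real n) \<partial>M) < \<epsilon>"
proof -
  interpret prob_space M by fact
  have [measurable_cong]: "sets M = sets borel" by fact
  have "(\<lambda>n. \<integral>x. max 0 ((norm x)\<^sup>2 - real n) \<partial>M) \<longlonglongrightarrow> (\<integral>x. 0 \<partial>M)"
  proof (rule integral_dominated_convergence[where w="\<lambda>x. (norm x)\<^sup>2"])
    show "AE x in M. (\<lambda>n. max 0 ((norm x)\<^sup>2 - real n)) \<longlonglongrightarrow> 0"
    proof (intro AE_I2 tendsto_eventually)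
      fix x
      have "\<forall>\<^sub>F n in sequentially. (norm x)\<^sup>2 \<le> real n"
        using filterlim_real_sequentially by (simp add: filterlim_at_top)
      then show "\<forall>\<^sub>F n in sequentially. max 0 ((norm x)\<^sup>2 - real n) = 0" by eventually_elim auto
    qed
  qed (use M in auto)
  then show ?thesis using \<open>0 < \<epsilon>\<close> by (intro order_tendstoD) auto
qed

lemma norm_le_norm_Pair: "norm x \<le> norm (x, y)" "norm y \<le> norm (x, y)"
  using norm_fst_le[of x y] norm_snd_le[of y x] by auto

lemma norm_Pair_square: "(norm (x, y))\<^sup>2 = (norm x)\<^sup>2 + (norm y)\<^sup>2"
  by (simp add: norm_Pair)

lemma norm_triple_le:
  "norm (x, y) \<le> norm (x, y, z)" "norm (x, z) \<le> norm (x, y, z)"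
  by (auto simp: norm_Pair intro!: real_sqrt_le_mono)

lemma abs_inner_le_norm_triple:
  "\<bar>fst (snd w) \<bullet> snd (snd w)\<bar> \<le> 1 * (1 + (norm w)\<^sup>2)" for w :: "'a \<times> 'a \<times> 'a::euclidean_space"
proof -
  obtain a b c where w: "w = (a, b, c)" by (cases w)
  show ?thesis
    using abs_inner_le_squares[of b c] zero_le_power2[of "norm a"]
    unfolding w fst_conv snd_conv norm_Pair_square mult_1 by linarith
qed

lemma subquadratic_inner:
  "subquadratic (\<lambda>w :: 'a \<times> 'a \<times> 'a::euclidean_space. fst (snd w) \<bullet> snd (snd w))"
  by (rule subquadraticI[OF _ abs_inner_le_norm_triple]) (intro continuous_intros)

text \<open>Here \<open>U\<close> collects the constraints on the pair \<open>(x, y)\<close>, while the law of \<open>(x, z)\<close> is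
  prescribed to be \<open>R\<close>.\<close>

lemma transport_duality:
  fixes R :: "('a::euclidean_space \<times> 'a) measure" and U :: "(('a \<times> 'a \<Rightarrow> real) \<times> real) set"
  assumes R: "prob_space R" "sets R = sets borel" "integrable R (\<lambda>p. (norm p)\<^sup>2)"
    and U_add: "\<And>u b u' b'. (u, b) \<in> U \<Longrightarrow> (u', b') \<in> U \<Longrightarrow> ((\<lambda>p. u p + u' p), b + b') \<in> U"
    and U_scale: "\<And>u b r. (u, b) \<in> U \<Longrightarrow> ((\<lambda>p. r * u p), r * b) \<in> U"
    and U_sub: "\<And>u b. (u, b) \<in> U \<Longrightarrow> subquadratic u"
    and U_sq: "((\<lambda>p. (norm (snd p))\<^sup>2), b0) \<in> U"
    and U_tail: "\<And>n::nat. ((\<lambda>p. max 0 ((norm (snd p))\<^sup>2 - real n)), tb n) \<in> U" "tb \<longlonglongrightarrow> 0"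
    and D: "\<And>u b \<xi>. (u, b) \<in> U \<Longrightarrow> subquadratic \<xi> \<Longrightarrow>
      (\<And>x y z. y \<bullet> z \<le> u (x, y) + \<xi> (x, z)) \<Longrightarrow> D \<le> b + (\<integral>p. \<xi> p \<partial>R)"
    and S: "countable S" "S \<subseteq> U"
  obtains P :: "('a \<times> 'a \<times> 'a) measure" where "prob_space P" "sets P = sets borel"
    "integrable P (\<lambda>w. (norm w)\<^sup>2)" "distr P borel (\<lambda>(x, y, z). (x, z)) = R"
    "\<And>u b. (u, b) \<in> S \<Longrightarrow> (\<integral>(x, y, z). u (x, y) \<partial>P) = b" "D \<le> (\<integral>(x, y, z). y \<bullet> z \<partial>P)"
proof -
  interpret R: prob_space R by fact
  have Ri: "integrable R \<xi>" if "subquadratic \<xi>" for \<xi>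
    by (rule subquadratic_integrable[OF that R.finite_measure_axioms R(2,3)])
  define G where "G u \<xi> = (\<lambda>(x, y, z). u (x, y) + \<xi> (x, z))" for u \<xi> :: "'a \<times> 'a \<Rightarrow> real"
  \<comment> \<open>Both kinds of constraints enter through one linear space, in which a member is
    the sum of a function of (x, y) and a function of (x, z) and its prescribed value is the sum of
    theirs.\<close>
  define L where "L = {(G u \<xi>, b + (\<integral>p. \<xi> p \<partial>R)) | u b \<xi>. (u, b) \<in> U \<and> subquadratic \<xi>}"
  have LI: "(g, c) \<in> L" if "(u, b) \<in> U" "subquadratic \<xi>" "g = G u \<xi>" "c = b + (\<integral>p. \<xi> p \<partial>R)" for g c u b \<xi>
    using that by (auto simp: L_def)
  have LE: "\<exists>u b \<xi>. (u, b) \<in> U \<and> subquadratic \<xi> \<and> g = G u \<xi> \<and> c = b + (\<integral>p. \<xi> p \<partial>R)" if "(g, c) \<in> L" for g c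
    using that by (auto simp: L_def)
  have U0: "((\<lambda>_. 0), 0) \<in> U" using U_scale[OF U_sq, of 0] by simp
  have sq0: "subquadratic (\<lambda>_. 0)" "subquadratic (\<lambda>_. 1)"
    by (auto intro!: subquadratic_bounded[where C=1] continuous_intros)
  have sub_xy: "subquadratic (\<lambda>w. u (fst w, fst (snd w)))" if "subquadratic u" for u :: "'a \<times> 'a \<Rightarrow> real"
    using norm_triple_le(1) by (intro subquadratic_compose[OF that] continuous_intros) (auto simp: split_paired_all)
  have sub_xz: "subquadratic (\<lambda>w. \<xi> (fst w, snd (snd w)))" if "subquadratic \<xi>" for \<xi> :: "'a \<times> 'a \<Rightarrow> real"
    using norm_triple_le(2) by (intro subquadratic_compose[OF that] continuous_intros) (auto simp: split_paired_all)
  have Gsub: "subquadratic (G u \<xi>)" if "subquadratic u" "subquadratic \<xi>" for u \<xi>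
    using subquadratic_add[OF sub_xy[OF that(1)] sub_xz[OF that(2)]] by (simp add: G_def case_prod_unfold)
  have Lsub: "subquadratic g" if "(g, b) \<in> L" for g b
    using LE[OF that] Gsub U_sub by blast
  obtain f :: "nat \<Rightarrow> 'a \<times> 'a \<Rightarrow> real" where f: "\<And>n. continuous_on UNIV (f n)"
    "\<And>n x. 0 \<le> f n x" "\<And>n x. f n x \<le> 1" and f_sep: "separates_measures f"
    by (rule separating_family_of_continuous_functions) (rule that)
  have fsub: "subquadratic (f n)" for n
    using f by (intro subquadratic_bounded[where C=1]) (auto simp: abs_le_iff intro: order_trans[of _ 0])
  \<comment> \<open>Only countably many constraints can be imposed exactly: those of S, and a
    separating family in (x, z) that forces the law R.\<close>
  define S' where "S' = (\<lambda>(u, b). (G u (\<lambda>_. 0), b)) ` S \<union> range (\<lambda>n. (G (\<lambda>_. 0) (f n), \<integral>p. f n p \<partial>R))"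
  have S': "countable S'" "S' \<subseteq> L"
  proof -
    show "countable S'" using S by (simp add: S'_def)
    have "(G u (\<lambda>_. 0), b) \<in> L" if "(u, b) \<in> S" for u b
      using S(2) that by (intro LI[OF _ sq0(1), of u b]) auto
    moreover have "(G (\<lambda>_. 0) (f n), \<integral>p. f n p \<partial>R) \<in> L" for n
      by (rule LI[OF U0 fsub]) auto
    ultimately show "S' \<subseteq> L" by (auto simp: S'_def)
  qed
  obtain P :: "('a \<times> 'a \<times> 'a) measure" where P: "prob_space P" "sets P = sets borel" "integrable P (\<lambda>x. (norm x)\<^sup>2)"
    "\<And>g b. (g, b) \<in> S' \<Longrightarrow> (\<integral>x. g x \<partial>P) = b" "D \<le> (\<integral>x. fst (snd x) \<bullet> snd (snd x) \<partial>P)"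
  proof (rule moment_problem_duality[of L "b0 + (\<integral>p. (norm p)\<^sup>2 \<partial>R)" "\<lambda>x. fst (snd x) \<bullet> snd (snd x)" 1 D S'])
    show "((\<lambda>x. g x + g' x), b + b') \<in> L" if a: "(g, b) \<in> L" "(g', b') \<in> L" for g b g' b'
    proof -
      obtain u \<beta> \<xi> u' \<beta>' \<xi>' where *: "(u, \<beta>) \<in> U" "subquadratic \<xi>" "g = G u \<xi>" "b = \<beta> + (\<integral>p. \<xi> p \<partial>R)"
        "(u', \<beta>') \<in> U" "subquadratic \<xi>'" "g' = G u' \<xi>'" "b' = \<beta>' + (\<integral>p. \<xi>' p \<partial>R)"
        using LE[OF a(1)] LE[OF a(2)] by blast
      show ?thesis
        by (rule LI[OF U_add[OF *(1,5)] subquadratic_add[OF *(2,6)]])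
          (auto simp: * G_def fun_eq_iff Ri)
    qed
    show "((\<lambda>x. r * g x), r * b) \<in> L" if a: "(g, b) \<in> L" for g b r
    proof -
      obtain u \<beta> \<xi> where *: "(u, \<beta>) \<in> U" "subquadratic \<xi>" "g = G u \<xi>" "b = \<beta> + (\<integral>p. \<xi> p \<partial>R)"
        using LE[OF a] by blast
      show ?thesis
        by (rule LI[OF U_scale[OF *(1)] subquadratic_scale[OF *(2)]])
          (auto simp: * G_def fun_eq_iff Ri distrib_left)
    qed
    show "((\<lambda>_. 1), 1) \<in> L"
      by (rule LI[OF U0 sq0(2)]) (auto simp: G_def fun_eq_iff R.prob_space)
    show "((\<lambda>x. (norm x)\<^sup>2), b0 + (\<integral>p. (norm p)\<^sup>2 \<partial>R)) \<in> L"
      by (rule LI[OF U_sq subquadratic_norm_square]) (auto simp: G_def fun_eq_iff norm_Pair_square)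
    show "continuous_on UNIV g" "\<exists>C. \<forall>x. \<bar>g x\<bar> \<le> C * (1 + (norm x)\<^sup>2)" if "(g, b) \<in> L" for g b
      using Lsub[OF that] unfolding subquadratic_def by blast+
    show "\<exists>r g b. 0 \<le> r \<and> (g, b) \<in> L \<and> (\<forall>x. max 0 ((norm x)\<^sup>2 - r) \<le> g x) \<and> b < \<epsilon>" if "0 < \<epsilon>" for \<epsilon>
    proof -
      have \<epsilon>2: "0 < \<epsilon> / 2" using that by simp
      have "\<forall>\<^sub>F n in sequentially. tb n < \<epsilon> / 2" by (rule order_tendstoD(2)[OF U_tail(2) \<epsilon>2])
      moreover have "\<forall>\<^sub>F n in sequentially. (\<integral>p. max 0 ((norm p)\<^sup>2 - real n) \<partial>R) < \<epsilon> / 2"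
        by (rule tail_integral_small[OF R \<epsilon>2])
      ultimately have "\<forall>\<^sub>F n in sequentially. tb n < \<epsilon> / 2 \<and> (\<integral>p. max 0 ((norm p)\<^sup>2 - real n) \<partial>R) < \<epsilon> / 2"
        by eventually_elim simp
      then obtain n where n: "tb n < \<epsilon> / 2" "(\<integral>p. max 0 ((norm p)\<^sup>2 - real n) \<partial>R) < \<epsilon> / 2"
        using eventually_happens'[OF sequentially_bot] by blast
      have tsub: "subquadratic (\<lambda>p :: 'a \<times> 'a. max 0 ((norm p)\<^sup>2 - real n))" by (rule subquadratic_tail) simp
      \<comment> \<open>The squared norm of a triple is that of y plus that of (x, z), so an excess
        over 2n is covered by the two excesses over n.\<close>
      have A: "\<forall>x. max 0 ((norm x)\<^sup>2 - 2 * real n) \<le> G (\<lambda>p. max 0 ((norm (snd p))\<^sup>2 - real n)) (\<lambda>p. max 0 ((norm p)\<^sup>2 - real n)) x"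
        by (auto simp: G_def norm_Pair_square)
      have B: "(G (\<lambda>p. max 0 ((norm (snd p))\<^sup>2 - real n)) (\<lambda>p. max 0 ((norm p)\<^sup>2 - real n)),
          tb n + (\<integral>p. max 0 ((norm p)\<^sup>2 - real n) \<partial>R)) \<in> L"
        by (rule LI[OF U_tail(1) tsub]) auto
      have lt: "tb n + (\<integral>p. max 0 ((norm p)\<^sup>2 - real n) \<partial>R) < \<epsilon>" using n by linarith
      show ?thesis
        by (rule exI[of _ "2 * real n"], rule exI, rule exI, intro conjI, simp, rule B, rule A, rule lt)
    qed
    show "continuous_on UNIV (\<lambda>x :: 'a \<times> 'a \<times> 'a. fst (snd x) \<bullet> snd (snd x))" by (intro continuous_intros)
    show "\<bar>fst (snd x) \<bullet> snd (snd x)\<bar> \<le> 1 * (1 + (norm x)\<^sup>2)" for x :: "'a \<times> 'a \<times> 'a"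
      by (rule abs_inner_le_norm_triple)
    show "D \<le> b" if a: "(g, b) \<in> L" and ge: "\<And>x. fst (snd x) \<bullet> snd (snd x) \<le> g x" for g b
    proof -
      obtain u \<beta> \<xi> where *: "(u, \<beta>) \<in> U" "subquadratic \<xi>" "g = G u \<xi>" "b = \<beta> + (\<integral>p. \<xi> p \<partial>R)"
        using LE[OF a] by blast
      have "y \<bullet> z \<le> u (x, y) + \<xi> (x, z)" for x y z
        using ge[of "(x, y, z)"] by (simp add: *(3) G_def)
      then show ?thesis unfolding *(4) by (rule D[OF *(1,2)])
    qed
  qed (use S' in blast)+
  interpret P: prob_space P by fact
  have [measurable_cong]: "sets P = sets borel" by fact
  have projm: "(\<lambda>(x, y, z). (x, z)) \<in> borel_measurable (borel :: ('a \<times> 'a \<times> 'a) measure)"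
    by (intro borel_measurable_continuous_onI) (auto simp: case_prod_unfold intro!: continuous_intros)
  then have projP: "(\<lambda>(x, y, z). (x, z)) \<in> borel_measurable P"
    using measurable_cong_sets[OF P(2) refl] by blast
  show thesis
  proof (rule that[OF P(1-3)])
    show "distr P borel (\<lambda>(x, y, z). (x, z)) = R"
    proof (rule f_sep[unfolded separates_measures_def, rule_format])
      show "finite_measure (distr P borel (\<lambda>(x, y, z). (x, z)))"
        using P.prob_space_distr[OF projP] by (simp add: prob_space_def)
      show "finite_measure R" by unfold_locales
      show "(\<integral>p. f n p \<partial>distr P borel (\<lambda>(x, y, z). (x, z))) = (\<integral>p. f n p \<partial>R)" for n
      proof -
        have [measurable]: "f n \<in> borel_measurable borel" using f(1) by (rule borel_measurable_continuous_onI)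
        have "(\<integral>p. f n p \<partial>distr P borel (\<lambda>(x, y, z). (x, z))) = (\<integral>w. G (\<lambda>_. 0) (f n) w \<partial>P)"
          using projP by (subst integral_distr) (auto simp: G_def case_prod_unfold)
        also have "\<dots> = (\<integral>p. f n p \<partial>R)" by (rule P(4)) (auto simp: S'_def)
        finally show "(\<integral>p. f n p \<partial>distr P borel (\<lambda>(x, y, z). (x, z))) = (\<integral>p. f n p \<partial>R)" .
      qed
    qed (use R in auto)
    show "(\<integral>(x, y, z). u (x, y) \<partial>P) = b" if "(u, b) \<in> S" for u b
    proof -
      have "(\<integral>w. G u (\<lambda>_. 0) w \<partial>P) = b" using that by (intro P(4)) (force simp: S'_def)
      then show ?thesis by (simp add: G_def)
    qed
    show "D \<le> (\<integral>(x, y, z). y \<bullet> z \<partial>P)" using P(5) by (simp add: case_prod_unfold)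
  qed
qed

section \<open>Dual potentials\<close>

lemma Cpl_second_moment:
  fixes \<rho> q :: "'a::euclidean_space measure"
  assumes \<gamma>: "\<gamma> \<in> Cpl \<rho> q" and \<rho>: "P2 \<rho>" and q: "P2 q"
  shows "integrable \<gamma> (\<lambda>p. (norm p)\<^sup>2)"
proof -
  have s: "sets \<gamma> = sets borel" and d: "distr \<gamma> borel fst = \<rho>" "distr \<gamma> borel snd = q"
    using \<gamma> by (auto simp: Cpl_def)
  have m: "fst \<in> borel_measurable \<gamma>" "snd \<in> borel_measurable \<gamma>"
    using borel_measurable_fst_snd measurable_cong_sets[OF s refl] by blast+
  have "integrable (distr \<gamma> borel fst) (\<lambda>x. (norm x)\<^sup>2)" "integrable (distr \<gamma> borel snd) (\<lambda>x. (norm x)\<^sup>2)"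
    using \<rho> q by (auto simp: d P2_def)
  then have "integrable \<gamma> (\<lambda>p. (norm (fst p))\<^sup>2)" "integrable \<gamma> (\<lambda>p. (norm (snd p))\<^sup>2)"
    by (auto simp: integrable_distr_eq m)
  then have "integrable \<gamma> (\<lambda>p. (norm (fst p))\<^sup>2 + (norm (snd p))\<^sup>2)" by simp
  then show ?thesis
    by (simp add: norm_Pair_square[of "fst _" "snd _", simplified, symmetric])
qed

lemma
  fixes \<mu> q :: "'a::euclidean_space measure"
  assumes \<mu>: "P2 \<mu>" and q: "P2 q"
  shows pair_prob_space_P2: "prob_space (\<mu> \<Otimes>\<^sub>M q)" and sets_pair_P2: "sets (\<mu> \<Otimes>\<^sub>M q) = sets borel"
    and pair_second_moment: "integrable (\<mu> \<Otimes>\<^sub>M q) (\<lambda>p. (norm p)\<^sup>2)"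
proof -
  have C: "\<mu> \<Otimes>\<^sub>M q \<in> Cpl \<mu> q" using \<mu> q by (intro prod_in_Cpl) (auto simp: P2_def)
  show "prob_space (\<mu> \<Otimes>\<^sub>M q)" by (rule Cpl_prob_space[OF C \<mu> q])
  show "sets (\<mu> \<Otimes>\<^sub>M q) = sets borel" using C by (simp add: Cpl_def)
  show "integrable (\<mu> \<Otimes>\<^sub>M q) (\<lambda>p. (norm p)\<^sup>2)" by (rule Cpl_second_moment[OF C \<mu> q])
qed

lemma subquadratic_section:
  assumes "subquadratic \<xi>"
  shows "subquadratic (\<lambda>z. \<xi> (x, z))"
proof -
  obtain C where C: "\<And>p. \<bar>\<xi> p\<bar> \<le> C * (1 + (norm p)\<^sup>2)" and c: "continuous_on UNIV \<xi>"
    using assms by (auto simp: subquadratic_def)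
  show ?thesis
  proof (rule subquadraticI)
    show "continuous_on UNIV (\<lambda>z. \<xi> (x, z))"
      by (rule continuous_on_compose2[OF c]) (auto intro!: continuous_intros)
    show "\<bar>\<xi> (x, z)\<bar> \<le> (\<bar>C\<bar> * (1 + (norm x)\<^sup>2)) * (1 + (norm z)\<^sup>2)" for z
    proof -
      have "\<bar>\<xi> (x, z)\<bar> \<le> \<bar>C\<bar> * (1 + ((norm x)\<^sup>2 + (norm z)\<^sup>2))"
        using C[of "(x, z)"] by (rule order_trans) (auto simp: norm_Pair_square intro!: mult_right_mono)
      also have "\<dots> \<le> \<bar>C\<bar> * ((1 + (norm x)\<^sup>2) * (1 + (norm z)\<^sup>2))"
        by (intro mult_left_mono) (auto simp: algebra_simps)
      finally show ?thesis by (simp add: mult.assoc)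
    qed
  qed
qed

lemma P2_subquadratic_integrable: "P2 M \<Longrightarrow> subquadratic f \<Longrightarrow> integrable M f"
  by (auto simp: P2_def prob_space_def intro!: subquadratic_integrable)

lemma
  fixes \<mu> q :: "'a::euclidean_space measure"
  assumes \<mu>: "P2 \<mu>" and q: "P2 q" and \<xi>: "subquadratic \<xi>"
  shows integrable_section_integral: "integrable \<mu> (\<lambda>x. \<integral>z. \<xi> (x, z) \<partial>q)"
    and integral_section_integral: "(\<integral>x. \<integral>z. \<xi> (x, z) \<partial>q \<partial>\<mu>) = (\<integral>p. \<xi> p \<partial>(\<mu> \<Otimes>\<^sub>M q))"
proof -
  interpret \<mu>: prob_space \<mu> using \<mu> by (simp add: P2_def)
  interpret q: prob_space q using q by (simp add: P2_def)
  interpret pair_sigma_finite \<mu> q ..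
  interpret R: prob_space "\<mu> \<Otimes>\<^sub>M q" by (rule pair_prob_space_P2[OF \<mu> q])
  have i: "integrable (\<mu> \<Otimes>\<^sub>M q) \<xi>"
    by (rule subquadratic_integrable[OF \<xi> R.finite_measure_axioms sets_pair_P2[OF \<mu> q] pair_second_moment[OF \<mu> q]])
  show "integrable \<mu> (\<lambda>x. \<integral>z. \<xi> (x, z) \<partial>q)" by (rule integrable_fst'[OF i])
  show "(\<integral>x. \<integral>z. \<xi> (x, z) \<partial>q \<partial>\<mu>) = (\<integral>p. \<xi> p \<partial>(\<mu> \<Otimes>\<^sub>M q))" by (rule integral_fst'[OF i])
qed

text \<open>Each bracket is affine in y, and \<open>dom\<close> says precisely that it lies below
  \<phi>. Replacing \<phi> by the supremum of the brackets keeps the inequality, makes the potential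
  convex and can only lower its integral.\<close>

lemma dual_potential:
  fixes \<phi> :: "'a::euclidean_space \<Rightarrow> real" and \<xi> :: "'a \<times> 'a \<Rightarrow> real" and h :: "'a \<Rightarrow> 'a"
  assumes dom: "\<And>x y z. y \<bullet> z \<le> \<phi> y + h x \<bullet> (y - x) + \<xi> (x, z)"
  obtains \<psi> :: "'a \<Rightarrow> real" where "convex_on UNIV \<psi>" "\<And>y. \<psi> y \<le> \<phi> y"
    "\<And>x y z. y \<bullet> (z - h x) + h x \<bullet> x - \<xi> (x, z) \<le> \<psi> y"
proof -
  define l where "l p y = y \<bullet> (snd p - h (fst p)) + h (fst p) \<bullet> fst p - \<xi> p" for p y
  have le: "l p y \<le> \<phi> y" for p y
    using dom[of y "snd p" "fst p"] by (simp add: l_def inner_diff_right inner_commute)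
  define \<psi> where "\<psi> y = (SUP p. l p y)" for y
  have bdd: "bdd_above (range (\<lambda>p. l p y))" for y using le by (auto intro!: bdd_aboveI)
  have up: "l p y \<le> \<psi> y" for p y unfolding \<psi>_def by (rule cSUP_upper[OF UNIV_I bdd])
  show thesis
  proof (rule that)
    show "\<psi> y \<le> \<phi> y" for y unfolding \<psi>_def using le by (intro cSUP_least) auto
    show "y \<bullet> (z - h x) + h x \<bullet> x - \<xi> (x, z) \<le> \<psi> y" for x y z
      using up[of "(x, z)" y] by (simp add: l_def)
    show "convex_on UNIV \<psi>"
    proof (rule convex_onI)
      fix t :: real and x y :: 'a assume t: "0 < t" "t < 1"
      show "\<psi> ((1 - t) *\<^sub>R x + t *\<^sub>R y) \<le> (1 - t) * \<psi> x + t * \<psi> y"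
        unfolding \<psi>_def[of "(1 - t) *\<^sub>R x + t *\<^sub>R y"]
      proof (rule cSUP_least)
        fix p
        have "l p ((1 - t) *\<^sub>R x + t *\<^sub>R y) = (1 - t) * l p x + t * l p y"
          by (simp add: l_def inner_add_left algebra_simps)
        also have "\<dots> \<le> (1 - t) * \<psi> x + t * \<psi> y"
          using t up by (intro add_mono mult_left_mono) auto
        finally show "l p ((1 - t) *\<^sub>R x + t *\<^sub>R y) \<le> (1 - t) * \<psi> x + t * \<psi> y" .
      qed simp
    qed simp
  qed
qed

text \<open>A convex function is continuous, and here it is squeezed between an affine function and
  \<phi>.\<close>

lemma dual_potential_integrable:
  fixes \<nu> :: "'a::euclidean_space measure"
  assumes \<nu>: "P2 \<nu>" and \<phi>: "subquadratic \<phi>" and convex: "convex_on UNIV \<psi>"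
    and up: "\<And>y. \<psi> y \<le> \<phi> y" and low: "\<And>y. y \<bullet> v + r \<le> \<psi> y"
  shows "integrable \<nu> \<psi>"
proof -
  interpret prob_space \<nu> using \<nu> by (simp add: P2_def)
  have s[measurable_cong]: "sets \<nu> = sets borel" using \<nu> by (simp add: P2_def)
  have "continuous_on UNIV \<psi>" by (rule convex_on_continuous[OF open_UNIV convex])
  then have [measurable]: "\<psi> \<in> borel_measurable borel" by (rule borel_measurable_continuous_onI)
  have i: "integrable \<nu> (\<lambda>y. y)" using \<nu> by (auto simp: P2_def intro!: integrable_of_square)
  have "integrable \<nu> (\<lambda>y. \<bar>\<phi> y\<bar> + \<bar>y \<bullet> v + r\<bar>)"
    using P2_subquadratic_integrable[OF \<nu> \<phi>] i by (intro Bochner_Integration.integrable_add integrable_abs integrable_inner_left) auto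
  then show ?thesis
  proof (rule Bochner_Integration.integrable_bound)
    show "AE y in \<nu>. norm (\<psi> y) \<le> norm (\<bar>\<phi> y\<bar> + \<bar>y \<bullet> v + r\<bar>)"
    proof (rule AE_I2)
      fix y show "norm (\<psi> y) \<le> norm (\<bar>\<phi> y\<bar> + \<bar>y \<bullet> v + r\<bar>)" using up[of y] low[of y] by simp
    qed
  qed simp
qed

text \<open>The affine minorants bound the conjugate of \<psi> at z - h x by \<xi> (x, z) - h x
  \<bullet> x. After integration over z, the choice -h x in the outer conjugate cancels h x
  \<bullet> x and leaves minus the q-integral of \<xi> (x, z) as a lower bound.\<close>

lemma dual_value_ge_Dq:
  fixes \<mu> \<nu> q :: "'a::euclidean_space measure"
  assumes \<mu>: "P2 \<mu>" and \<nu>: "P2 \<nu>" and q: "P2 q"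
    and \<phi>: "subquadratic \<phi>" and \<xi>: "subquadratic \<xi>"
    and dom: "\<And>x y z. y \<bullet> z \<le> \<phi> y + h x \<bullet> (y - x) + \<xi> (x, z)"
  shows "Dq q \<mu> \<nu> \<le> ereal ((\<integral>y. \<phi> y \<partial>\<nu>) + (\<integral>p. \<xi> p \<partial>(\<mu> \<Otimes>\<^sub>M q)))"
proof -
  obtain \<psi> where \<psi>: "convex_on UNIV \<psi>" "\<And>y. \<psi> y \<le> \<phi> y"
    "\<And>x y z. y \<bullet> (z - h x) + h x \<bullet> x - \<xi> (x, z) \<le> \<psi> y"
    using dual_potential[of \<phi> h \<xi>] dom by blast
  interpret q: prob_space q using q by (simp add: P2_def)
  have \<psi>i: "integrable \<nu> \<psi>"
    by (rule dual_potential_integrable[OF \<nu> \<phi> \<psi>(1,2), of "0 - h 0" "h 0 \<bullet> 0 - \<xi> (0, 0)"])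
      (use \<psi>(3)[where x=0 and z=0] in simp)
  define \<Psi> where "\<Psi> y = ereal (\<psi> y)" for y
  define f where "f = conj (conv_meas (conj \<Psi>) q)"
  have conj_le: "conj \<Psi> (z - h x) \<le> ereal (\<xi> (x, z) - h x \<bullet> x)" for x z
    unfolding conj_def \<Psi>_def
  proof (rule SUP_least)
    fix y show "ereal ((z - h x) \<bullet> y) - ereal (\<psi> y) \<le> ereal (\<xi> (x, z) - h x \<bullet> x)"
      using \<psi>(3)[of y z x] by (simp add: inner_commute)
  qed
  have conv_le: "conv_meas (conj \<Psi>) q (- h x) \<le> ereal ((\<integral>z. \<xi> (x, z) \<partial>q) - h x \<bullet> x)" for x
  proof -
    have i: "integrable q (\<lambda>z. \<xi> (x, z))" by (rule P2_subquadratic_integrable[OF q subquadratic_section[OF \<xi>]])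
    have "conv_meas (conj \<Psi>) q (- h x) \<le> eint q (\<lambda>z. ereal (\<xi> (x, z) - h x \<bullet> x))"
      unfolding conv_meas_def using conj_le[of _ x] by (intro eint_mono_AE AE_I2) simp
    also have "\<dots> = ereal (\<integral>z. \<xi> (x, z) - h x \<bullet> x \<partial>q)" using i by (intro eint_eq_integral) auto
    finally show ?thesis using i by (simp add: q.prob_space)
  qed
  have f_ge: "ereal (- (\<integral>z. \<xi> (x, z) \<partial>q)) \<le> f x" for x
  proof -
    have "ereal (- (\<integral>z. \<xi> (x, z) \<partial>q)) \<le> ereal (x \<bullet> (- h x)) - conv_meas (conj \<Psi>) q (- h x)"
      using conv_le[of x] by (cases "conv_meas (conj \<Psi>) q (- h x)") (auto simp: inner_commute)
    also have "\<dots> \<le> f x" unfolding f_def conj_def[of "conv_meas _ _"] by (rule SUP_upper) simp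
    finally show ?thesis .
  qed
  have "ereal (\<integral>x. - (\<integral>z. \<xi> (x, z) \<partial>q) \<partial>\<mu>) = eint \<mu> (\<lambda>x. ereal (- (\<integral>z. \<xi> (x, z) \<partial>q)))"
    using integrable_section_integral[OF \<mu> q \<xi>] by (intro eint_eq_integral[symmetric]) auto
  also have "\<dots> \<le> eint \<mu> f" using f_ge by (intro eint_mono_AE AE_I2)
  finally have f_int: "ereal (- (\<integral>p. \<xi> p \<partial>(\<mu> \<Otimes>\<^sub>M q))) \<le> eint \<mu> f"
    by (simp add: integral_section_integral[OF \<mu> q \<xi>])
  have "econvex \<Psi>"
    unfolding econvex_def \<Psi>_def using convex_onD[OF \<psi>(1)] by auto
  moreover have "L1e \<nu> \<Psi>" using \<psi>i by (simp add: L1e_def \<Psi>_def)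
  ultimately have "Dq q \<mu> \<nu> \<le> ereal (\<integral>y. real_of_ereal (\<Psi> y) \<partial>\<nu>) - eint \<mu> f"
    unfolding Dq_def f_def by (intro INF_lower) auto
  also have "\<dots> \<le> ereal (\<integral>y. \<psi> y \<partial>\<nu>) - ereal (- (\<integral>p. \<xi> p \<partial>(\<mu> \<Otimes>\<^sub>M q)))"
    using f_int by (intro ereal_minus_mono) (auto simp: \<Psi>_def)
  also have "\<dots> \<le> ereal ((\<integral>y. \<phi> y \<partial>\<nu>) + (\<integral>p. \<xi> p \<partial>(\<mu> \<Otimes>\<^sub>M q)))"
    using integral_mono[OF \<psi>i P2_subquadratic_integrable[OF \<nu> \<phi>] \<psi>(2)] by simp
  finally show ?thesis .
qed

text \<open>At y = x the term with h disappears, so \<psi> x is at least x \<bullet> z - \<xi> (x,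
  z) for all z. Averaging over z and x bounds the \<mu>-integral of \<psi> from below, and the
  convex order transfers the bound to \<nu>. It is applied to the convex \<psi>, as \<phi> may fail
  to be convex.\<close>

lemma dual_value_bounded_below:
  fixes \<mu> \<nu> q :: "'a::euclidean_space measure"
  assumes \<mu>: "P2 \<mu>" and \<nu>: "P2 \<nu>" and q: "P2 q" and order: "convex_order \<mu> \<nu>"
    and \<phi>: "subquadratic \<phi>" and \<xi>: "subquadratic \<xi>"
    and dom: "\<And>x y z. y \<bullet> z \<le> \<phi> y + h x \<bullet> (y - x) + \<xi> (x, z)"
  shows "(\<integral>x. x \<partial>\<mu>) \<bullet> (\<integral>z. z \<partial>q) \<le> (\<integral>y. \<phi> y \<partial>\<nu>) + (\<integral>p. \<xi> p \<partial>(\<mu> \<Otimes>\<^sub>M q))"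
proof -
  obtain \<psi> where \<psi>: "convex_on UNIV \<psi>" "\<And>y. \<psi> y \<le> \<phi> y"
    "\<And>x y z. y \<bullet> (z - h x) + h x \<bullet> x - \<xi> (x, z) \<le> \<psi> y"
    using dual_potential[of \<phi> h \<xi>] dom by blast
  interpret q: prob_space q using q by (simp add: P2_def)
  have \<psi>i: "integrable \<nu> \<psi>"
    by (rule dual_potential_integrable[OF \<nu> \<phi> \<psi>(1,2), of "0 - h 0" "h 0 \<bullet> 0 - \<xi> (0, 0)"])
      (use \<psi>(3)[where x=0 and z=0] in simp)
  have iq: "integrable q (\<lambda>z. z)" "integrable \<mu> (\<lambda>z. z)" using q \<mu> by (auto simp: P2_def intro!: integrable_of_square)
  have low: "x \<bullet> (\<integral>z. z \<partial>q) - (\<integral>z. \<xi> (x, z) \<partial>q) \<le> \<psi> x" for x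
  proof -
    have i: "integrable q (\<lambda>z. \<xi> (x, z))" by (rule P2_subquadratic_integrable[OF q subquadratic_section[OF \<xi>]])
    have "x \<bullet> (\<integral>z. z \<partial>q) - (\<integral>z. \<xi> (x, z) \<partial>q) = (\<integral>z. x \<bullet> z - \<xi> (x, z) \<partial>q)"
      using iq(1) i by simp
    also have "\<dots> \<le> (\<integral>z. \<psi> x \<partial>q)"
    proof (rule integral_mono)
      show "x \<bullet> z - \<xi> (x, z) \<le> \<psi> x" for z
        using \<psi>(3)[of x z x] by (simp add: inner_diff_right inner_commute)
    qed (use iq(1) i in auto)
    finally show ?thesis by (simp add: q.prob_space)
  qed
  have i2: "integrable \<mu> (\<lambda>x. x \<bullet> (\<integral>z. z \<partial>q) - (\<integral>z. \<xi> (x, z) \<partial>q))"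
    using iq(2) integrable_section_integral[OF \<mu> q \<xi>] by simp
  have "ereal ((\<integral>x. x \<partial>\<mu>) \<bullet> (\<integral>z. z \<partial>q) - (\<integral>p. \<xi> p \<partial>(\<mu> \<Otimes>\<^sub>M q))) =
      ereal (\<integral>x. x \<bullet> (\<integral>z. z \<partial>q) - (\<integral>z. \<xi> (x, z) \<partial>q) \<partial>\<mu>)"
    using iq(2) integrable_section_integral[OF \<mu> q \<xi>] by (simp add: integral_section_integral[OF \<mu> q \<xi>])
  also have "\<dots> = eint \<mu> (\<lambda>x. ereal (x \<bullet> (\<integral>z. z \<partial>q) - (\<integral>z. \<xi> (x, z) \<partial>q)))"
    using i2 by (intro eint_eq_integral[symmetric]) auto
  also have "\<dots> \<le> eint \<mu> (\<lambda>x. ereal (\<psi> x))" using low by (intro eint_mono_AE AE_I2) simp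
  also have "\<dots> \<le> eint \<nu> (\<lambda>x. ereal (\<psi> x))" using order \<psi>(1) by (simp add: convex_order_def)
  also have "\<dots> = ereal (\<integral>y. \<psi> y \<partial>\<nu>)" using \<psi>i by (intro eint_eq_integral) auto
  also have "\<dots> \<le> ereal (\<integral>y. \<phi> y \<partial>\<nu>)"
    using integral_mono[OF \<psi>i P2_subquadratic_integrable[OF \<nu> \<phi>] \<psi>(2)] by simp
  finally show ?thesis by simp
qed

section \<open>Kernels and their joint laws\<close>

lemma
  fixes \<mu> :: "'a::euclidean_space measure" and \<kappa> :: "'a \<Rightarrow> 'b::euclidean_space measure"
  assumes \<mu>: "prob_space \<mu>" "sets \<mu> = sets borel" and \<kappa>: "\<kappa> \<in> measurable \<mu> (prob_algebra borel)"
  defines "J \<equiv> bind \<mu> (\<lambda>x. distr (\<kappa> x) (borel :: ('a \<times> 'b) measure) (Pair x))"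
  shows sets_joint_kernel: "sets J = sets borel"
    and prob_space_joint_kernel: "prob_space J"
    and nn_integral_joint_kernel: "\<And>g. g \<in> borel_measurable borel \<Longrightarrow>
      (\<integral>\<^sup>+w. g w \<partial>J) = (\<integral>\<^sup>+x. \<integral>\<^sup>+y. g (x, y) \<partial>\<kappa> x \<partial>\<mu>)"
    and distr_joint_kernel_fst: "distr J borel fst = \<mu>"
    and distr_joint_kernel_snd: "distr J borel snd = bind \<mu> \<kappa>"
    and distr_joint_kernel_map: "\<And>g :: 'b \<Rightarrow> 'c::euclidean_space. g \<in> borel_measurable borel \<Longrightarrow>
      distr J borel (\<lambda>w. (fst w, g (snd w))) = bind \<mu> (\<lambda>x. distr (distr (\<kappa> x) borel g) borel (Pair x))"
    and integral_joint_kernel_integrable: "\<And>f :: 'a \<times> 'b \<Rightarrow> real. f \<in> borel_measurable borel \<Longrightarrow> integrable J f \<Longrightarrow>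
      integrable \<mu> (\<lambda>x. \<integral>y. f (x, y) \<partial>\<kappa> x)"
    and integral_joint_kernel: "\<And>f :: 'a \<times> 'b \<Rightarrow> real. f \<in> borel_measurable borel \<Longrightarrow> integrable J f \<Longrightarrow>
      (\<integral>w. f w \<partial>J) = (\<integral>x. \<integral>y. f (x, y) \<partial>\<kappa> x \<partial>\<mu>)"
proof -
  interpret \<mu>: prob_space \<mu> by fact
  note [measurable_cong] = \<mu>(2)
  have sp\<mu>: "space \<mu> = UNIV" using sets_eq_imp_space_eq[OF \<mu>(2)] by simp
  have s\<kappa>: "sets (\<kappa> x) = sets borel" and p\<kappa>: "prob_space (\<kappa> x)" for x
    using measurable_space[OF \<kappa>, of x] by (auto simp: sp\<mu> space_prob_algebra)
  have jm: "(\<lambda>x. distr (\<kappa> x) (borel :: ('a \<times> 'b) measure) (Pair x)) \<in> measurable \<mu> (prob_algebra borel)"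
    by (rule measurable_joint_kernel[OF \<mu>(2) \<kappa>])
  note jm' = measurable_prob_algebraD[OF jm]
  have Pm: "Pair x \<in> measurable borel (borel :: ('a \<times> 'b) measure)" for x :: 'a
    by (simp flip: borel_prod)
  have Pm\<kappa>: "Pair x \<in> measurable (\<kappa> x) (borel :: ('a \<times> 'b) measure)" for x
    using Pm measurable_cong_sets[OF s\<kappa> refl] by blast
  show sJ: "sets J = sets borel" unfolding J_def by (rule sets_bind) (auto simp: sp\<mu>)
  show "prob_space J" unfolding J_def
  proof (rule \<mu>.prob_space_bind[OF _ jm'])
    show "AE x in \<mu>. prob_space (distr (\<kappa> x) (borel :: ('a \<times> 'b) measure) (Pair x))"
      using p\<kappa> Pm\<kappa> by (auto intro!: AE_I2 prob_space.prob_space_distr)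
  qed
  show nn: "(\<integral>\<^sup>+w. g w \<partial>J) = (\<integral>\<^sup>+x. \<integral>\<^sup>+y. g (x, y) \<partial>\<kappa> x \<partial>\<mu>)" if g: "g \<in> borel_measurable borel" for g
    unfolding J_def using g Pm\<kappa> by (subst nn_integral_bind[OF g jm']) (simp add: nn_integral_distr)
  have fstJ: "fst \<in> borel_measurable J" and sndJ: "snd \<in> borel_measurable J"
    using borel_measurable_fst_snd measurable_cong_sets[OF sJ refl] by blast+
  show "distr J borel fst = \<mu>"
  proof (rule measure_eqI)
    fix A assume "A \<in> sets (distr J borel fst)"
    then have A[measurable]: "A \<in> sets borel" by simp
    have "emeasure (distr J borel fst) A = (\<integral>\<^sup>+w. indicator A (fst w) \<partial>J)"
      using fstJ by (subst nn_integral_distr[symmetric, where f="indicator A"]) auto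
    also have "\<dots> = (\<integral>\<^sup>+x. \<integral>\<^sup>+y. indicator A x \<partial>\<kappa> x \<partial>\<mu>)" by (subst nn) auto
    also have "\<dots> = (\<integral>\<^sup>+x. indicator A x \<partial>\<mu>)"
      using prob_space.emeasure_space_1[OF p\<kappa>] by simp
    finally show "emeasure (distr J borel fst) A = emeasure \<mu> A" by simp
  qed (simp add: \<mu>)
  have distr_J: "distr J borel g = bind \<mu> (\<lambda>x. distr (\<kappa> x) borel (\<lambda>y. g (x, y)))"
    if g: "g \<in> borel_measurable borel" for g :: "'a \<times> 'b \<Rightarrow> 'd::euclidean_space"
  proof -
    have "distr J borel g = bind \<mu> (\<lambda>x. distr (distr (\<kappa> x) borel (Pair x)) borel g)"
      unfolding J_def by (rule distr_bind[OF jm' _ g]) (simp add: sp\<mu>)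
    also have "\<dots> = bind \<mu> (\<lambda>x. distr (\<kappa> x) borel (\<lambda>y. g (x, y)))"
      using Pm\<kappa> g by (intro bind_cong refl) (simp add: distr_distr comp_def)
    finally show ?thesis .
  qed
  show "distr J borel snd = bind \<mu> \<kappa>"
  proof -
    have "distr J borel snd = bind \<mu> (\<lambda>x. distr (\<kappa> x) borel (\<lambda>y. y))" by (subst distr_J) auto
    also have "\<dots> = bind \<mu> \<kappa>"
    proof (intro bind_cong refl)
      fix x
      show "distr (\<kappa> x) borel (\<lambda>y. y) = \<kappa> x"
        using s\<kappa>[of x] by (intro distr_id2) simp
    qed
    finally show ?thesis .
  qed
  show "distr J borel (\<lambda>w. (fst w, g (snd w))) = bind \<mu> (\<lambda>x. distr (distr (\<kappa> x) borel g) borel (Pair x))"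
    if g[measurable]: "g \<in> borel_measurable borel" for g :: "'b \<Rightarrow> 'c"
  proof -
    have "distr J borel (\<lambda>w. (fst w, g (snd w))) = bind \<mu> (\<lambda>x. distr (\<kappa> x) borel (\<lambda>y. (x, g y)))"
      by (subst distr_J) (auto simp flip: borel_prod)
    also have "\<dots> = bind \<mu> (\<lambda>x. distr (distr (\<kappa> x) borel g) borel (Pair x))"
    proof (intro bind_cong refl)
      fix x
      have "g \<in> borel_measurable (\<kappa> x)" using g measurable_cong_sets[OF s\<kappa> refl] by blast
      moreover have "Pair x \<in> measurable borel (borel :: ('a \<times> 'c) measure)" by (simp flip: borel_prod)
      ultimately show "distr (\<kappa> x) borel (\<lambda>y. (x, g y)) = distr (distr (\<kappa> x) borel g) borel (Pair x)"
        by (subst distr_distr) (auto simp: comp_def)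
    qed
    finally show ?thesis .
  qed
  {
    fix f :: "'a \<times> 'b \<Rightarrow> real" assume f: "f \<in> borel_measurable borel" and i: "integrable J f"
    note ib = integral_bind_kernel[OF jm i[unfolded J_def] f]
    have eq: "(\<integral>w. f w \<partial>distr (\<kappa> x) borel (Pair x)) = (\<integral>y. f (x, y) \<partial>\<kappa> x)" for x
      using Pm\<kappa> f by (rule integral_distr)
    show "integrable \<mu> (\<lambda>x. \<integral>y. f (x, y) \<partial>\<kappa> x)" using ib(2) by (simp add: eq)
    show "(\<integral>w. f w \<partial>J) = (\<integral>x. \<integral>y. f (x, y) \<partial>\<kappa> x \<partial>\<mu>)" using ib(3) by (simp add: eq J_def)
  }
qed

text \<open>Exhibits q as a conditional law of z given x under the product, for comparison by
  uniqueness of kernels.\<close>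

lemma joint_kernel_const:
  fixes \<mu> q :: "'a::euclidean_space measure"
  assumes \<mu>: "P2 \<mu>" and q: "P2 q"
  shows "bind \<mu> (\<lambda>x. distr q borel (Pair x)) = \<mu> \<Otimes>\<^sub>M q"
proof -
  interpret q: prob_space q using q by (simp add: P2_def)
  have s: "prob_space \<mu>" "sets \<mu> = sets borel" "sets q = sets borel" using \<mu> q by (auto simp: P2_def)
  have sq: "space q = UNIV" using sets_eq_imp_space_eq[OF s(3)] by simp
  have c: "(\<lambda>_. q) \<in> measurable \<mu> (prob_algebra borel)"
    using q by (intro measurable_const) (simp add: space_prob_algebra P2_def)
  show ?thesis
  proof (rule prod_measure_eqI)
    show "finite_measure (bind \<mu> (\<lambda>x. distr q borel (Pair x)))"
      using prob_space_joint_kernel[OF s(1,2) c] by (simp add: prob_space_def)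
    show "sets (bind \<mu> (\<lambda>x. distr q borel (Pair x))) = sets borel" by (rule sets_joint_kernel[OF s(1,2) c])
    show "sets (\<mu> \<Otimes>\<^sub>M q) = sets borel" by (rule sets_pair_P2[OF \<mu> q])
    fix A B :: "'a set" assume AB: "A \<in> sets borel" "B \<in> sets borel"
    then have [measurable]: "A \<times> B \<in> sets borel" unfolding borel_prod[symmetric] by auto
    have "emeasure (bind \<mu> (\<lambda>x. distr q borel (Pair x))) (A \<times> B) =
        (\<integral>\<^sup>+w. indicator (A \<times> B) w \<partial>bind \<mu> (\<lambda>x. distr q borel (Pair x)))"
      using sets_joint_kernel[OF s(1,2) c] by (subst nn_integral_indicator) auto
    also have "\<dots> = (\<integral>\<^sup>+x. \<integral>\<^sup>+y. indicator A x * indicator B y \<partial>q \<partial>\<mu>)"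
      by (subst nn_integral_joint_kernel[OF s(1,2) c]) (auto simp: indicator_times)
    also have "\<dots> = (\<integral>\<^sup>+x. emeasure q B * indicator A x \<partial>\<mu>)"
      using AB s by (intro nn_integral_cong) (simp add: nn_integral_cmult mult.commute)
    also have "\<dots> = emeasure q B * emeasure \<mu> A"
      using AB s by (subst nn_integral_cmult) auto
    also have "\<dots> = emeasure (\<mu> \<Otimes>\<^sub>M q) (A \<times> B)"
      using AB s by (subst q.emeasure_pair_measure_Times) (auto simp: mult.commute)
    finally show "emeasure (bind \<mu> (\<lambda>x. distr q borel (Pair x))) (A \<times> B) = emeasure (\<mu> \<Otimes>\<^sub>M q) (A \<times> B)" .
  qed
qed

text \<open>For each member of a separating family the conditional integrals agree almost surely; as
  the family is countable, a single null set serves for all of them.\<close>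

lemma kernel_unique:
  fixes \<mu> :: "'a::euclidean_space measure" and \<kappa>1 \<kappa>2 :: "'a \<Rightarrow> 'b::euclidean_space measure"
  assumes \<mu>: "prob_space \<mu>" "sets \<mu> = sets borel"
    and \<kappa>1: "\<kappa>1 \<in> measurable \<mu> (prob_algebra borel)" and \<kappa>2: "\<kappa>2 \<in> measurable \<mu> (prob_algebra borel)"
    and eq: "bind \<mu> (\<lambda>x. distr (\<kappa>1 x) borel (Pair x)) = bind \<mu> (\<lambda>x. distr (\<kappa>2 x) borel (Pair x))"
  shows "AE x in \<mu>. \<kappa>1 x = \<kappa>2 x"
proof -
  interpret \<mu>: prob_space \<mu> by fact
  note [measurable_cong] = \<mu>(2)
  have sp\<mu>: "space \<mu> = UNIV" using sets_eq_imp_space_eq[OF \<mu>(2)] by simp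
  obtain f :: "nat \<Rightarrow> 'b \<Rightarrow> real" where f: "\<And>n. continuous_on UNIV (f n)"
    "\<And>n x. 0 \<le> f n x" "\<And>n x. f n x \<le> 1" and f_sep: "separates_measures f"
    by (rule separating_family_of_continuous_functions) (rule that)
  have fm[measurable]: "f n \<in> borel_measurable borel" for n using f(1) by (rule borel_measurable_continuous_onI)
  define g where "g \<kappa> n x = (\<integral>\<^sup>+y. ennreal (f n y) \<partial>\<kappa> x)" for \<kappa> :: "'a \<Rightarrow> 'b measure" and n x
  have gm: "g \<kappa> n \<in> borel_measurable \<mu>" if "\<kappa> \<in> measurable \<mu> (prob_algebra borel)" for \<kappa> n
    unfolding g_def using measurable_prob_algebraD[OF that]
    by (rule measurable_compose[OF _ nn_integral_measurable_subprob_algebra]) simp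
  have int: "(\<integral>\<^sup>+x. g \<kappa> n x * indicator A x \<partial>\<mu>) =
      (\<integral>\<^sup>+w. indicator A (fst w) * ennreal (f n (snd w)) \<partial>bind \<mu> (\<lambda>x. distr (\<kappa> x) borel (Pair x)))"
    if \<kappa>: "\<kappa> \<in> measurable \<mu> (prob_algebra borel)" and A[measurable]: "A \<in> sets borel" for \<kappa> n A
  proof -
    have "(\<integral>\<^sup>+w. indicator A (fst w) * ennreal (f n (snd w)) \<partial>bind \<mu> (\<lambda>x. distr (\<kappa> x) borel (Pair x))) =
        (\<integral>\<^sup>+x. \<integral>\<^sup>+y. indicator A x * ennreal (f n y) \<partial>\<kappa> x \<partial>\<mu>)"
      by (subst nn_integral_joint_kernel[OF \<mu> \<kappa>]) auto
    also have "\<dots> = (\<integral>\<^sup>+x. g \<kappa> n x * indicator A x \<partial>\<mu>)"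
    proof (intro nn_integral_cong)
      fix x
      have "sets (\<kappa> x) = sets borel" using measurable_space[OF \<kappa>, of x] by (simp add: sp\<mu> space_prob_algebra)
      then have "(\<lambda>y. ennreal (f n y)) \<in> borel_measurable (\<kappa> x)"
        using measurable_cong_sets[of "\<kappa> x" borel] fm by simp
      then show "(\<integral>\<^sup>+y. indicator A x * ennreal (f n y) \<partial>\<kappa> x) = g \<kappa> n x * indicator A x"
        by (simp add: nn_integral_cmult g_def mult.commute)
    qed
    finally show ?thesis by simp
  qed
  have "AE x in \<mu>. g \<kappa>1 n x = g \<kappa>2 n x" for n
  proof -
    have "density \<mu> (g \<kappa>1 n) = density \<mu> (g \<kappa>2 n)"
      by (rule measure_eqI) (auto simp: emeasure_density gm[OF \<kappa>1] gm[OF \<kappa>2] int[OF \<kappa>1] int[OF \<kappa>2] eq \<mu>(2))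
    then show ?thesis using \<mu>.density_unique_iff[OF gm[OF \<kappa>1] gm[OF \<kappa>2]] by simp
  qed
  then have "AE x in \<mu>. \<forall>n. g \<kappa>1 n x = g \<kappa>2 n x" by (simp add: AE_all_countable)
  then show ?thesis
  proof eventually_elim
    case (elim x)
    have k: "finite_measure (\<kappa> x)" "sets (\<kappa> x) = sets borel" "f n \<in> borel_measurable (\<kappa> x)"
      if "\<kappa> \<in> measurable \<mu> (prob_algebra borel)" for \<kappa> n
      using measurable_space[OF that, of x] fm measurable_cong_sets[of "\<kappa> x" borel]
      by (auto simp: sp\<mu> space_prob_algebra prob_space_def)
    show ?case
    proof (rule f_sep[unfolded separates_measures_def, rule_format])
      show "(\<integral>y. f n y \<partial>\<kappa>1 x) = (\<integral>y. f n y \<partial>\<kappa>2 x)" for n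
        using elim f(2) k(3)[OF \<kappa>1] k(3)[OF \<kappa>2] by (simp add: integral_eq_nn_integral g_def)
    qed (use k[OF \<kappa>1] k[OF \<kappa>2] in auto)
  qed
qed

text \<open>The signed measure with density g is tested through its positive and negative parts,
  which are finite measures that no member of the family tells apart.\<close>

lemma AE_zero_if_orthogonal_to_separating:
  fixes \<mu> :: "'a::euclidean_space measure" and g :: "'a \<Rightarrow> real"
  assumes \<mu>: "prob_space \<mu>" "sets \<mu> = sets borel" and g: "integrable \<mu> g"
    and f: "\<And>n. continuous_on UNIV (f n)" "\<And>n x. 0 \<le> f n x" "\<And>n x. f n x \<le> 1" "separates_measures f"
    and zero: "\<And>n. (\<integral>x. f n x * g x \<partial>\<mu>) = 0"
  shows "AE x in \<mu>. g x = 0"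
proof -
  interpret \<mu>: prob_space \<mu> by fact
  note [measurable_cong] = \<mu>(2)
  have gm[measurable]: "g \<in> borel_measurable \<mu>" using g by simp
  have fm[measurable]: "f n \<in> borel_measurable borel" for n using f(1) by (rule borel_measurable_continuous_onI)
  have fin: "finite_measure (density \<mu> (\<lambda>x. ennreal (r * g x)))" for r
  proof
    have "(\<integral>\<^sup>+x. ennreal (r * g x) \<partial>\<mu>) \<noteq> \<infinity>"
    proof -
      have "integrable \<mu> (\<lambda>x. r * g x)" using g by simp
      then show ?thesis unfolding real_integrable_def by blast
    qed
    then show "emeasure (density \<mu> (\<lambda>x. ennreal (r * g x))) (space (density \<mu> (\<lambda>x. ennreal (r * g x)))) \<noteq> \<infinity>"
      by (simp add: emeasure_density cong: nn_integral_cong)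
  qed
  \<comment> \<open>\<open>ennreal\<close> sends negative numbers to 0, so these densities are the
    positive and the negative part of g.\<close>
  have "density \<mu> (\<lambda>x. ennreal (1 * g x)) = density \<mu> (\<lambda>x. ennreal (- 1 * g x))"
  proof (rule f(4)[unfolded separates_measures_def, rule_format, OF fin fin])
    fix n
    have ifg: "integrable \<mu> (\<lambda>x. f n x * max 0 (r * g x))" for r
    proof (rule Bochner_Integration.integrable_bound[of _ "\<lambda>x. r * g x"])
      show "AE x in \<mu>. norm (f n x * max 0 (r * g x)) \<le> norm (r * g x)"
      proof (rule AE_I2)
        fix x
        have "f n x * max 0 (r * g x) \<le> 1 * max 0 (r * g x)" using f(3) by (intro mult_right_mono) auto
        then have "f n x * max 0 (r * g x) \<le> \<bar>r * g x\<bar>" by linarith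
        moreover have "0 \<le> f n x * max 0 (r * g x)" using f(2)[of n x] by simp
        ultimately show "norm (f n x * max 0 (r * g x)) \<le> norm (r * g x)"
          by (simp only: real_norm_def abs_of_nonneg)
      qed
    qed (use g in simp_all)
    have d: "(\<integral>x. f n x \<partial>density \<mu> (\<lambda>x. ennreal (r * g x))) = (\<integral>x. f n x * max 0 (r * g x) \<partial>\<mu>)" for r
    proof -
      have e: "density \<mu> (\<lambda>x. ennreal (r * g x)) = density \<mu> (\<lambda>x. ennreal (max 0 (r * g x)))"
        by (intro density_cong) (auto intro!: AE_I2 simp: max_def ennreal_neg)
      have "(\<integral>x. f n x \<partial>density \<mu> (\<lambda>x. ennreal (max 0 (r * g x)))) = (\<integral>x. max 0 (r * g x) * f n x \<partial>\<mu>)"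
        by (rule integral_real_density) auto
      then show ?thesis unfolding e by (simp only: mult.commute)
    qed
    have "(\<integral>x. f n x * max 0 (1 * g x) \<partial>\<mu>) - (\<integral>x. f n x * max 0 (- 1 * g x) \<partial>\<mu>) = (\<integral>x. f n x * g x \<partial>\<mu>)"
      by (subst Bochner_Integration.integral_diff[OF ifg ifg, symmetric])
        (auto intro!: Bochner_Integration.integral_cong simp: max_def algebra_simps)
    then show "(\<integral>x. f n x \<partial>density \<mu> (\<lambda>x. ennreal (1 * g x))) = (\<integral>x. f n x \<partial>density \<mu> (\<lambda>x. ennreal (- 1 * g x)))"
      using zero unfolding d by simp
  qed (auto simp: \<mu>(2))
  then have "AE x in \<mu>. ennreal (1 * g x) = ennreal (- 1 * g x)"
    by (subst (asm) \<mu>.density_unique_iff) auto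
  then show ?thesis
  proof eventually_elim
    case (elim x)
    then show ?case by (cases "0 \<le> g x") (auto simp: ennreal_neg ennreal_eq_0_iff)
  qed
qed

section \<open>Existence of an optimal plan\<close>

lemma tail_integrals_tendsto_zero:
  assumes "P2 \<nu>"
  shows "(\<lambda>n. \<integral>y. max 0 ((norm y)\<^sup>2 - real n) \<partial>\<nu>) \<longlonglongrightarrow> 0"
proof (rule order_tendstoI)
  fix a :: real assume "a < 0"
  then show "\<forall>\<^sub>F n in sequentially. a < (\<integral>y. max 0 ((norm y)\<^sup>2 - real n) \<partial>\<nu>)"
    by (intro always_eventually allI less_le_trans[OF _ Bochner_Integration.integral_nonneg]) auto
next
  fix a :: real assume "0 < a"
  then show "\<forall>\<^sub>F n in sequentially. (\<integral>y. max 0 ((norm y)\<^sup>2 - real n) \<partial>\<nu>) < a"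
    using assms by (intro tail_integral_small) (auto simp: P2_def)
qed

text \<open>A semistatic hedge in the language of martingale transport: \<phi> is a static claim on
  y, and the other term is the gain of the strategy h, which integrates to zero under martingale
  laws.\<close>

definition hedge :: "('a::euclidean_space \<Rightarrow> real) \<Rightarrow> ('a \<Rightarrow> 'a) \<Rightarrow> 'a \<times> 'a \<Rightarrow> real" where
  "hedge \<phi> h p = \<phi> (snd p) + h (fst p) \<bullet> (snd p - fst p)"

lemma subquadratic_hedge:
  fixes \<phi> :: "'a::euclidean_space \<Rightarrow> real"
  assumes \<phi>: "subquadratic \<phi>" and h: "continuous_on UNIV h" "bounded (range h)"
  shows "subquadratic (hedge \<phi> h)"
proof -
  obtain H where H: "\<And>x. norm (h x) \<le> H" using h(2) by (auto simp: bounded_iff)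
  have H0: "0 \<le> H" using H[of 0] norm_ge_zero[of "h 0"] by linarith
  have "subquadratic (\<lambda>p. h (fst p) \<bullet> (snd p - fst p))"
  proof (rule subquadraticI)
    have "continuous_on UNIV (\<lambda>p :: 'a \<times> 'a. h (fst p))"
      by (rule continuous_on_compose2[OF h(1)]) (auto intro!: continuous_intros)
    then show "continuous_on UNIV (\<lambda>p :: 'a \<times> 'a. h (fst p) \<bullet> (snd p - fst p))"
      by (intro continuous_intros)
    fix p :: "'a \<times> 'a"
    have n: "norm (fst p) \<le> norm p" "norm (snd p) \<le> norm p"
      using norm_le_norm_Pair[where x="fst p" and y="snd p"] by simp_all
    have "\<bar>h (fst p) \<bullet> (snd p - fst p)\<bar> \<le> norm (h (fst p)) * norm (snd p - fst p)" by (rule Cauchy_Schwarz_ineq2)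
    also have "\<dots> \<le> H * (2 * norm p)"
      using H H0 n norm_triangle_ineq4[of "snd p" "fst p"] by (intro mult_mono) auto
    also have "\<dots> \<le> H * (1 + (norm p)\<^sup>2)"
    proof (intro mult_left_mono H0)
      show "2 * norm p \<le> 1 + (norm p)\<^sup>2" using zero_le_power2[of "1 - norm p"] by (simp add: power2_diff)
    qed
    finally show "\<bar>h (fst p) \<bullet> (snd p - fst p)\<bar> \<le> H * (1 + (norm p)\<^sup>2)" .
  qed
  moreover have "subquadratic (\<lambda>p :: 'a \<times> 'a. \<phi> (snd p))"
    using norm_le_norm_Pair(2) by (intro subquadratic_compose[OF \<phi>] continuous_intros) (auto simp: split_paired_all)
  ultimately show ?thesis
    using subquadratic_add by (simp add: hedge_def[abs_def])
qed

lemma integral_law_of_xy: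
  fixes P :: "('a::euclidean_space \<times> 'a \<times> 'a) measure" and f :: "'a \<times> 'a \<Rightarrow> real"
  assumes "sets P = sets borel" and f: "f \<in> borel_measurable (borel :: ('a \<times> 'a) measure)"
  shows "(\<integral>p. f p \<partial>distr P borel (\<lambda>w. (fst w, fst (snd w)))) = (\<integral>(x, y, z). f (x, y) \<partial>P)"
proof -
  have "(\<lambda>w. (fst w, fst (snd w))) \<in> borel_measurable (borel :: ('a \<times> 'a \<times> 'a) measure)"
    by (intro borel_measurable_continuous_onI continuous_intros)
  then have "(\<lambda>w. (fst w, fst (snd w))) \<in> borel_measurable P"
    using measurable_cong_sets[OF assms(1) refl] by blast
  then show ?thesis using f by (subst integral_distr) (auto simp: case_prod_unfold)
qed

text \<open>The functions \<open>hedge \<phi> h\<close> form a linear space whose prescribed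
  integrals encode both the law \<nu> of y and the martingale property. Given x, the law of (y, z)
  under the solution is a coupling of its y-marginal with q, so its cost is at most the fibrewise
  \<open>MCov\<close>.\<close>

lemma primal_candidate:
  fixes \<mu> \<nu> q :: "'a::euclidean_space measure"
  assumes \<mu>: "P2 \<mu>" and \<nu>: "P2 \<nu>" and q: "P2 q"
    and D: "\<And>\<phi> h \<xi>. subquadratic \<phi> \<Longrightarrow> continuous_on UNIV h \<Longrightarrow> bounded (range h) \<Longrightarrow> subquadratic \<xi> \<Longrightarrow>
      (\<And>x y z. y \<bullet> z \<le> \<phi> y + h x \<bullet> (y - x) + \<xi> (x, z)) \<Longrightarrow>
      D \<le> (\<integral>y. \<phi> y \<partial>\<nu>) + (\<integral>p. \<xi> p \<partial>(\<mu> \<Otimes>\<^sub>M q))"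
  obtains K where "K \<in> MT_kernels \<mu> \<nu>" "ereal D \<le> primal_obj q \<mu> K"
proof -
  have p\<mu>: "prob_space \<mu>" "sets \<mu> = sets borel" and s\<nu>: "sets \<nu> = sets borel" and sq: "sets q = sets borel"
    using \<mu> \<nu> q by (auto simp: P2_def)
  have sp\<mu>: "space \<mu> = UNIV" using sets_eq_imp_space_eq[OF p\<mu>(2)] by simp
  note R = pair_prob_space_P2[OF \<mu> q] sets_pair_P2[OF \<mu> q] pair_second_moment[OF \<mu> q]
  have \<nu>i: "integrable \<nu> \<phi>" if "subquadratic \<phi>" for \<phi> using P2_subquadratic_integrable[OF \<nu> that] .
  obtain f :: "nat \<Rightarrow> 'a \<Rightarrow> real" where f: "\<And>n. continuous_on UNIV (f n)"
    "\<And>n x. 0 \<le> f n x" "\<And>n x. f n x \<le> 1" and f_sep: "separates_measures f"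
    by (rule separating_family_of_continuous_functions) (rule that)
  have fm[measurable]: "f n \<in> borel_measurable borel" for n using f(1) by (rule borel_measurable_continuous_onI)
  have fsub: "subquadratic (f n)" for n
    using f by (intro subquadratic_bounded[where C=1]) (auto simp: abs_le_iff intro: order_trans[of _ 0])
  \<comment> \<open>Boundedness of h keeps h x \<bullet> (y - x) subquadratic.\<close>
  define ok where "ok h \<longleftrightarrow> continuous_on UNIV h \<and> bounded (range h)" for h :: "'a \<Rightarrow> 'a"
  have ok0: "ok (\<lambda>_. 0)" by (auto simp: ok_def)
  have okb: "ok (\<lambda>x. f n x *\<^sub>R b)" for n b
  proof -
    have "norm (f n x *\<^sub>R b) \<le> norm b" for x using f(2,3)[of n x] by (simp add: mult_left_le_one_le)
    then show ?thesis unfolding ok_def using f(1)[of n] by (auto simp: bounded_iff intro!: continuous_intros)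
  qed
  have sub0: "subquadratic (\<lambda>_ :: 'a. 0)" by (rule subquadratic_bounded[where C=0]) auto
  define U where "U = {(hedge \<phi> h, \<integral>y. \<phi> y \<partial>\<nu>) | \<phi> h. subquadratic \<phi> \<and> ok h}"
  have UI: "(u, b) \<in> U" if "subquadratic \<phi>" "ok h" "u = hedge \<phi> h" "b = (\<integral>y. \<phi> y \<partial>\<nu>)" for u b \<phi> h
    using that by (auto simp: U_def)
  have UE: "\<exists>\<phi> h. subquadratic \<phi> \<and> ok h \<and> u = hedge \<phi> h \<and> b = (\<integral>y. \<phi> y \<partial>\<nu>)" if "(u, b) \<in> U" for u b
    using that by (auto simp: U_def)
  \<comment> \<open>The first family fixes the law of y. The second tests y - x against
    \<open>f n\<close> times each basis vector, which is enough to recover the conditional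
    mean.\<close>
  define S where "S = range (\<lambda>n. (hedge (f n) (\<lambda>_. 0), \<integral>y. f n y \<partial>\<nu>)) \<union>
    (\<lambda>(n, b). (hedge (\<lambda>_. 0) (\<lambda>x. f n x *\<^sub>R b), \<integral>y. 0 \<partial>\<nu>)) ` (UNIV \<times> Basis)"
  have S: "countable S" "S \<subseteq> U"
  proof -
    show "countable S" unfolding S_def
      by (intro countable_Un countable_image countable_SIGMA countableI_type) (auto intro: countable_finite)
    have "(hedge (f n) (\<lambda>_. 0), \<integral>y. f n y \<partial>\<nu>) \<in> U" for n by (rule UI[OF fsub ok0]) auto
    moreover have "(hedge (\<lambda>_. 0) (\<lambda>x. f n x *\<^sub>R b), \<integral>y. 0 \<partial>\<nu>) \<in> U" for n b by (rule UI[OF sub0 okb]) auto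
    ultimately show "S \<subseteq> U" by (auto simp: S_def)
  qed
  obtain P :: "('a \<times> 'a \<times> 'a) measure" where P: "prob_space P" "sets P = sets borel"
    "integrable P (\<lambda>w. (norm w)\<^sup>2)" "distr P borel (\<lambda>(x, y, z). (x, z)) = \<mu> \<Otimes>\<^sub>M q"
    "\<And>u b. (u, b) \<in> S \<Longrightarrow> (\<integral>(x, y, z). u (x, y) \<partial>P) = b" "D \<le> (\<integral>(x, y, z). y \<bullet> z \<partial>P)"
  proof (rule transport_duality[OF R, of U "\<integral>y. (norm y)\<^sup>2 \<partial>\<nu>" "\<lambda>n. \<integral>y. max 0 ((norm y)\<^sup>2 - real n) \<partial>\<nu>" D S])
    show "((\<lambda>p. u p + u' p), b + b') \<in> U" if a: "(u, b) \<in> U" "(u', b') \<in> U" for u b u' b'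
    proof -
      obtain \<phi> h \<phi>' h' where *: "subquadratic \<phi>" "ok h" "u = hedge \<phi> h" "b = (\<integral>y. \<phi> y \<partial>\<nu>)"
        "subquadratic \<phi>'" "ok h'" "u' = hedge \<phi>' h'" "b' = (\<integral>y. \<phi>' y \<partial>\<nu>)"
        using UE[OF a(1)] UE[OF a(2)] by blast
      have "ok (\<lambda>x. h x + h' x)"
        using *(2,6) unfolding ok_def by (auto intro!: continuous_intros bounded_plus_comp)
      then show ?thesis
        by (rule UI[OF subquadratic_add[OF *(1,5)]])
          (auto simp: * hedge_def fun_eq_iff \<nu>i inner_add_left)
    qed
    show "((\<lambda>p. r * u p), r * b) \<in> U" if a: "(u, b) \<in> U" for u b r
    proof -
      obtain \<phi> h where *: "subquadratic \<phi>" "ok h" "u = hedge \<phi> h" "b = (\<integral>y. \<phi> y \<partial>\<nu>)"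
        using UE[OF a] by blast
      have "ok (\<lambda>x. r *\<^sub>R h x)"
        using *(2) unfolding ok_def by (auto intro!: continuous_intros bounded_scaleR_comp)
      then show ?thesis
        by (rule UI[OF subquadratic_scale[OF *(1)]])
          (auto simp: * hedge_def fun_eq_iff distrib_left)
    qed
    show "subquadratic u" if a: "(u, b) \<in> U" for u b
      using UE[OF a] subquadratic_hedge by (auto simp: ok_def)
    show "((\<lambda>p. (norm (snd p))\<^sup>2), \<integral>y. (norm y)\<^sup>2 \<partial>\<nu>) \<in> U"
      by (rule UI[OF subquadratic_norm_square ok0]) (auto simp: hedge_def fun_eq_iff)
    show "((\<lambda>p. max 0 ((norm (snd p))\<^sup>2 - real n)), \<integral>y. max 0 ((norm y)\<^sup>2 - real n) \<partial>\<nu>) \<in> U" for n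
      by (rule UI[OF subquadratic_tail[of "real n"] ok0]) (auto simp: hedge_def fun_eq_iff)
    show "(\<lambda>n. \<integral>y. max 0 ((norm y)\<^sup>2 - real n) \<partial>\<nu>) \<longlonglongrightarrow> 0" by (rule tail_integrals_tendsto_zero[OF \<nu>])
    show "D \<le> b + (\<integral>p. \<xi> p \<partial>(\<mu> \<Otimes>\<^sub>M q))"
      if a: "(u, b) \<in> U" "subquadratic \<xi>" and dom: "\<And>x y z. y \<bullet> z \<le> u (x, y) + \<xi> (x, z)" for u b \<xi>
    proof -
      obtain \<phi> h where *: "subquadratic \<phi>" "ok h" "u = hedge \<phi> h" "b = (\<integral>y. \<phi> y \<partial>\<nu>)"
        using UE[OF a(1)] by blast
      have "y \<bullet> z \<le> \<phi> y + h x \<bullet> (y - x) + \<xi> (x, z)" for x y z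
        using dom[of y z x] by (simp add: * hedge_def)
      then show ?thesis
        unfolding *(4) using *(1,2) a(2) by (intro D) (auto simp: ok_def)
    qed
  qed (use S in blast)+
  interpret P: prob_space P by fact
  have [measurable_cong]: "sets P = sets borel" by fact
  have toP: "g \<in> borel_measurable P" if "continuous_on UNIV g" for g :: "'a \<times> 'a \<times> 'a \<Rightarrow> 'c::euclidean_space"
    using borel_measurable_continuous_onI[OF that] measurable_cong_sets[OF P(2) refl] by blast
  have Pi: "integrable P g" if "subquadratic g" for g
    by (rule subquadratic_integrable[OF that P.finite_measure_axioms P(2,3)])
  have "distr P borel fst = distr (distr P borel (\<lambda>(x, y, z). (x, z))) borel fst"
    by (subst distr_distr) (auto simp: comp_def case_prod_unfold intro!: toP continuous_intros)
  also have "\<dots> = \<mu>"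
    using prod_in_Cpl[of \<mu> q] \<mu> q unfolding P(4) by (auto simp: Cpl_def P2_def)
  finally have "distr P borel fst = \<mu>" .
  from disintegration[OF P(1,2) this]
  obtain \<kappa> where \<kappa>: "\<kappa> \<in> measurable \<mu> (prob_algebra borel)"
    and Pk: "P = bind \<mu> (\<lambda>x. distr (\<kappa> x) borel (Pair x))" by blast
  define K where "K x = distr (\<kappa> x) borel fst" for x
  have Km: "K \<in> measurable \<mu> (prob_algebra borel)"
    unfolding K_def by (rule measurable_compose[OF \<kappa> measurable_distr_prob_space]) simp
  have Zm: "(\<lambda>x. distr (\<kappa> x) borel snd) \<in> measurable \<mu> (prob_algebra borel)"
    by (rule measurable_compose[OF \<kappa> measurable_distr_prob_space]) simp
  note jk = distr_joint_kernel_map[OF p\<mu> \<kappa>, folded Pk]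
  \<comment> \<open>The conditional law of z given x is compared with the constant kernel q, since
    both have the product as their joint law.\<close>
  have "bind \<mu> (\<lambda>x. distr (distr (\<kappa> x) borel snd) borel (Pair x)) = distr P borel (\<lambda>w. (fst w, snd (snd w)))"
    by (rule jk[symmetric]) simp
  also have "\<dots> = \<mu> \<Otimes>\<^sub>M q" using P(4) by (simp add: case_prod_unfold)
  also have "\<dots> = bind \<mu> (\<lambda>x. distr q borel (Pair x))" by (rule joint_kernel_const[OF \<mu> q, symmetric])
  finally have Zq: "AE x in \<mu>. distr (\<kappa> x) borel snd = q"
    using q by (intro kernel_unique[OF p\<mu> Zm]) (auto intro!: measurable_const simp: space_prob_algebra P2_def)
  define \<pi> where "\<pi> = distr P borel (\<lambda>w. (fst w, fst (snd w)))"
  have \<pi>K: "\<pi> = bind \<mu> (\<lambda>x. distr (K x) borel (Pair x))"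
    unfolding \<pi>_def K_def by (rule jk) simp
  have xym: "(\<lambda>w. (fst w, fst (snd w))) \<in> borel_measurable P" by (intro toP continuous_intros)
  have "bind \<mu> K = distr \<pi> borel snd"
    unfolding \<pi>K by (rule distr_joint_kernel_snd[OF p\<mu> Km, symmetric])
  also have "\<dots> = \<nu>"
  proof (rule f_sep[unfolded separates_measures_def, rule_format])
    have "prob_space \<pi>" unfolding \<pi>_def by (rule P.prob_space_distr[OF xym])
    moreover have "snd \<in> borel_measurable \<pi>" unfolding \<pi>_def by simp
    ultimately have "prob_space (distr \<pi> borel snd)" by (rule prob_space.prob_space_distr)
    then show "finite_measure (distr \<pi> borel snd)" by (simp add: prob_space_def)
    show "finite_measure \<nu>" using \<nu> by (simp add: P2_def prob_space_def)
    fix n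
    have "(\<integral>y. f n y \<partial>distr \<pi> borel snd) = (\<integral>p. f n (snd p) \<partial>\<pi>)"
      unfolding \<pi>_def by (subst integral_distr) auto
    also have "\<dots> = (\<integral>(x, y, z). hedge (f n) (\<lambda>_. 0) (x, y) \<partial>P)"
      unfolding \<pi>_def by (subst integral_law_of_xy[OF P(2)]) (auto simp: hedge_def case_prod_unfold)
    also have "\<dots> = (\<integral>y. f n y \<partial>\<nu>)" by (rule P(5)) (auto simp: S_def)
    finally show "(\<integral>y. f n y \<partial>distr \<pi> borel snd) = (\<integral>y. f n y \<partial>\<nu>)" .
  qed (auto simp: s\<nu>)
  finally have bK: "bind \<mu> K = \<nu>" .
  have s\<pi>: "sets \<pi> = sets borel" by (simp add: \<pi>_def)
  have \<pi>i: "integrable \<pi> u" if u: "subquadratic u" for u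
  proof -
    have "subquadratic (\<lambda>w :: 'a \<times> 'a \<times> 'a. u (fst w, fst (snd w)))"
      using norm_triple_le(1) by (intro subquadratic_compose[OF u] continuous_intros) (auto simp: split_paired_all)
    from Pi[OF this] show ?thesis
      unfolding \<pi>_def using xym subquadratic_measurable[OF u] by (subst integrable_distr_eq) auto
  qed
  have sq_int: "AE x in \<mu>. integrable (K x) (\<lambda>y. (norm y)\<^sup>2)"
    using \<nu> by (intro integral_bind_kernel(1)[OF Km]) (auto simp: bK P2_def)
  have id_int: "AE x in \<mu>. integrable (K x) (\<lambda>y. y)"
    using sq_int
  proof eventually_elim
    case (elim x)
    then show ?case
      using measurable_space[OF Km, of x] by (intro integrable_of_square) (auto simp: sp\<mu> space_prob_algebra)
  qed
  \<comment> \<open>The conditional mean of y - x in the direction b is orthogonal to all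
    \<open>f n\<close>, hence zero almost surely.\<close>
  have ortho: "AE x in \<mu>. (\<integral>y. b \<bullet> (y - x) \<partial>K x) = 0" if b: "b \<in> Basis" for b :: 'a
  proof (rule AE_zero_if_orthogonal_to_separating[OF p\<mu> _ f f_sep])
    have bu: "subquadratic (hedge (\<lambda>_. 0) (\<lambda>_. b))"
      by (rule subquadratic_hedge[OF sub0]) auto
    show "integrable \<mu> (\<lambda>x. \<integral>y. b \<bullet> (y - x) \<partial>K x)"
      using integral_joint_kernel_integrable[OF p\<mu> Km subquadratic_measurable[OF bu], folded \<pi>K, OF \<pi>i[OF bu]]
      by (simp add: hedge_def)
    fix n
    let ?u = "hedge (\<lambda>_. 0) (\<lambda>x. f n x *\<^sub>R b)"
    have su: "subquadratic ?u" using okb[of n b] by (intro subquadratic_hedge[OF sub0]) (auto simp: ok_def)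
    note um = subquadratic_measurable[OF su]
    have "(\<integral>x. f n x * (\<integral>y. b \<bullet> (y - x) \<partial>K x) \<partial>\<mu>) = (\<integral>x. \<integral>y. ?u (x, y) \<partial>K x \<partial>\<mu>)"
      by (simp add: hedge_def)
    also have "\<dots> = (\<integral>p. ?u p \<partial>\<pi>)"
      by (rule integral_joint_kernel[OF p\<mu> Km um, folded \<pi>K, OF \<pi>i[OF su], symmetric])
    also have "\<dots> = (\<integral>(x, y, z). ?u (x, y) \<partial>P)"
      unfolding \<pi>_def by (rule integral_law_of_xy[OF P(2) um])
    also have "\<dots> = (\<integral>y. 0 \<partial>\<nu>)" using b by (intro P(5)) (force simp: S_def)
    finally show "(\<integral>x. f n x * (\<integral>y. b \<bullet> (y - x) \<partial>K x) \<partial>\<mu>) = 0" by simp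
  qed
  have "AE x in \<mu>. \<forall>b\<in>Basis. (\<integral>y. b \<bullet> (y - x) \<partial>K x) = 0"
    using ortho by (simp add: AE_finite_all)
  then have mart: "AE x in \<mu>. (\<integral>y. y \<partial>K x) = x"
    using id_int
  proof eventually_elim
    case (elim x)
    interpret Kx: prob_space "K x"
      using measurable_space[OF Km, of x] by (simp add: sp\<mu> space_prob_algebra)
    show ?case
    proof (rule euclidean_eqI)
      fix b :: 'a assume "b \<in> Basis"
      then have "0 = (\<integral>y. b \<bullet> (y - x) \<partial>K x)" using elim(1) by simp
      also have "\<dots> = b \<bullet> (\<integral>y. y \<partial>K x) - b \<bullet> x"
        using elim(2) by (simp add: inner_diff_right Kx.prob_space)
      finally show "(\<integral>y. y \<partial>K x) \<bullet> b = x \<bullet> b" by (simp add: inner_commute)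
    qed
  qed
  have KMT: "K \<in> MT_kernels \<mu> \<nu>"
    using Km bK id_int mart by (auto simp: MT_kernels_def)
  have cint: "integrable P (\<lambda>w. fst (snd w) \<bullet> snd (snd w))"
    by (rule Pi) (rule subquadratic_inner)
  have cm: "(\<lambda>w. fst (snd w) \<bullet> snd (snd w)) \<in> borel_measurable (borel :: ('a \<times> 'a \<times> 'a) measure)" by simp
  note ck = integral_joint_kernel_integrable[OF p\<mu> \<kappa> cm, folded Pk, OF cint]
    integral_joint_kernel[OF p\<mu> \<kappa> cm, folded Pk, OF cint]
  have "ereal D \<le> ereal (\<integral>x. (\<integral>p. fst p \<bullet> snd p \<partial>\<kappa> x) \<partial>\<mu>)"
    using P(6) ck(2) by (simp add: case_prod_unfold)
  also have "\<dots> = eint \<mu> (\<lambda>x. ereal (\<integral>p. fst p \<bullet> snd p \<partial>\<kappa> x))"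
    using ck(1) by (intro eint_eq_integral[symmetric]) auto
  also have "\<dots> \<le> primal_obj q \<mu> K"
    unfolding primal_obj_def
  proof (rule eint_mono_AE)
    show "AE x in \<mu>. ereal (\<integral>p. fst p \<bullet> snd p \<partial>\<kappa> x) \<le> MCov (K x) q"
      using Zq
    proof eventually_elim
      case (elim x)
      have "sets (\<kappa> x) = sets borel"
        using measurable_space[OF \<kappa>, of x] by (simp add: sp\<mu> space_prob_algebra)
      then have "\<kappa> x \<in> Cpl (K x) q" using elim by (simp add: Cpl_def K_def)
      then show ?case unfolding MCov_def by (rule SUP_upper)
    qed
  qed
  finally have "ereal D \<le> primal_obj q \<mu> K" .
  then show thesis using that KMT by blast
qed

section \<open>Uniqueness\<close>

lemma joint_in_Cpl:
  fixes \<mu> \<nu> :: "'a::euclidean_space measure"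
  assumes "P2 \<mu>" and K: "K \<in> MT_kernels \<mu> \<nu>"
  shows "joint \<mu> K \<in> Cpl \<mu> \<nu>"
proof -
  have p\<mu>: "prob_space \<mu>" "sets \<mu> = sets borel" using assms by (auto simp: P2_def)
  have Km: "K \<in> measurable \<mu> (prob_algebra borel)" and b: "bind \<mu> K = \<nu>" using K by (auto simp: MT_kernels_def)
  show ?thesis
    using sets_joint_kernel[OF p\<mu> Km] distr_joint_kernel_fst[OF p\<mu> Km] distr_joint_kernel_snd[OF p\<mu> Km] b
    by (simp add: Cpl_def joint_def)
qed

text \<open>Weak duality when the law of (x, y) is fixed: \<open>dom\<close> is integrated over
  every coupling of \<open>K x\<close> with q, fibre by fibre. It bounds the dual values in the
  lifting of a given kernel.\<close>

lemma primal_obj_le_pair_potentials: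
  fixes \<mu> \<nu> q :: "'a::euclidean_space measure"
  assumes \<mu>: "P2 \<mu>" and \<nu>: "P2 \<nu>" and q: "P2 q" and K: "K \<in> MT_kernels \<mu> \<nu>"
    and u: "subquadratic u" and \<xi>: "subquadratic \<xi>"
    and dom: "\<And>x y z. y \<bullet> z \<le> u (x, y) + \<xi> (x, z)"
  shows "primal_obj q \<mu> K \<le> ereal ((\<integral>p. u p \<partial>joint \<mu> K) + (\<integral>p. \<xi> p \<partial>(\<mu> \<Otimes>\<^sub>M q)))"
proof -
  have p\<mu>: "prob_space \<mu>" "sets \<mu> = sets borel" using \<mu> by (auto simp: P2_def)
  have Km: "K \<in> measurable \<mu> (prob_algebra borel)" using K by (auto simp: MT_kernels_def)
  note C = joint_in_Cpl[OF \<mu> K]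
  interpret J: prob_space "joint \<mu> K" by (rule Cpl_prob_space[OF C \<mu> \<nu>])
  have sJ: "sets (joint \<mu> K) = sets borel" using C by (simp add: Cpl_def)
  have ui: "integrable (joint \<mu> K) u"
    by (rule subquadratic_integrable[OF u J.finite_measure_axioms sJ Cpl_second_moment[OF C \<mu> \<nu>]])
  note um = subquadratic_measurable[OF u]
  note uk = integral_joint_kernel_integrable[OF p\<mu> Km um, folded joint_def, OF ui]
    integral_joint_kernel[OF p\<mu> Km um, folded joint_def, OF ui]
  define A where "A x = (\<integral>y. u (x, y) \<partial>K x) + (\<integral>z. \<xi> (x, z) \<partial>q)" for x
  have Ai: "integrable \<mu> A"
    unfolding A_def[abs_def] using uk(1) integrable_section_integral[OF \<mu> q \<xi>] by simp
  have Ae: "(\<integral>x. A x \<partial>\<mu>) = (\<integral>p. u p \<partial>joint \<mu> K) + (\<integral>p. \<xi> p \<partial>(\<mu> \<Otimes>\<^sub>M q))"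
    unfolding A_def using uk integrable_section_integral[OF \<mu> q \<xi>] integral_section_integral[OF \<mu> q \<xi>] by simp
  have "primal_obj q \<mu> K \<le> eint \<mu> (\<lambda>x. ereal (A x))"
    unfolding primal_obj_def
  proof (rule eint_mono_AE)
    show "AE x in \<mu>. MCov (K x) q \<le> ereal (A x)"
      using MT_kernel_AE(1)[OF K \<nu>]
    proof eventually_elim
      case (elim x)
      then have Kx: "P2 (K x)" by simp
      show ?case unfolding MCov_def
      proof (rule SUP_least)
        fix \<gamma> assume \<gamma>: "\<gamma> \<in> Cpl (K x) q"
        have s: "sets \<gamma> = sets borel" and d: "distr \<gamma> borel fst = K x" "distr \<gamma> borel snd = q"
          using \<gamma> by (auto simp: Cpl_def)
        have m: "fst \<in> borel_measurable \<gamma>" "snd \<in> borel_measurable \<gamma>"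
          using borel_measurable_fst_snd measurable_cong_sets[OF s refl] by blast+
        note sec = subquadratic_section[OF u, of x] subquadratic_section[OF \<xi>, of x]
        note secm = subquadratic_measurable[OF sec(1)] subquadratic_measurable[OF sec(2)]
        have i: "integrable \<gamma> (\<lambda>p. u (x, fst p))" "integrable \<gamma> (\<lambda>p. \<xi> (x, snd p))"
          using integrable_distr_eq[OF m(1) secm(1)] integrable_distr_eq[OF m(2) secm(2)]
            P2_subquadratic_integrable[OF Kx sec(1)] P2_subquadratic_integrable[OF q sec(2)]
          by (auto simp: d)
        have "(\<integral>p. fst p \<bullet> snd p \<partial>\<gamma>) \<le> (\<integral>p. u (x, fst p) + \<xi> (x, snd p) \<partial>\<gamma>)"
          using i dom by (intro integral_mono Cpl_integrable[OF \<gamma> Kx q]) auto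
        also have "\<dots> = A x"
          using i integral_distr[OF m(1) secm(1)] integral_distr[OF m(2) secm(2)] by (simp add: d A_def)
        finally show "ereal (\<integral>p. fst p \<bullet> snd p \<partial>\<gamma>) \<le> ereal (A x)" by simp
      qed
    qed
  qed
  also have "\<dots> = ereal (\<integral>x. A x \<partial>\<mu>)" using Ai by (intro eint_eq_integral) auto
  finally show ?thesis by (simp add: Ae)
qed

text \<open>Duality for the problem with the law of \<open>(x, y)\<close> fixed takes the place of a measurable
  selection of optimal couplings of \<open>K x\<close> and \<open>q\<close>.\<close>

lemma optimal_lift:
  fixes \<mu> \<nu> q :: "'a::euclidean_space measure"
  assumes \<mu>: "P2 \<mu>" and \<nu>: "P2 \<nu>" and q: "P2 q" and K: "K \<in> MT_kernels \<mu> \<nu>"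
    and V: "ereal V \<le> primal_obj q \<mu> K"
  obtains P :: "('a \<times> 'a \<times> 'a) measure" where "prob_space P" "sets P = sets borel"
    "integrable P (\<lambda>w. (norm w)\<^sup>2)" "distr P borel (\<lambda>(x, y, z). (x, z)) = \<mu> \<Otimes>\<^sub>M q"
    "distr P borel (\<lambda>w. (fst w, fst (snd w))) = joint \<mu> K" "V \<le> (\<integral>(x, y, z). y \<bullet> z \<partial>P)"
proof -
  note C = joint_in_Cpl[OF \<mu> K]
  interpret J: prob_space "joint \<mu> K" by (rule Cpl_prob_space[OF C \<mu> \<nu>])
  have sJ: "sets (joint \<mu> K) = sets borel" and dJ: "distr (joint \<mu> K) borel snd = \<nu>" using C by (auto simp: Cpl_def)
  have sndJ: "snd \<in> borel_measurable (joint \<mu> K)"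
    using borel_measurable_fst_snd(2) measurable_cong_sets[OF sJ refl] by blast
  have ui: "integrable (joint \<mu> K) u" if "subquadratic u" for u
    by (rule subquadratic_integrable[OF that J.finite_measure_axioms sJ Cpl_second_moment[OF C \<mu> \<nu>]])
  note R = pair_prob_space_P2[OF \<mu> q] sets_pair_P2[OF \<mu> q] pair_second_moment[OF \<mu> q]
  obtain f :: "nat \<Rightarrow> 'a \<times> 'a \<Rightarrow> real" where f: "\<And>n. continuous_on UNIV (f n)"
    "\<And>n x. 0 \<le> f n x" "\<And>n x. f n x \<le> 1" and f_sep: "separates_measures f"
    by (rule separating_family_of_continuous_functions) (rule that)
  have fm: "f n \<in> borel_measurable borel" for n using f(1) by (rule borel_measurable_continuous_onI)
  have fsub: "subquadratic (f n)" for n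
    using f by (intro subquadratic_bounded[where C=1]) (auto simp: abs_le_iff intro: order_trans[of _ 0])
  have sub_snd: "subquadratic (\<lambda>p :: 'a \<times> 'a. g (snd p))" if "subquadratic g" for g :: "'a \<Rightarrow> real"
    using norm_le_norm_Pair(2) by (intro subquadratic_compose[OF that] continuous_intros) (auto simp: split_paired_all)
  define U where "U = {(u, \<integral>p. u p \<partial>joint \<mu> K) | u. subquadratic u}"
  obtain P :: "('a \<times> 'a \<times> 'a) measure" where P: "prob_space P" "sets P = sets borel"
    "integrable P (\<lambda>w. (norm w)\<^sup>2)" "distr P borel (\<lambda>(x, y, z). (x, z)) = \<mu> \<Otimes>\<^sub>M q"
    "\<And>u b. (u, b) \<in> range (\<lambda>n. (f n, \<integral>p. f n p \<partial>joint \<mu> K)) \<Longrightarrow> (\<integral>(x, y, z). u (x, y) \<partial>P) = b"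
    "V \<le> (\<integral>(x, y, z). y \<bullet> z \<partial>P)"
  proof (rule transport_duality[OF R, of U "\<integral>p. (norm (snd p))\<^sup>2 \<partial>joint \<mu> K"
        "\<lambda>n. \<integral>p. max 0 ((norm (snd p))\<^sup>2 - real n) \<partial>joint \<mu> K" V "range (\<lambda>n. (f n, \<integral>p. f n p \<partial>joint \<mu> K))"])
    show "((\<lambda>p. u p + u' p), b + b') \<in> U" if "(u, b) \<in> U" "(u', b') \<in> U" for u b u' b'
      using that ui by (auto simp: U_def subquadratic_add)
    show "((\<lambda>p. r * u p), r * b) \<in> U" if "(u, b) \<in> U" for u b r
      using that by (auto simp: U_def subquadratic_scale)
    show "subquadratic u" if "(u, b) \<in> U" for u b using that by (auto simp: U_def)
    show "((\<lambda>p. (norm (snd p))\<^sup>2), \<integral>p. (norm (snd p))\<^sup>2 \<partial>joint \<mu> K) \<in> U"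
      using sub_snd[OF subquadratic_norm_square] by (auto simp: U_def)
    show "((\<lambda>p. max 0 ((norm (snd p))\<^sup>2 - real n)), \<integral>p. max 0 ((norm (snd p))\<^sup>2 - real n) \<partial>joint \<mu> K) \<in> U" for n
      using sub_snd[OF subquadratic_tail[of "real n"]] by (auto simp: U_def)
    show "(\<lambda>n. \<integral>p. max 0 ((norm (snd p))\<^sup>2 - real n) \<partial>joint \<mu> K) \<longlonglongrightarrow> 0"
    proof -
      have "(\<integral>p. max 0 ((norm (snd p))\<^sup>2 - real n) \<partial>joint \<mu> K) = (\<integral>y. max 0 ((norm y)\<^sup>2 - real n) \<partial>\<nu>)" for n
        unfolding dJ[symmetric] by (rule integral_distr[OF sndJ, symmetric]) simp
      then show ?thesis using tail_integrals_tendsto_zero[OF \<nu>] by simp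
    qed
    show "V \<le> b + (\<integral>p. \<xi> p \<partial>(\<mu> \<Otimes>\<^sub>M q))"
      if "(u, b) \<in> U" "subquadratic \<xi>" and dom: "\<And>x y z. y \<bullet> z \<le> u (x, y) + \<xi> (x, z)" for u b \<xi>
    proof -
      have u: "subquadratic u" "b = (\<integral>p. u p \<partial>joint \<mu> K)" using that(1) by (auto simp: U_def)
      have "ereal V \<le> ereal (b + (\<integral>p. \<xi> p \<partial>(\<mu> \<Otimes>\<^sub>M q)))"
        using V primal_obj_le_pair_potentials[OF \<mu> \<nu> q K u(1) that(2) dom] unfolding u(2) by (rule order_trans)
      then show ?thesis by simp
    qed
    show "range (\<lambda>n. (f n, \<integral>p. f n p \<partial>joint \<mu> K)) \<subseteq> U" using fsub by (auto simp: U_def)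
    show "countable (range (\<lambda>n. (f n, \<integral>p. f n p \<partial>joint \<mu> K)))" by simp
  qed blast
  interpret P: prob_space P by fact
  show thesis
  proof (rule that[OF P(1-4) _ P(6)])
    show "distr P borel (\<lambda>w. (fst w, fst (snd w))) = joint \<mu> K"
    proof (rule f_sep[unfolded separates_measures_def, rule_format])
      have "(\<lambda>w. (fst w, fst (snd w))) \<in> borel_measurable (borel :: ('a \<times> 'a \<times> 'a) measure)"
        by (intro borel_measurable_continuous_onI continuous_intros)
      then have "(\<lambda>w. (fst w, fst (snd w))) \<in> borel_measurable P"
        using measurable_cong_sets[OF P(2) refl] by blast
      then show "finite_measure (distr P borel (\<lambda>w. (fst w, fst (snd w))))"
        by (rule P.finite_measure_distr)
      show "finite_measure (joint \<mu> K)" by (rule J.finite_measure_axioms)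
      show "(\<integral>p. f n p \<partial>distr P borel (\<lambda>w. (fst w, fst (snd w)))) = (\<integral>p. f n p \<partial>joint \<mu> K)" for n
        unfolding integral_law_of_xy[OF P(2) fm] by (rule P(5)) simp
    qed (simp_all add: sJ)
  qed
qed

text \<open>The expected gap of a dual triple under a lift is the dual value minus the expectation
  of y \<bullet> z, because the strategy h integrates to zero fibrewise.\<close>

lemma lift_dual_value:
  fixes \<mu> \<nu> q :: "'a::euclidean_space measure" and P :: "('a \<times> 'a \<times> 'a) measure"
  assumes \<mu>: "P2 \<mu>" and \<nu>: "P2 \<nu>" and q: "P2 q" and K: "K \<in> MT_kernels \<mu> \<nu>"
    and P: "prob_space P" "sets P = sets borel" "integrable P (\<lambda>w. (norm w)\<^sup>2)"
      "distr P borel (\<lambda>(x, y, z). (x, z)) = \<mu> \<Otimes>\<^sub>M q"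
      "distr P borel (\<lambda>w. (fst w, fst (snd w))) = joint \<mu> K"
    and \<phi>: "subquadratic \<phi>" and h: "continuous_on UNIV h" "bounded (range h)" and \<xi>: "subquadratic \<xi>"
  shows "integrable P (\<lambda>(x, y, z). \<phi> y + h x \<bullet> (y - x) + \<xi> (x, z) - y \<bullet> z)"
    and "(\<integral>(x, y, z). \<phi> y + h x \<bullet> (y - x) + \<xi> (x, z) - y \<bullet> z \<partial>P) =
      (\<integral>y. \<phi> y \<partial>\<nu>) + (\<integral>p. \<xi> p \<partial>(\<mu> \<Otimes>\<^sub>M q)) - (\<integral>(x, y, z). y \<bullet> z \<partial>P)"
proof -
  interpret P: prob_space P by fact
  have p\<mu>: "prob_space \<mu>" "sets \<mu> = sets borel" using \<mu> by (auto simp: P2_def)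
  have Km: "K \<in> measurable \<mu> (prob_algebra borel)" using K by (auto simp: MT_kernels_def)
  note C = joint_in_Cpl[OF \<mu> K]
  interpret J: prob_space "joint \<mu> K" by (rule Cpl_prob_space[OF C \<mu> \<nu>])
  have sJ: "sets (joint \<mu> K) = sets borel" and dJ: "distr (joint \<mu> K) borel snd = \<nu>" using C by (auto simp: Cpl_def)
  have sndJ: "snd \<in> borel_measurable (joint \<mu> K)"
    using borel_measurable_fst_snd(2) measurable_cong_sets[OF sJ refl] by blast
  have Ji: "integrable (joint \<mu> K) u" if "subquadratic u" for u
    by (rule subquadratic_integrable[OF that J.finite_measure_axioms sJ Cpl_second_moment[OF C \<mu> \<nu>]])
  have Pi: "integrable P g" if "subquadratic g" for g
    by (rule subquadratic_integrable[OF that P.finite_measure_axioms P(2,3)])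
  have sub_h: "subquadratic (hedge \<phi> h)" "subquadratic (hedge (\<lambda>_. 0) h)"
    using subquadratic_hedge[OF \<phi> h] subquadratic_hedge[OF _ h, of "\<lambda>_. 0"] subquadratic_bounded[of "\<lambda>_. 0" 0] by auto
  have "(\<integral>x. \<integral>y. hedge (\<lambda>_. 0) h (x, y) \<partial>K x \<partial>\<mu>) = (\<integral>x. 0 \<partial>\<mu>)"
  proof (rule integral_cong_AE)
    show "(\<lambda>x. \<integral>y. hedge (\<lambda>_. 0) h (x, y) \<partial>K x) \<in> borel_measurable \<mu>"
      using integral_joint_kernel_integrable[OF p\<mu> Km subquadratic_measurable[OF sub_h(2)], folded joint_def, OF Ji[OF sub_h(2)]] by simp
    show "AE x in \<mu>. (\<integral>y. hedge (\<lambda>_. 0) h (x, y) \<partial>K x) = 0"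
      using MT_kernel_AE(1)[OF K \<nu>]
    proof eventually_elim
      case (elim x)
      then interpret Kx: prob_space "K x" by (simp add: P2_def)
      have "integrable (K x) (\<lambda>y. y)" using elim by (intro integrable_of_square) (auto simp: P2_def)
      then show ?case using elim by (simp add: hedge_def Kx.prob_space)
    qed
  qed simp
  then have J0: "(\<integral>p. hedge (\<lambda>_. 0) h p \<partial>joint \<mu> K) = 0"
    using integral_joint_kernel[OF p\<mu> Km subquadratic_measurable[OF sub_h(2)], folded joint_def, OF Ji[OF sub_h(2)]] by simp
  have sub_snd: "subquadratic (\<lambda>p :: 'a \<times> 'a. \<phi> (snd p))"
    using norm_le_norm_Pair(2) by (intro subquadratic_compose[OF \<phi>] continuous_intros) (auto simp: split_paired_all)
  have "(\<integral>(x, y, z). hedge \<phi> h (x, y) \<partial>P) = (\<integral>p. hedge \<phi> h p \<partial>joint \<mu> K)"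
    unfolding P(5)[symmetric] by (rule integral_law_of_xy[OF P(2) subquadratic_measurable[OF sub_h(1)], symmetric])
  also have "\<dots> = (\<integral>p. \<phi> (snd p) + hedge (\<lambda>_. 0) h p \<partial>joint \<mu> K)" by (simp add: hedge_def)
  also have "\<dots> = (\<integral>p. \<phi> (snd p) \<partial>joint \<mu> K)" using Ji[OF sub_snd] Ji[OF sub_h(2)] J0 by simp
  also have "\<dots> = (\<integral>y. \<phi> y \<partial>\<nu>)"
    unfolding dJ[symmetric] by (rule integral_distr[OF sndJ subquadratic_measurable[OF \<phi>], symmetric])
  finally have e1: "(\<integral>w. hedge \<phi> h (fst w, fst (snd w)) \<partial>P) = (\<integral>y. \<phi> y \<partial>\<nu>)" by (simp add: case_prod_unfold)
  have "(\<lambda>(x, y, z). (x, z)) \<in> borel_measurable (borel :: ('a \<times> 'a \<times> 'a) measure)"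
    by (intro borel_measurable_continuous_onI) (auto simp: case_prod_unfold intro!: continuous_intros)
  then have prm: "(\<lambda>(x, y, z). (x, z)) \<in> borel_measurable P" using measurable_cong_sets[OF P(2) refl] by blast
  have e2: "(\<integral>w. \<xi> (fst w, snd (snd w)) \<partial>P) = (\<integral>p. \<xi> p \<partial>(\<mu> \<Otimes>\<^sub>M q))"
    unfolding P(4)[symmetric] using integral_distr[OF prm subquadratic_measurable[OF \<xi>]] by (simp add: case_prod_unfold)
  have i1: "integrable P (\<lambda>w. hedge \<phi> h (fst w, fst (snd w)))"
    using norm_triple_le(1) by (intro Pi subquadratic_compose[OF sub_h(1)] continuous_intros) (auto simp: split_paired_all)
  have i2: "integrable P (\<lambda>w. \<xi> (fst w, snd (snd w)))"
    using norm_triple_le(2) by (intro Pi subquadratic_compose[OF \<xi>] continuous_intros) (auto simp: split_paired_all)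
  have i3: "integrable P (\<lambda>w. fst (snd w) \<bullet> snd (snd w))"
    by (rule Pi) (rule subquadratic_inner)
  have eq: "(\<lambda>(x, y, z). \<phi> y + h x \<bullet> (y - x) + \<xi> (x, z) - y \<bullet> z) =
      (\<lambda>w. hedge \<phi> h (fst w, fst (snd w)) + \<xi> (fst w, snd (snd w)) - fst (snd w) \<bullet> snd (snd w))"
    by (auto simp: hedge_def)
  show "integrable P (\<lambda>(x, y, z). \<phi> y + h x \<bullet> (y - x) + \<xi> (x, z) - y \<bullet> z)"
    unfolding eq using i1 i2 i3 by simp
  show "(\<integral>(x, y, z). \<phi> y + h x \<bullet> (y - x) + \<xi> (x, z) - y \<bullet> z \<partial>P) =
      (\<integral>y. \<phi> y \<partial>\<nu>) + (\<integral>p. \<xi> p \<partial>(\<mu> \<Otimes>\<^sub>M q)) - (\<integral>(x, y, z). y \<bullet> z \<partial>P)"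
    unfolding eq using i1 i2 i3 e1 e2 by (simp add: case_prod_unfold)
qed

text \<open>The exceptional set is never projected as a Borel set: inner regularity replaces it by compact
  sets, whose projections are compact.\<close>

lemma emeasure_le_of_monotone_sections:
  fixes M1 M2 :: "('a::euclidean_space \<times> 'a \<times> 'a) measure" and \<mu> q :: "'a measure"
  assumes \<mu>: "P2 \<mu>" and q: "P2 q" and small: "no_mass_small_sets q"
    and M1: "prob_space M1" "sets M1 = sets borel" "distr M1 borel (\<lambda>(x, y, z). (x, z)) = \<mu> \<Otimes>\<^sub>M q"
    and M2: "prob_space M2" "sets M2 = sets borel" "distr M2 borel (\<lambda>(x, y, z). (x, z)) = \<mu> \<Otimes>\<^sub>M q"
    and \<Gamma>: "\<Gamma> \<in> sets borel" "AE w in M1. w \<in> \<Gamma>" "AE w in M2. w \<in> \<Gamma>"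
    and mono: "\<And>x y z y' z'. (x, y, z) \<in> \<Gamma> \<Longrightarrow> (x, y', z') \<in> \<Gamma> \<Longrightarrow> 0 \<le> (z - z') \<bullet> (y - y')"
    and B: "B \<in> sets borel"
  shows "emeasure M1 B \<le> emeasure M2 B"
proof -
  let ?pr = "\<lambda>(x :: 'a, y :: 'a, z :: 'a). (x, z)"
  interpret M1: prob_space M1 by fact
  interpret M2: prob_space M2 by fact
  interpret q: prob_space q using q by (simp add: P2_def)
  have cpr: "continuous_on S ?pr" for S :: "('a \<times> 'a \<times> 'a) set"
    by (auto simp: case_prod_unfold intro!: continuous_intros)
  have mpr[measurable]: "?pr \<in> borel_measurable borel" by (rule borel_measurable_continuous_onI[OF cpr])
  have sq: "sets q = sets borel" using q by (simp add: P2_def)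
  have marg: "emeasure P (?pr -` L) = emeasure (\<mu> \<Otimes>\<^sub>M q) L"
    if "sets P = sets borel" "distr P borel ?pr = \<mu> \<Otimes>\<^sub>M q" "L \<in> sets borel" for P L
  proof -
    have "?pr \<in> borel_measurable P" using mpr measurable_cong_sets[OF that(1) refl] by blast
    moreover have "space P = UNIV" using sets_eq_imp_space_eq[OF that(1)] by simp
    ultimately show ?thesis unfolding that(2)[symmetric] using that(3) by (subst emeasure_distr) auto
  qed
  have main: "emeasure M1 C \<le> emeasure M2 B" if C: "C \<subseteq> B \<inter> \<Gamma>" "compact C" for C
  proof -
    define L where "L = ?pr ` C"
    have L: "compact L" unfolding L_def by (rule compact_continuous_image[OF cpr C(2)])
    then have Lb: "L \<in> sets borel" by (rule borel_compact)
    have vL: "?pr -` L \<in> sets borel" using measurable_sets[OF mpr Lb] by simp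
    have Cb: "C \<in> sets borel" using C(2) by (rule borel_compact)
    \<comment> \<open>Points of \<Gamma> that share their (x, z) with a point of C without lying in
      C: exactly the places where y is not determined.\<close>
    define E where "E = (?pr -` L \<inter> \<Gamma>) - C"
    have Eb: "E \<in> sets borel" unfolding E_def using vL \<Gamma>(1) Cb by auto
    have "emeasure M2 E \<le> 0"
    proof (subst inner_regular[OF M2(2) _ Eb])
      show "emeasure M2 (space M2) \<noteq> \<infinity>" by (simp add: M2.emeasure_eq_measure)
      show "(SUP K\<in>{K. K \<subseteq> E \<and> compact K}. emeasure M2 K) \<le> 0"
      proof (rule SUP_least, clarify)
        fix K assume K: "K \<subseteq> E" "compact K"
        define T where "T = ?pr ` K"
        have T: "compact T" unfolding T_def by (rule compact_continuous_image[OF cpr K(2)])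
        then have Mb: "T \<in> sets borel" by (rule borel_compact)
        have vM: "?pr -` T \<in> sets borel" using measurable_sets[OF mpr Mb] by simp
        \<comment> \<open>Over such an (x, z) there are two values of y, one from K outside C and
          one from C, so the section is a set where a monotone relation is multivalued.\<close>
        have sect: "emeasure q (Pair x -` T) = 0" for x
        proof -
          have "compact (Pair x -` T)"
          proof -
            have "Pair x -` T = snd ` (T \<inter> ({x} \<times> UNIV))" by force
            moreover have "closed ({x} \<times> (UNIV :: 'a set))" by (intro closed_Times) auto
            then have "compact (T \<inter> ({x} \<times> UNIV))" using T by (rule compact_Int_closed[rotated])
            ultimately show ?thesis
              by (simp add: compact_continuous_image continuous_on_snd)
          qed
          then have "Pair x -` T \<in> sets q" using sq borel_compact by blast
          moreover have "hausdorff_dim (Pair x -` T) \<le> real DIM('a) - 1"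
          proof (rule hausdorff_dim_multivalued_monotone[of "{(z, y). (x, y, z) \<in> \<Gamma>}"])
            show "0 \<le> (z - z') \<bullet> (y - y')" if "(z, y) \<in> {(z, y). (x, y, z) \<in> \<Gamma>}" "(z', y') \<in> {(z, y). (x, y, z) \<in> \<Gamma>}" for z y z' y'
              using mono that by blast
            show "\<exists>y y'. y \<noteq> y' \<and> (z, y) \<in> {(z, y). (x, y, z) \<in> \<Gamma>} \<and> (z, y') \<in> {(z, y). (x, y, z) \<in> \<Gamma>}"
              if "z \<in> Pair x -` T" for z
            proof -
              from that obtain y where y: "(x, y, z) \<in> K" by (auto simp: T_def)
              then have yE: "(x, y, z) \<in> \<Gamma>" "(x, z) \<in> L" "(x, y, z) \<notin> C" using K(1) by (auto simp: E_def)
              then obtain y' where "(x, y', z) \<in> C" by (auto simp: L_def)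
              then have "(x, y', z) \<in> \<Gamma>" "y \<noteq> y'" using yE C(1) by auto
              then show ?thesis using yE(1) by (intro exI[of _ y] exI[of _ y']) simp
            qed
          qed
          ultimately show ?thesis using small by (auto simp: no_mass_small_sets_def)
        qed
        have "emeasure M2 K \<le> emeasure M2 (?pr -` T)"
          using vM M2(2) by (intro emeasure_mono) (auto simp: T_def)
        also have "\<dots> = emeasure (\<mu> \<Otimes>\<^sub>M q) T" by (rule marg[OF M2(2,3) Mb])
        also have "\<dots> = (\<integral>\<^sup>+x. emeasure q (Pair x -` T) \<partial>\<mu>)"
          using Mb sets_pair_P2[OF \<mu> q] by (intro q.emeasure_pair_measure_alt) simp
        also have "\<dots> = 0" by (simp add: sect)
        finally show "emeasure M2 K \<le> 0" .
      qed
    qed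
    then have E0: "emeasure M2 E = 0" by simp
    \<comment> \<open>Both measures give the preimage of L the same mass since they share the law of
      (x, z); under M2 this mass sits on C up to the null set E.\<close>
    have "emeasure M1 C \<le> emeasure M1 (?pr -` L)"
      using vL M1(2) by (intro emeasure_mono) (auto simp: L_def)
    also have "\<dots> = emeasure M2 (?pr -` L)" using marg[OF M1(2,3) Lb] marg[OF M2(2,3) Lb] by simp
    also have "\<dots> = emeasure M2 (?pr -` L \<inter> \<Gamma>)"
      using \<Gamma> vL M2(2) by (intro emeasure_eq_AE) auto
    also have "\<dots> \<le> emeasure M2 (C \<union> E)"
    proof (rule emeasure_mono)
      show "?pr -` L \<inter> \<Gamma> \<subseteq> C \<union> E" unfolding E_def by blast
      show "C \<union> E \<in> sets M2" unfolding M2(2) by (rule sets.Un[OF Cb Eb])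
    qed
    also have "\<dots> \<le> emeasure M2 C + emeasure M2 E"
      using Cb Eb unfolding M2(2)[symmetric] by (rule emeasure_subadditive)
    also have "\<dots> = emeasure M2 C" using E0 by simp
    also have "\<dots> \<le> emeasure M2 B"
    proof (rule emeasure_mono)
      show "C \<subseteq> B" using C(1) by blast
      show "B \<in> sets M2" unfolding M2(2) by (rule B)
    qed
    finally show ?thesis .
  qed
  have "emeasure M1 B = emeasure M1 (B \<inter> \<Gamma>)"
    using \<Gamma> B M1(2) by (intro emeasure_eq_AE) auto
  also have "\<dots> = (SUP C\<in>{C. C \<subseteq> B \<inter> \<Gamma> \<and> compact C}. emeasure M1 C)"
    using B \<Gamma>(1) by (intro inner_regular[OF M1(2)]) (auto simp: M1.emeasure_eq_measure)
  also have "\<dots> \<le> emeasure M2 B" using main by (intro SUP_least) auto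
  finally show ?thesis .
qed

lemma measure_eq_of_monotone_sections:
  fixes M1 M2 :: "('a::euclidean_space \<times> 'a \<times> 'a) measure" and \<mu> q :: "'a measure"
  assumes \<mu>: "P2 \<mu>" and q: "P2 q" and small: "no_mass_small_sets q"
    and M1: "prob_space M1" "sets M1 = sets borel" "distr M1 borel (\<lambda>(x, y, z). (x, z)) = \<mu> \<Otimes>\<^sub>M q"
    and M2: "prob_space M2" "sets M2 = sets borel" "distr M2 borel (\<lambda>(x, y, z). (x, z)) = \<mu> \<Otimes>\<^sub>M q"
    and \<Gamma>: "\<Gamma> \<in> sets borel" "AE w in M1. w \<in> \<Gamma>" "AE w in M2. w \<in> \<Gamma>"
    and mono: "\<And>x y z y' z'. (x, y, z) \<in> \<Gamma> \<Longrightarrow> (x, y', z') \<in> \<Gamma> \<Longrightarrow> 0 \<le> (z - z') \<bullet> (y - y')"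
  shows "M1 = M2"
proof (rule measure_eqI)
  show "sets M1 = sets M2" using M1 M2 by simp
  fix B assume "B \<in> sets M1"
  then have B: "B \<in> sets borel" using M1 by simp
  show "emeasure M1 B = emeasure M2 B"
    using emeasure_le_of_monotone_sections[OF \<mu> q small M1 M2 \<Gamma>(1,2,3) mono B]
      emeasure_le_of_monotone_sections[OF \<mu> q small M2 M1 \<Gamma>(1,3,2) mono B] by (rule antisym)
qed

lemma optimal_plan_unique:
  fixes \<mu> \<nu> q :: "'a::euclidean_space measure"
  assumes \<mu>: "P2 \<mu>" and \<nu>: "P2 \<nu>" and q: "P2 q" and small: "no_mass_small_sets q"
    and K: "K1 \<in> MT_kernels \<mu> \<nu>" "K2 \<in> MT_kernels \<mu> \<nu>"
    and V: "ereal V \<le> primal_obj q \<mu> K1" "ereal V \<le> primal_obj q \<mu> K2"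
    and dual: "\<And>\<epsilon>. 0 < \<epsilon> \<Longrightarrow> \<exists>\<phi> h \<xi>. subquadratic \<phi> \<and> continuous_on UNIV h \<and> bounded (range h) \<and> subquadratic \<xi> \<and>
      (\<forall>x y z. y \<bullet> z \<le> \<phi> y + h x \<bullet> (y - x) + \<xi> (x, z)) \<and>
      (\<integral>y. \<phi> y \<partial>\<nu>) + (\<integral>p. \<xi> p \<partial>(\<mu> \<Otimes>\<^sub>M q)) < V + \<epsilon>"
  shows "joint \<mu> K1 = joint \<mu> K2"
proof -
  \<comment> \<open>Errors that sum to 1 make the expected sum of all gaps finite, so the gaps tend
    to 0 almost surely along the whole sequence.\<close>
  have "\<forall>n. \<exists>\<phi> h \<xi>. subquadratic \<phi> \<and> continuous_on UNIV h \<and> bounded (range h) \<and> subquadratic \<xi> \<and>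
      (\<forall>x y z. y \<bullet> z \<le> \<phi> y + h x \<bullet> (y - x) + \<xi> (x, z)) \<and>
      (\<integral>y. \<phi> y \<partial>\<nu>) + (\<integral>p. \<xi> p \<partial>(\<mu> \<Otimes>\<^sub>M q)) < V + (1/2) ^ Suc n"
    by (intro allI dual) simp
  then obtain \<phi> h \<xi> where sub: "\<And>n. subquadratic (\<phi> n)" "\<And>n. continuous_on UNIV (h n)" "\<And>n. bounded (range (h n))"
    "\<And>n. subquadratic (\<xi> n)" and dom: "\<And>n x y z. y \<bullet> z \<le> \<phi> n y + h n x \<bullet> (y - x) + \<xi> n (x, z)"
    and val: "\<And>n. (\<integral>y. \<phi> n y \<partial>\<nu>) + (\<integral>p. \<xi> n p \<partial>(\<mu> \<Otimes>\<^sub>M q)) < V + (1/2) ^ Suc n"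
    by metis
  define gap where "gap n = (\<lambda>(x, y, z). \<phi> n y + h n x \<bullet> (y - x) + \<xi> n (x, z) - y \<bullet> z)" for n
  have gap0: "0 \<le> gap n w" for n w using dom by (cases w) (simp add: gap_def)
  have gapm[measurable]: "gap n \<in> borel_measurable borel" for n
  proof (rule borel_measurable_continuous_onI)
    have "continuous_on UNIV (\<lambda>w :: 'a \<times> 'a \<times> 'a. \<phi> n (fst (snd w)))"
      by (rule continuous_on_compose2[OF subquadratic_continuous[OF sub(1)]]) (auto intro!: continuous_intros)
    moreover have "continuous_on UNIV (\<lambda>w :: 'a \<times> 'a \<times> 'a. h n (fst w))"
      by (rule continuous_on_compose2[OF sub(2)]) (auto intro!: continuous_intros)
    moreover have "continuous_on UNIV (\<lambda>w :: 'a \<times> 'a \<times> 'a. \<xi> n (fst w, snd (snd w)))"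
      by (rule continuous_on_compose2[OF subquadratic_continuous[OF sub(4)]]) (auto intro!: continuous_intros)
    ultimately show "continuous_on UNIV (gap n)"
      unfolding gap_def case_prod_unfold by (intro continuous_intros)
  qed
  \<comment> \<open>Summability is asked for instead of mere convergence to 0: it is a Borel
    condition on one nonnegative function, with integral bounded by the errors.\<close>
  define \<Gamma> where "\<Gamma> = {w. (\<Sum>n. ennreal (gap n w)) \<noteq> \<infinity>}"
  have \<Gamma>m: "\<Gamma> \<in> sets borel" unfolding \<Gamma>_def by measurable
  have \<Gamma>lim: "(\<lambda>n. gap n w) \<longlonglongrightarrow> 0" if "w \<in> \<Gamma>" for w
    using that gap0 by (intro summable_LIMSEQ_zero summable_suminf_not_top) (auto simp: \<Gamma>_def)
  have mono: "0 \<le> (z - z') \<bullet> (y - y')" if "(x, y, z) \<in> \<Gamma>" "(x, y', z') \<in> \<Gamma>" for x y z y' z'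
  proof (rule LIMSEQ_le_const)
    have "(\<lambda>n. gap n (x, y, z) + gap n (x, y', z') + (z - z') \<bullet> (y - y')) \<longlonglongrightarrow> 0 + 0 + (z - z') \<bullet> (y - y')"
      by (intro tendsto_intros \<Gamma>lim that)
    then show "(\<lambda>n. gap n (x, y, z) + gap n (x, y', z') + (z - z') \<bullet> (y - y')) \<longlonglongrightarrow> (z - z') \<bullet> (y - y')" by simp
    \<comment> \<open>Two triples over the same x exchange their z: the terms with \<phi>, h and
      \<xi> match, only the inner products change, and the exchanged gaps are nonnegative.\<close>
    have "gap n (x, y, z) + gap n (x, y', z') + (z - z') \<bullet> (y - y') = gap n (x, y', z) + gap n (x, y, z')" for n
      by (simp add: gap_def inner_diff_left inner_diff_right inner_commute)
    then show "\<exists>N. \<forall>n\<ge>N. 0 \<le> gap n (x, y, z) + gap n (x, y', z') + (z - z') \<bullet> (y - y')"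
      using gap0 by simp
  qed
  have concentrated: "AE w in P. w \<in> \<Gamma>"
    if K: "K \<in> MT_kernels \<mu> \<nu>"
    and P: "prob_space P" "sets P = sets borel" "integrable P (\<lambda>w. (norm w)\<^sup>2)"
      "distr P borel (\<lambda>(x, y, z). (x, z)) = \<mu> \<Otimes>\<^sub>M q"
      "distr P borel (\<lambda>w. (fst w, fst (snd w))) = joint \<mu> K" "V \<le> (\<integral>(x, y, z). y \<bullet> z \<partial>P)" for K P
  proof -
    have [measurable_cong]: "sets P = sets borel" by fact
    have ld: "integrable P (gap n)" "(\<integral>w. gap n w \<partial>P) =
        (\<integral>y. \<phi> n y \<partial>\<nu>) + (\<integral>p. \<xi> n p \<partial>(\<mu> \<Otimes>\<^sub>M q)) - (\<integral>(x, y, z). y \<bullet> z \<partial>P)" for n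
      unfolding gap_def by (rule lift_dual_value[OF \<mu> \<nu> q K P(1-5) sub(1-4)])+
    have "(\<integral>\<^sup>+w. (\<Sum>n. ennreal (gap n w)) \<partial>P) = (\<Sum>n. \<integral>\<^sup>+w. ennreal (gap n w) \<partial>P)"
      by (rule nn_integral_suminf) simp
    also have "\<dots> \<le> (\<Sum>n. ennreal ((1/2) ^ Suc n))"
    proof (rule suminf_le)
      fix n
      have "(\<integral>\<^sup>+w. ennreal (gap n w) \<partial>P) = ennreal (\<integral>w. gap n w \<partial>P)"
        using gap0 by (intro nn_integral_eq_integral ld(1)) auto
      also have "\<dots> \<le> ennreal ((1/2) ^ Suc n)"
        using ld(2)[of n] val[of n] P(6) by (intro ennreal_leI) simp
      finally show "(\<integral>\<^sup>+w. ennreal (gap n w) \<partial>P) \<le> ennreal ((1/2) ^ Suc n)" .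
    qed auto
    also have "\<dots> = ennreal 1"
      by (rule suminf_ennreal_eq[OF _ power_half_series]) simp
    finally have "(\<integral>\<^sup>+w. (\<Sum>n. ennreal (gap n w)) \<partial>P) \<noteq> \<infinity>" by (auto simp: top_unique)
    then show ?thesis unfolding \<Gamma>_def by (subst mem_Collect_eq) (rule nn_integral_PInf_AE, auto)
  qed
  obtain M1 :: "('a \<times> 'a \<times> 'a) measure" where M1: "prob_space M1" "sets M1 = sets borel" "integrable M1 (\<lambda>w. (norm w)\<^sup>2)"
      "distr M1 borel (\<lambda>(x, y, z). (x, z)) = \<mu> \<Otimes>\<^sub>M q"
      "distr M1 borel (\<lambda>w. (fst w, fst (snd w))) = joint \<mu> K1" "V \<le> (\<integral>(x, y, z). y \<bullet> z \<partial>M1)"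
    by (rule optimal_lift[OF \<mu> \<nu> q K(1) V(1)])
  obtain M2 :: "('a \<times> 'a \<times> 'a) measure" where M2: "prob_space M2" "sets M2 = sets borel" "integrable M2 (\<lambda>w. (norm w)\<^sup>2)"
      "distr M2 borel (\<lambda>(x, y, z). (x, z)) = \<mu> \<Otimes>\<^sub>M q"
      "distr M2 borel (\<lambda>w. (fst w, fst (snd w))) = joint \<mu> K2" "V \<le> (\<integral>(x, y, z). y \<bullet> z \<partial>M2)"
    by (rule optimal_lift[OF \<mu> \<nu> q K(2) V(2)])
  have "M1 = M2"
    by (rule measure_eq_of_monotone_sections[OF \<mu> q small M1(1,2,4) M2(1,2,4) \<Gamma>m
          concentrated[OF K(1) M1] concentrated[OF K(2) M2] mono])
  then show ?thesis using M1(5) M2(5) by simp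
qed

theorem theorem1p1:
  fixes \<mu> \<nu> q :: "'a::euclidean_space measure"
  assumes "P2 \<mu>" and "P2 \<nu>" and "P2 q"
    and "convex_order \<mu> \<nu>"
    and "no_mass_small_sets q"
  shows "(\<exists>K\<in>MT_kernels \<mu> \<nu>. primal_obj q \<mu> K = Pq q \<mu> \<nu>)
       \<and> (\<forall>K1\<in>MT_kernels \<mu> \<nu>. \<forall>K2\<in>MT_kernels \<mu> \<nu>.
            primal_obj q \<mu> K1 = Pq q \<mu> \<nu> \<and> primal_obj q \<mu> K2 = Pq q \<mu> \<nu>
            \<longrightarrow> joint \<mu> K1 = joint \<mu> K2)
       \<and> \<bar>Pq q \<mu> \<nu>\<bar> \<noteq> \<infinity>
       \<and> Pq q \<mu> \<nu> = Dq q \<mu> \<nu>"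
proof -
  note \<mu> = assms(1) and \<nu> = assms(2) and q = assms(3)
  \<comment> \<open>The dual is first posed over regular triples. Its infimum V turns out to equal
    \<open>Dq\<close>.\<close>
  define feasible where "feasible \<phi> h \<xi> \<longleftrightarrow> subquadratic \<phi> \<and> continuous_on UNIV h \<and> bounded (range h) \<and>
    subquadratic \<xi> \<and> (\<forall>x y z. y \<bullet> z \<le> \<phi> y + h x \<bullet> (y - x) + \<xi> (x, z))"
    for \<phi> :: "'a \<Rightarrow> real" and h :: "'a \<Rightarrow> 'a" and \<xi> :: "'a \<times> 'a \<Rightarrow> real"
  define vals where "vals = {(\<integral>y. \<phi> y \<partial>\<nu>) + (\<integral>p. \<xi> p \<partial>(\<mu> \<Otimes>\<^sub>M q)) | \<phi> h \<xi>. feasible \<phi> h \<xi>}"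
  \<comment> \<open>Feasibility of squared norms rests on y \<bullet> z being at most the sum of the
    squares of the norms.\<close>
  have "feasible (\<lambda>y. (norm y)\<^sup>2) (\<lambda>_. 0) (\<lambda>p. (norm p)\<^sup>2)"
    unfolding feasible_def
  proof (intro conjI allI)
    fix x y z :: 'a
    show "y \<bullet> z \<le> (norm y)\<^sup>2 + 0 \<bullet> (y - x) + (norm (x, z))\<^sup>2"
      using abs_inner_le_squares[of y z] abs_ge_self[of "y \<bullet> z"] zero_le_power2[of "norm x"]
      unfolding norm_Pair_square inner_zero_left by linarith
  qed (auto intro: subquadratic_norm_square)
  then have ne: "vals \<noteq> {}" unfolding vals_def by blast
  have bdd: "bdd_below vals"
  proof (rule bdd_belowI)
    fix v assume "v \<in> vals"
    then show "(\<integral>x. x \<partial>\<mu>) \<bullet> (\<integral>z. z \<partial>q) \<le> v"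
      unfolding vals_def feasible_def using dual_value_bounded_below[OF \<mu> \<nu> q assms(4)] by blast
  qed
  define V where "V = Inf vals"
  have Vle: "V \<le> (\<integral>y. \<phi> y \<partial>\<nu>) + (\<integral>p. \<xi> p \<partial>(\<mu> \<Otimes>\<^sub>M q))" if "feasible \<phi> h \<xi>" for \<phi> h \<xi>
    unfolding V_def using that by (intro cInf_lower bdd) (auto simp: vals_def)
  obtain K where K: "K \<in> MT_kernels \<mu> \<nu>" "ereal V \<le> primal_obj q \<mu> K"
  proof (rule primal_candidate[OF \<mu> \<nu> q, of V])
    show "V \<le> (\<integral>y. \<phi> y \<partial>\<nu>) + (\<integral>p. \<xi> p \<partial>(\<mu> \<Otimes>\<^sub>M q))"
      if "subquadratic \<phi>" "continuous_on UNIV h" "bounded (range h)" "subquadratic \<xi>"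
        "\<And>x y z. y \<bullet> z \<le> \<phi> y + h x \<bullet> (y - x) + \<xi> (x, z)" for \<phi> h \<xi>
      by (rule Vle[of \<phi> h \<xi>]) (use that in \<open>auto simp: feasible_def\<close>)
  qed
  have Dv: "Dq q \<mu> \<nu> \<le> ereal v" if "v \<in> vals" for v
    using that dual_value_ge_Dq[OF \<mu> \<nu> q] unfolding vals_def feasible_def by blast
  have DV: "Dq q \<mu> \<nu> \<le> ereal V"
  proof (cases "Dq q \<mu> \<nu>")
    case (real d)
    then have "d \<le> V" unfolding V_def using Dv by (intro cInf_greatest[OF ne]) auto
    then show ?thesis using real by simp
  next
    case PInf
    then show ?thesis using Dv ne by auto
  qed simp
  have PD: "Pq q \<mu> \<nu> \<le> Dq q \<mu> \<nu>"
    unfolding Pq_def Dq_def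
    by (intro SUP_least INF_greatest) (auto intro: weak_duality[OF _ \<mu> \<nu> q])
  have KP: "primal_obj q \<mu> K \<le> Pq q \<mu> \<nu>" unfolding Pq_def by (rule SUP_upper[OF K(1)])
  \<comment> \<open>The circle: V is at most the value of K, which is at most \<open>Pq\<close>,
    then \<open>Dq\<close>, then V again.\<close>
  have PV: "Pq q \<mu> \<nu> = ereal V" and DVe: "Dq q \<mu> \<nu> = ereal V" and KV: "primal_obj q \<mu> K = ereal V"
    using K(2) KP PD DV by auto
  have unique: "joint \<mu> K1 = joint \<mu> K2"
    if "K1 \<in> MT_kernels \<mu> \<nu>" "K2 \<in> MT_kernels \<mu> \<nu>" "primal_obj q \<mu> K1 = ereal V" "primal_obj q \<mu> K2 = ereal V" for K1 K2
  proof (rule optimal_plan_unique[OF \<mu> \<nu> q assms(5) that(1,2), of V])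
    fix \<epsilon> :: real assume "0 < \<epsilon>"
    then obtain v where "v \<in> vals" "v < V + \<epsilon>"
      using cInf_lessD[OF ne, of "V + \<epsilon>"] unfolding V_def by auto
    then show "\<exists>\<phi> h \<xi>. subquadratic \<phi> \<and> continuous_on UNIV h \<and> bounded (range h) \<and> subquadratic \<xi> \<and>
      (\<forall>x y z. y \<bullet> z \<le> \<phi> y + h x \<bullet> (y - x) + \<xi> (x, z)) \<and>
      (\<integral>y. \<phi> y \<partial>\<nu>) + (\<integral>p. \<xi> p \<partial>(\<mu> \<Otimes>\<^sub>M q)) < V + \<epsilon>"
      unfolding vals_def feasible_def by blast
  qed (use that in auto)
  show ?thesis
  proof (intro conjI ballI impI)
    show "\<exists>K\<in>MT_kernels \<mu> \<nu>. primal_obj q \<mu> K = Pq q \<mu> \<nu>"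
      using K(1) KV PV by (intro bexI[of _ K]) simp_all
    fix K1 K2
    assume "K1 \<in> MT_kernels \<mu> \<nu>" "K2 \<in> MT_kernels \<mu> \<nu>"
      and "primal_obj q \<mu> K1 = Pq q \<mu> \<nu> \<and> primal_obj q \<mu> K2 = Pq q \<mu> \<nu>"
    then show "joint \<mu> K1 = joint \<mu> K2" by (intro unique) (simp_all add: PV)
  qed (simp_all add: PV DVe)
qed

end
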